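(* Let $\mathcal{I}$ be the unit 2-ring. The forgetful functor $\mathcal{I}\text{-Mod}\to SPC$, $(\mathcal{M},\dots)\mapsto\mathcal{M}$, $(H,\delta)\mapsto H$, is part of an equivalence of categories. Its equivalence inverse factors as $$SPC\xrightarrow{\ \cong\ }\mathcal{I}\text{-Mod}^s\xrightarrow{\ inc\ }\mathcal{I}\text{-Mod},$$ where the left functor is an isomorphism between $SPC$ and the full subcategory $\mathcal{I}\text{-Mod}^s$ of $\mathcal{I}\text{-Mod}$ generated by the strict modules, and $inc$ is the inclusion functor.
   Context: A symmetric Picard category is a symmetric monoidal category whose underlying category is a groupoid, with a chosen object $a^{\bullet}$ and isomorphism $j_a:I\to a^{\bullet}\otimes a$ for each object $a$. $SPC$ is the 2-category of symmetric Picard categories, symmetric monoidal functors and monoidal natural transformations (in the claim, $SPC$ means its underlying category). An arrow $F$ of $SPC$ is strict if it preserves the monoidal structure strictly and $F(a^\bullet)=(Fa)^\bullet$, $F(j_a)=j_{Fa}$. $[\mathcal{B},\mathcal{C}]$ is the internal hom: symmetric monoidal functors and monoidal transformations, with symmetric Picard structure given pointwise by that of $\mathcal{C}$. An $n$-linear map $\mathcal{A}_1\times\dots\times\mathcal{A}_n\to\mathcal{B}$ is an object of $[\mathcal{A}_1,[\mathcal{A}_2,\dots,[\mathcal{A}_n,\mathcal{B}]\dots]]$, and an $n$-linear natural transformation is an arrow there. $\mathcal{I}$ is the free symmetric Picard category on one generator $\star$: for every symmetric Picard category $\mathcal{B}$ and object $b$ of $\mathcal{B}$ there is a unique strict arrow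 $\mathcal{I}\to\mathcal{B}$ sending $\star$ to $b$; in particular $v:\mathcal{I}\to[\mathcal{A},\mathcal{A}]$ denotes the unique strict arrow with $v(\star)=1_{\mathcal{A}}$. The unit 2-ring structure on $\mathcal{I}$ has multiplication $t_1.t_2=v(t_1)(t_2)$ (with $v:\mathcal{I}\to[\mathcal{I},\mathcal{I}]$) and unit $\star$; it is strictly associative and unital. An $\mathcal{I}$-module consists of a symmetric Picard category $\mathcal{M}$ with an arrow $\varphi':\mathcal{I}\to[\mathcal{M},\mathcal{M}]$ of $SPC$ (write $t\times m=\varphi'(t)(m)$), a trilinear natural transformation $\beta_{t_1,t_2,m}:t_1\times(t_2\times m)\to(t_1.t_2)\times m$ and a linear natural transformation $\gamma_m:m\to\star\times m$ such that, for all objects, $\beta_{t_1.t_2,t_3,m}\circ\beta_{t_1,t_2,t_3\times m}=\beta_{t_1,t_2.t_3,m}\circ(t_1\times\beta_{t_2,t_3,m})$, $\beta_{t,\star,m}\circ(t\times\gamma_m)=\mathrm{id}_{t\times m}$ and $\beta_{\star,t,m}\circ\gamma_{t\times m}=\mathrm{id}_{t\times m}$. It is strict when $\varphi'$ is a strict arrow and $\beta$ and $\gamma$ are identities. A morphism of $\mathcal{I}$-modules $(H,\delta):\mathcal{M}\to\mathcal{N}$ is an arrow $H:\mathcal{M}\to\mathcal{N}$ of $SPC$ with a bilinear natural transformation $\delta_{t,m}:t\times H(m)\to H(t\times m)$ such that $H(\gamma_m)=\delta_{\star,m}\circ\gamma_{H(m)}$ and $\delta_{t_1.t_2,m}\circ\beta_{t_1,t_2,H(m)}=H(\beta_{t_1,t_2,m})\circ\delta_{t_1,t_2\times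 m}\circ(t_1\times\delta_{t_2,m})$. The composite $(K,\epsilon)\circ(H,\delta)$ is $KH$ with $K(\delta_{t,m})\circ\epsilon_{t,H(m)}$. $\mathcal{I}\text{-Mod}$ is the resulting category. *)

theory Defs
  imports Main "HOL-Library.FuncSet"
begin

section \<open>Categories, functors, equivalences\<close>

text \<open>
  Categories have carrier sets, so the fields of the records below matter only on the carriers.
  Functors, monoidal constraints and transformations are required to be \<^const>\<open>extensional\<close>,
  so that two of them are equal as soon as they agree on the carriers.
\<close>

record ('o, 'a) cat =
  Ob :: "'o set"
  Ar :: "'a set"
  Dom :: "'a \<Rightarrow> 'o"
  Cod :: "'a \<Rightarrow> 'o"
  Idn :: "'o \<Rightarrow> 'a"
  Cmp :: "'a \<Rightarrow> 'a \<Rightarrow> 'a" (infixr "\<cdot>\<index>" 70)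

definition Hom :: "('o, 'a, 'x) cat_scheme \<Rightarrow> 'o \<Rightarrow> 'o \<Rightarrow> 'a set" where
  "Hom C a b = {f \<in> Ar C. Dom C f = a \<and> Cod C f = b}"

locale category =
  fixes C :: "('o, 'a, 'x) cat_scheme" (structure)
  assumes dom_cod: "f \<in> Ar C \<Longrightarrow> Dom C f \<in> Ob C \<and> Cod C f \<in> Ob C"
    and idn: "a \<in> Ob C \<Longrightarrow> Idn C a \<in> Hom C a a"
    and cmp: "\<lbrakk>f \<in> Hom C a b; g \<in> Hom C b c\<rbrakk> \<Longrightarrow> g \<cdot> f \<in> Hom C a c"
    and cmp_idn: "f \<in> Hom C a b \<Longrightarrow> f \<cdot> Idn C a = f"
    and idn_cmp: "f \<in> Hom C a b \<Longrightarrow> Idn C b \<cdot> f = f"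
    and cmp_assoc:
      "\<lbrakk>f \<in> Hom C a b; g \<in> Hom C b c; h \<in> Hom C c d\<rbrakk> \<Longrightarrow> (h \<cdot> g) \<cdot> f = h \<cdot> (g \<cdot> f)"

definition inverse_arrows :: "('o, 'a, 'x) cat_scheme \<Rightarrow> 'a \<Rightarrow> 'a \<Rightarrow> bool" where
  "inverse_arrows C f g \<longleftrightarrow>
     f \<in> Ar C \<and> g \<in> Hom C (Cod C f) (Dom C f) \<and>
     Cmp C g f = Idn C (Dom C f) \<and> Cmp C f g = Idn C (Cod C f)"

definition Inv :: "('o, 'a, 'x) cat_scheme \<Rightarrow> 'a \<Rightarrow> 'a" where
  "Inv C f = (THE g. inverse_arrows C f g)"

record ('o1, 'a1, 'o2, 'a2) fctr =
  FOb :: "'o1 \<Rightarrow> 'o2"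
  FAr :: "'a1 \<Rightarrow> 'a2"

locale is_functor = C: category C + D: category D
  for C :: "('o1, 'a1, 'x) cat_scheme" and D :: "('o2, 'a2, 'y) cat_scheme" +
  fixes F :: "('o1, 'a1, 'o2, 'a2, 'z) fctr_scheme"
  assumes FOb_ext: "FOb F \<in> extensional (Ob C)"
    and FAr_ext: "FAr F \<in> extensional (Ar C)"
    and FOb: "a \<in> Ob C \<Longrightarrow> FOb F a \<in> Ob D"
    and FAr: "f \<in> Hom C a b \<Longrightarrow> FAr F f \<in> Hom D (FOb F a) (FOb F b)"
    and F_idn: "a \<in> Ob C \<Longrightarrow> FAr F (Idn C a) = Idn D (FOb F a)"
    and F_cmp: "\<lbrakk>f \<in> Hom C a b; g \<in> Hom C b c\<rbrakk> \<Longrightarrow>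
      FAr F (g \<cdot>\<^bsub>C\<^esub> f) = FAr F g \<cdot>\<^bsub>D\<^esub> FAr F f"

definition idF :: "('o, 'a, 'x) cat_scheme \<Rightarrow> ('o, 'a, 'o, 'a) fctr" where
  "idF C = \<lparr>FOb = (\<lambda>a\<in>Ob C. a), FAr = (\<lambda>f\<in>Ar C. f)\<rparr>"

text \<open>The first argument is the domain of the composite \<open>G \<circ> F\<close>; it is needed to restrict the maps.\<close>

definition compF :: "('o1, 'a1, 'x) cat_scheme \<Rightarrow> ('o2, 'a2, 'o3, 'a3) fctr \<Rightarrow>
    ('o1, 'a1, 'o2, 'a2) fctr \<Rightarrow> ('o1, 'a1, 'o3, 'a3) fctr" where
  "compF C G F = \<lparr>FOb = (\<lambda>a\<in>Ob C. FOb G (FOb F a)), FAr = (\<lambda>f\<in>Ar C. FAr G (FAr F f))\<rparr>"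

definition natural_iso :: "('o1, 'a1, 'x) cat_scheme \<Rightarrow> ('o2, 'a2, 'y) cat_scheme \<Rightarrow>
    ('o1, 'a1, 'o2, 'a2) fctr \<Rightarrow> ('o1, 'a1, 'o2, 'a2) fctr \<Rightarrow> ('o1 \<Rightarrow> 'a2) \<Rightarrow> bool" where
  "natural_iso C D F G \<tau> \<longleftrightarrow>
     is_functor C D F \<and> is_functor C D G \<and>
     (\<forall>a\<in>Ob C. \<tau> a \<in> Hom D (FOb F a) (FOb G a) \<and> (\<exists>g. inverse_arrows D (\<tau> a) g)) \<and>
     (\<forall>f\<in>Ar C. \<tau> (Cod C f) \<cdot>\<^bsub>D\<^esub> FAr F f = FAr G f \<cdot>\<^bsub>D\<^esub> \<tau> (Dom C f))"

definition equivalence_with_inverse :: "('o1, 'a1, 'x) cat_scheme \<Rightarrow> ('o2, 'a2, 'y) cat_scheme \<Rightarrow>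
    ('o1, 'a1, 'o2, 'a2) fctr \<Rightarrow> ('o2, 'a2, 'o1, 'a1) fctr \<Rightarrow> bool" where
  "equivalence_with_inverse C D F G \<longleftrightarrow>
     is_functor C D F \<and> is_functor D C G \<and>
     (\<exists>\<eta>. natural_iso C C (idF C) (compF C G F) \<eta>) \<and>
     (\<exists>\<epsilon>. natural_iso D D (compF D F G) (idF D) \<epsilon>)"

definition isomorphism_of_categories :: "('o1, 'a1, 'x) cat_scheme \<Rightarrow>
    ('o2, 'a2, 'y) cat_scheme \<Rightarrow> ('o1, 'a1, 'o2, 'a2) fctr \<Rightarrow> bool" where
  "isomorphism_of_categories C D F \<longleftrightarrow>
     is_functor C D F \<and>
     (\<exists>G. is_functor D C G \<and> compF C G F = idF C \<and> compF D F G = idF D)"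

definition full_subcategory :: "('o, 'a) cat \<Rightarrow> 'o set \<Rightarrow> ('o, 'a) cat" where
  "full_subcategory C S =
     C\<lparr>Ob := Ob C \<inter> S, Ar := {f \<in> Ar C. Dom C f \<in> S \<and> Cod C f \<in> S}\<rparr>"


section \<open>Symmetric Picard categories\<close>

record ('o, 'a) spc = "('o, 'a) cat" +
  Unt :: "'o"
  Ten :: "'o \<Rightarrow> 'o \<Rightarrow> 'o" (infixl "\<otimes>\<index>" 75)
  TenA :: "'a \<Rightarrow> 'a \<Rightarrow> 'a" (infixl "\<odot>\<index>" 75)
  Asc :: "'o \<Rightarrow> 'o \<Rightarrow> 'o \<Rightarrow> 'a"
  Lun :: "'o \<Rightarrow> 'a"
  Run :: "'o \<Rightarrow> 'a"
  Sym :: "'o \<Rightarrow> 'o \<Rightarrow> 'a"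
  Dual :: "'o \<Rightarrow> 'o"
  Jay :: "'o \<Rightarrow> 'a"

locale symmetric_picard = category C
  for C :: "('o, 'a) spc" (structure) +
  assumes groupoid: "f \<in> Ar C \<Longrightarrow> \<exists>g. inverse_arrows C f g"
    and Unt: "Unt C \<in> Ob C"
    and Ten: "\<lbrakk>a \<in> Ob C; b \<in> Ob C\<rbrakk> \<Longrightarrow> a \<otimes> b \<in> Ob C"
    and TenA: "\<lbrakk>f \<in> Hom C a a'; g \<in> Hom C b b'\<rbrakk> \<Longrightarrow> f \<odot> g \<in> Hom C (a \<otimes> b) (a' \<otimes> b')"
    and TenA_idn: "\<lbrakk>a \<in> Ob C; b \<in> Ob C\<rbrakk> \<Longrightarrow> Idn C a \<odot> Idn C b = Idn C (a \<otimes> b)"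
    and TenA_cmp:
      "\<lbrakk>f \<in> Hom C a a'; f' \<in> Hom C a' a''; g \<in> Hom C b b'; g' \<in> Hom C b' b''\<rbrakk>
        \<Longrightarrow> (f' \<cdot> f) \<odot> (g' \<cdot> g) = (f' \<odot> g') \<cdot> (f \<odot> g)"
    and Asc: "\<lbrakk>a \<in> Ob C; b \<in> Ob C; c \<in> Ob C\<rbrakk>
        \<Longrightarrow> Asc C a b c \<in> Hom C ((a \<otimes> b) \<otimes> c) (a \<otimes> (b \<otimes> c))"
    and Asc_nat: "\<lbrakk>f \<in> Hom C a a'; g \<in> Hom C b b'; h \<in> Hom C c c'\<rbrakk>
        \<Longrightarrow> Asc C a' b' c' \<cdot> ((f \<odot> g) \<odot> h) = (f \<odot> (g \<odot> h)) \<cdot> Asc C a b c"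
    and Lun: "a \<in> Ob C \<Longrightarrow> Lun C a \<in> Hom C (Unt C \<otimes> a) a"
    and Lun_nat: "f \<in> Hom C a a' \<Longrightarrow> Lun C a' \<cdot> (Idn C (Unt C) \<odot> f) = f \<cdot> Lun C a"
    and Run: "a \<in> Ob C \<Longrightarrow> Run C a \<in> Hom C (a \<otimes> Unt C) a"
    and Run_nat: "f \<in> Hom C a a' \<Longrightarrow> Run C a' \<cdot> (f \<odot> Idn C (Unt C)) = f \<cdot> Run C a"
    and Sym: "\<lbrakk>a \<in> Ob C; b \<in> Ob C\<rbrakk> \<Longrightarrow> Sym C a b \<in> Hom C (a \<otimes> b) (b \<otimes> a)"
    and Sym_nat: "\<lbrakk>f \<in> Hom C a a'; g \<in> Hom C b b'\<rbrakk>
        \<Longrightarrow> Sym C a' b' \<cdot> (f \<odot> g) = (g \<odot> f) \<cdot> Sym C a b"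
    and Sym_Sym: "\<lbrakk>a \<in> Ob C; b \<in> Ob C\<rbrakk> \<Longrightarrow> Sym C b a \<cdot> Sym C a b = Idn C (a \<otimes> b)"
    and pentagon: "\<lbrakk>a \<in> Ob C; b \<in> Ob C; c \<in> Ob C; d \<in> Ob C\<rbrakk>
        \<Longrightarrow> Asc C a b (c \<otimes> d) \<cdot> Asc C (a \<otimes> b) c d =
            (Idn C a \<odot> Asc C b c d) \<cdot> Asc C a (b \<otimes> c) d \<cdot> (Asc C a b c \<odot> Idn C d)"
    and triangle: "\<lbrakk>a \<in> Ob C; b \<in> Ob C\<rbrakk>
        \<Longrightarrow> (Idn C a \<odot> Lun C b) \<cdot> Asc C a (Unt C) b = Run C a \<odot> Idn C b"
    and hexagon: "\<lbrakk>a \<in> Ob C; b \<in> Ob C; c \<in> Ob C\<rbrakk>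
        \<Longrightarrow> Asc C b c a \<cdot> Sym C a (b \<otimes> c) \<cdot> Asc C a b c =
            (Idn C b \<odot> Sym C a c) \<cdot> Asc C b a c \<cdot> (Sym C a b \<odot> Idn C c)"
    and Dual: "a \<in> Ob C \<Longrightarrow> Dual C a \<in> Ob C"
    and Jay: "a \<in> Ob C \<Longrightarrow> Jay C a \<in> Hom C (Unt C) (Dual C a \<otimes> a)"

text \<open>The canonical isomorphism \<open>(a \<otimes> b) \<otimes> (c \<otimes> d) \<rightarrow> (a \<otimes> c) \<otimes> (b \<otimes> d)\<close>.\<close>

definition Interchange :: "('o, 'a) spc \<Rightarrow> 'o \<Rightarrow> 'o \<Rightarrow> 'o \<Rightarrow> 'o \<Rightarrow> 'a" where
  "Interchange C a b c d =
     Inv C (Asc C a c (b \<otimes>\<^bsub>C\<^esub> d)) \<cdot>\<^bsub>C\<^esub>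
     (Idn C a \<odot>\<^bsub>C\<^esub> Asc C c b d) \<cdot>\<^bsub>C\<^esub>
     (Idn C a \<odot>\<^bsub>C\<^esub> (Sym C b c \<odot>\<^bsub>C\<^esub> Idn C d)) \<cdot>\<^bsub>C\<^esub>
     (Idn C a \<odot>\<^bsub>C\<^esub> Inv C (Asc C b c d)) \<cdot>\<^bsub>C\<^esub>
     Asc C a b (c \<otimes>\<^bsub>C\<^esub> d)"


subsection \<open>Symmetric monoidal functors: the arrows of SPC\<close>

text \<open>
  The constraints are \<open>FTen F a b : F a \<otimes> F b \<rightarrow> F (a \<otimes> b)\<close> and \<open>FUnt F : I \<rightarrow> F I\<close>; they are
  invertible because the codomain is a groupoid.
\<close>

record ('o1, 'a1, 'o2, 'a2) smf = "('o1, 'a1, 'o2, 'a2) fctr" +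
  FTen :: "'o1 \<Rightarrow> 'o1 \<Rightarrow> 'a2"
  FUnt :: "'a2"

locale symmetric_monoidal_functor =
  A: symmetric_picard A + B: symmetric_picard B + is_functor A B F
  for A :: "('o1, 'a1) spc" and B :: "('o2, 'a2) spc" and F :: "('o1, 'a1, 'o2, 'a2) smf" +
  assumes FTen_ext: "FTen F \<in> extensional (Ob A)"
    and FTen_ext': "a \<in> Ob A \<Longrightarrow> FTen F a \<in> extensional (Ob A)"
    and FTen: "\<lbrakk>a \<in> Ob A; b \<in> Ob A\<rbrakk>
      \<Longrightarrow> FTen F a b \<in> Hom B (FOb F a \<otimes>\<^bsub>B\<^esub> FOb F b) (FOb F (a \<otimes>\<^bsub>A\<^esub> b))"
    and FUnt: "FUnt F \<in> Hom B (Unt B) (FOb F (Unt A))"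
    and FTen_nat: "\<lbrakk>f \<in> Hom A a a'; g \<in> Hom A b b'\<rbrakk>
      \<Longrightarrow> FTen F a' b' \<cdot>\<^bsub>B\<^esub> (FAr F f \<odot>\<^bsub>B\<^esub> FAr F g) = FAr F (f \<odot>\<^bsub>A\<^esub> g) \<cdot>\<^bsub>B\<^esub> FTen F a b"
    and F_Asc: "\<lbrakk>a \<in> Ob A; b \<in> Ob A; c \<in> Ob A\<rbrakk>
      \<Longrightarrow> FAr F (Asc A a b c) \<cdot>\<^bsub>B\<^esub> FTen F (a \<otimes>\<^bsub>A\<^esub> b) c \<cdot>\<^bsub>B\<^esub> (FTen F a b \<odot>\<^bsub>B\<^esub> Idn B (FOb F c)) =
          FTen F a (b \<otimes>\<^bsub>A\<^esub> c) \<cdot>\<^bsub>B\<^esub> (Idn B (FOb F a) \<odot>\<^bsub>B\<^esub> FTen F b c) \<cdot>\<^bsub>B\<^esub>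
          Asc B (FOb F a) (FOb F b) (FOb F c)"
    and F_Lun: "a \<in> Ob A
      \<Longrightarrow> FAr F (Lun A a) \<cdot>\<^bsub>B\<^esub> FTen F (Unt A) a \<cdot>\<^bsub>B\<^esub> (FUnt F \<odot>\<^bsub>B\<^esub> Idn B (FOb F a)) = Lun B (FOb F a)"
    and F_Run: "a \<in> Ob A
      \<Longrightarrow> FAr F (Run A a) \<cdot>\<^bsub>B\<^esub> FTen F a (Unt A) \<cdot>\<^bsub>B\<^esub> (Idn B (FOb F a) \<odot>\<^bsub>B\<^esub> FUnt F) = Run B (FOb F a)"
    and F_Sym: "\<lbrakk>a \<in> Ob A; b \<in> Ob A\<rbrakk>
      \<Longrightarrow> FAr F (Sym A a b) \<cdot>\<^bsub>B\<^esub> FTen F a b = FTen F b a \<cdot>\<^bsub>B\<^esub> Sym B (FOb F a) (FOb F b)"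

locale strict_arrow = symmetric_monoidal_functor +
  assumes strict_Unt: "FOb F (Unt A) = Unt B"
    and strict_FUnt: "FUnt F = Idn B (Unt B)"
    and strict_Ten: "\<lbrakk>a \<in> Ob A; b \<in> Ob A\<rbrakk> \<Longrightarrow> FOb F (a \<otimes>\<^bsub>A\<^esub> b) = FOb F a \<otimes>\<^bsub>B\<^esub> FOb F b"
    and strict_FTen: "\<lbrakk>a \<in> Ob A; b \<in> Ob A\<rbrakk> \<Longrightarrow> FTen F a b = Idn B (FOb F a \<otimes>\<^bsub>B\<^esub> FOb F b)"
    and strict_Dual: "a \<in> Ob A \<Longrightarrow> FOb F (Dual A a) = Dual B (FOb F a)"
    and strict_Jay: "a \<in> Ob A \<Longrightarrow> FAr F (Jay A a) = Jay B (FOb F a)"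

definition id_smf :: "('o, 'a) spc \<Rightarrow> ('o, 'a, 'o, 'a) smf" where
  "id_smf A = \<lparr>FOb = (\<lambda>a\<in>Ob A. a), FAr = (\<lambda>f\<in>Ar A. f),
     FTen = (\<lambda>a\<in>Ob A. \<lambda>b\<in>Ob A. Idn A (a \<otimes>\<^bsub>A\<^esub> b)), FUnt = Idn A (Unt A)\<rparr>"

text \<open>The composite \<open>G \<circ> F\<close> of \<open>F : A \<rightarrow> B\<close> and \<open>G : B \<rightarrow> C\<close>.\<close>

definition comp_smf :: "('o1, 'a1) spc \<Rightarrow> ('o3, 'a3) spc \<Rightarrow> ('o2, 'a2, 'o3, 'a3) smf \<Rightarrow>
    ('o1, 'a1, 'o2, 'a2) smf \<Rightarrow> ('o1, 'a1, 'o3, 'a3) smf" where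
  "comp_smf A C G F = \<lparr>FOb = (\<lambda>a\<in>Ob A. FOb G (FOb F a)), FAr = (\<lambda>f\<in>Ar A. FAr G (FAr F f)),
     FTen = (\<lambda>a\<in>Ob A. \<lambda>b\<in>Ob A. FAr G (FTen F a b) \<cdot>\<^bsub>C\<^esub> FTen G (FOb F a) (FOb F b)),
     FUnt = FAr G (FUnt F) \<cdot>\<^bsub>C\<^esub> FUnt G\<rparr>"

definition SPC :: "(('o, 'a) spc, ('o, 'a) spc \<times> ('o, 'a) spc \<times> ('o, 'a, 'o, 'a) smf) cat" where
  "SPC = \<lparr>Ob = {A. symmetric_picard A},
     Ar = {(A, B, F). symmetric_monoidal_functor A B F},
     Dom = (\<lambda>(A, B, F). A),
     Cod = (\<lambda>(A, B, F). B),
     Idn = (\<lambda>A. (A, A, id_smf A)),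
     Cmp = (\<lambda>(B', C, G) (A, B, F). (A, C, comp_smf A C G F))\<rparr>"


subsection \<open>The internal hom\<close>

record ('o1, 'a1, 'o2, 'a2) smt =
  Src :: "('o1, 'a1, 'o2, 'a2) smf"
  Trg :: "('o1, 'a1, 'o2, 'a2) smf"
  cpt :: "'o1 \<Rightarrow> 'a2"

locale monoidal_transformation =
  S: symmetric_monoidal_functor A B "Src \<sigma>" + T: symmetric_monoidal_functor A B "Trg \<sigma>"
  for A :: "('o1, 'a1) spc" and B :: "('o2, 'a2) spc" and \<sigma> :: "('o1, 'a1, 'o2, 'a2) smt" +
  assumes cpt_ext: "cpt \<sigma> \<in> extensional (Ob A)"
    and cpt: "a \<in> Ob A \<Longrightarrow> cpt \<sigma> a \<in> Hom B (FOb (Src \<sigma>) a) (FOb (Trg \<sigma>) a)"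
    and cpt_nat: "f \<in> Hom A a b
      \<Longrightarrow> cpt \<sigma> b \<cdot>\<^bsub>B\<^esub> FAr (Src \<sigma>) f = FAr (Trg \<sigma>) f \<cdot>\<^bsub>B\<^esub> cpt \<sigma> a"
    and cpt_Ten: "\<lbrakk>a \<in> Ob A; b \<in> Ob A\<rbrakk>
      \<Longrightarrow> cpt \<sigma> (a \<otimes>\<^bsub>A\<^esub> b) \<cdot>\<^bsub>B\<^esub> FTen (Src \<sigma>) a b = FTen (Trg \<sigma>) a b \<cdot>\<^bsub>B\<^esub> (cpt \<sigma> a \<odot>\<^bsub>B\<^esub> cpt \<sigma> b)"
    and cpt_Unt: "cpt \<sigma> (Unt A) \<cdot>\<^bsub>B\<^esub> FUnt (Src \<sigma>) = FUnt (Trg \<sigma>)"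

definition unit_smf :: "('o1, 'a1) spc \<Rightarrow> ('o2, 'a2) spc \<Rightarrow> ('o1, 'a1, 'o2, 'a2) smf" where
  "unit_smf A B = \<lparr>FOb = (\<lambda>a\<in>Ob A. Unt B), FAr = (\<lambda>f\<in>Ar A. Idn B (Unt B)),
     FTen = (\<lambda>a\<in>Ob A. \<lambda>b\<in>Ob A. Lun B (Unt B)), FUnt = Idn B (Unt B)\<rparr>"

definition tensor_smf :: "('o1, 'a1) spc \<Rightarrow> ('o2, 'a2) spc \<Rightarrow> ('o1, 'a1, 'o2, 'a2) smf \<Rightarrow>
    ('o1, 'a1, 'o2, 'a2) smf \<Rightarrow> ('o1, 'a1, 'o2, 'a2) smf" where
  "tensor_smf A B F G =
     \<lparr>FOb = (\<lambda>a\<in>Ob A. FOb F a \<otimes>\<^bsub>B\<^esub> FOb G a),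
      FAr = (\<lambda>f\<in>Ar A. FAr F f \<odot>\<^bsub>B\<^esub> FAr G f),
      FTen = (\<lambda>a\<in>Ob A. \<lambda>b\<in>Ob A. (FTen F a b \<odot>\<^bsub>B\<^esub> FTen G a b) \<cdot>\<^bsub>B\<^esub>
                Interchange B (FOb F a) (FOb G a) (FOb F b) (FOb G b)),
      FUnt = (FUnt F \<odot>\<^bsub>B\<^esub> FUnt G) \<cdot>\<^bsub>B\<^esub> Inv B (Lun B (Unt B))\<rparr>"

definition jay_smt :: "('o1, 'a1) spc \<Rightarrow> ('o2, 'a2) spc \<Rightarrow> ('o1, 'a1, 'o2, 'a2) smf \<Rightarrow>
    ('o1, 'a1, 'o2, 'a2) smf \<Rightarrow> ('o1, 'a1, 'o2, 'a2) smt" where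
  "jay_smt A B G F = \<lparr>Src = unit_smf A B, Trg = tensor_smf A B G F,
     cpt = (\<lambda>a\<in>Ob A. Jay B (FOb F a))\<rparr>"

text \<open>
  A symmetric Picard structure on \<open>[A, B]\<close> that is pointwise that of \<open>B\<close> has
  \<open>F\<^sup>\<bullet> a = (F a)\<^sup>\<bullet>\<close> on objects and \<open>j\<^sub>F\<close> with components \<open>j\<close> at \<open>F a\<close>. As \<open>j\<^sub>F\<close> has to be
  an arrow of \<open>[A, B]\<close>, this determines the rest of \<open>F\<^sup>\<bullet>\<close>: its action on arrows by
  naturality of \<open>j\<^sub>F\<close>, its constraints by monoidality (tensoring with an object is faithful).
\<close>

definition dual_smf :: "('o1, 'a1) spc \<Rightarrow> ('o2, 'a2) spc \<Rightarrow> ('o1, 'a1, 'o2, 'a2) smf \<Rightarrow>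
    ('o1, 'a1, 'o2, 'a2) smf" where
  "dual_smf A B F = (THE G. symmetric_monoidal_functor A B G \<and>
     (\<forall>a\<in>Ob A. FOb G a = Dual B (FOb F a)) \<and> monoidal_transformation A B (jay_smt A B G F))"

definition ihom :: "('o1, 'a1) spc \<Rightarrow> ('o2, 'a2) spc \<Rightarrow>
    (('o1, 'a1, 'o2, 'a2) smf, ('o1, 'a1, 'o2, 'a2) smt) spc" where
  "ihom A B =
     \<lparr>Ob = {F. symmetric_monoidal_functor A B F},
      Ar = {\<sigma>. monoidal_transformation A B \<sigma>},
      Dom = Src,
      Cod = Trg,
      Idn = (\<lambda>F. \<lparr>Src = F, Trg = F, cpt = (\<lambda>a\<in>Ob A. Idn B (FOb F a))\<rparr>),
      Cmp = (\<lambda>\<tau> \<sigma>. \<lparr>Src = Src \<sigma>, Trg = Trg \<tau>, cpt = (\<lambda>a\<in>Ob A. cpt \<tau> a \<cdot>\<^bsub>B\<^esub> cpt \<sigma> a)\<rparr>),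
      Unt = unit_smf A B,
      Ten = tensor_smf A B,
      TenA = (\<lambda>\<sigma> \<tau>. \<lparr>Src = tensor_smf A B (Src \<sigma>) (Src \<tau>), Trg = tensor_smf A B (Trg \<sigma>) (Trg \<tau>),
                cpt = (\<lambda>a\<in>Ob A. cpt \<sigma> a \<odot>\<^bsub>B\<^esub> cpt \<tau> a)\<rparr>),
      Asc = (\<lambda>F G H. \<lparr>Src = tensor_smf A B (tensor_smf A B F G) H,
                Trg = tensor_smf A B F (tensor_smf A B G H),
                cpt = (\<lambda>a\<in>Ob A. Asc B (FOb F a) (FOb G a) (FOb H a))\<rparr>),
      Lun = (\<lambda>F. \<lparr>Src = tensor_smf A B (unit_smf A B) F, Trg = F,
                cpt = (\<lambda>a\<in>Ob A. Lun B (FOb F a))\<rparr>),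
      Run = (\<lambda>F. \<lparr>Src = tensor_smf A B F (unit_smf A B), Trg = F,
                cpt = (\<lambda>a\<in>Ob A. Run B (FOb F a))\<rparr>),
      Sym = (\<lambda>F G. \<lparr>Src = tensor_smf A B F G, Trg = tensor_smf A B G F,
                cpt = (\<lambda>a\<in>Ob A. Sym B (FOb F a) (FOb G a))\<rparr>),
      Dual = dual_smf A B,
      Jay = (\<lambda>F. jay_smt A B (dual_smf A B F) F)\<rparr>"

text \<open>
  Post-composition \<open>[A, G] : [A, B] \<rightarrow> [A, C]\<close> with \<open>G : B \<rightarrow> C\<close>; its constraints are those
  of \<open>G\<close>.
\<close>

definition post :: "('o1, 'a1) spc \<Rightarrow> ('o2, 'a2) spc \<Rightarrow> ('o3, 'a3) spc \<Rightarrow>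
    ('o2, 'a2, 'o3, 'a3) smf \<Rightarrow>
    (('o1, 'a1, 'o2, 'a2) smf, ('o1, 'a1, 'o2, 'a2) smt,
     ('o1, 'a1, 'o3, 'a3) smf, ('o1, 'a1, 'o3, 'a3) smt) smf" where
  "post A B C G =
     \<lparr>FOb = (\<lambda>F\<in>Ob (ihom A B). comp_smf A C G F),
      FAr = (\<lambda>\<sigma>\<in>Ar (ihom A B). \<lparr>Src = comp_smf A C G (Src \<sigma>), Trg = comp_smf A C G (Trg \<sigma>),
               cpt = (\<lambda>a\<in>Ob A. FAr G (cpt \<sigma> a))\<rparr>),
      FTen = (\<lambda>F\<in>Ob (ihom A B). \<lambda>F'\<in>Ob (ihom A B).
               \<lparr>Src = tensor_smf A C (comp_smf A C G F) (comp_smf A C G F'),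
                Trg = comp_smf A C G (tensor_smf A B F F'),
                cpt = (\<lambda>a\<in>Ob A. FTen G (FOb F a) (FOb F' a))\<rparr>),
      FUnt = \<lparr>Src = unit_smf A C, Trg = comp_smf A C G (unit_smf A B),
               cpt = (\<lambda>a\<in>Ob A. FUnt G)\<rparr>\<rparr>"

text \<open>
  Pre-composition \<open>[F, C] : [B, C] \<rightarrow> [A, C]\<close> with \<open>F : A \<rightarrow> B\<close>, and the functor
  \<open>[B, C] \<rightarrow> [[A, B], [A, C]]\<close> sending \<open>G\<close> to \<open>[A, G]\<close>. The structure of the internal homs being
  pointwise, both preserve it on the nose: \<open>(G \<otimes> G') \<circ> F = (G \<circ> F) \<otimes> (G' \<circ> F)\<close> and
  \<open>[A, G \<otimes> G'] = [A, G] \<otimes> [A, G']\<close>, and similarly for units. Hence the identity constraints.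
\<close>

definition pre :: "('o1, 'a1) spc \<Rightarrow> ('o2, 'a2) spc \<Rightarrow> ('o3, 'a3) spc \<Rightarrow>
    ('o1, 'a1, 'o2, 'a2) smf \<Rightarrow>
    (('o2, 'a2, 'o3, 'a3) smf, ('o2, 'a2, 'o3, 'a3) smt,
     ('o1, 'a1, 'o3, 'a3) smf, ('o1, 'a1, 'o3, 'a3) smt) smf" where
  "pre A B C F =
     \<lparr>FOb = (\<lambda>G\<in>Ob (ihom B C). comp_smf A C G F),
      FAr = (\<lambda>\<sigma>\<in>Ar (ihom B C). \<lparr>Src = comp_smf A C (Src \<sigma>) F, Trg = comp_smf A C (Trg \<sigma>) F,
               cpt = (\<lambda>a\<in>Ob A. cpt \<sigma> (FOb F a))\<rparr>),
      FTen = (\<lambda>G\<in>Ob (ihom B C). \<lambda>G'\<in>Ob (ihom B C).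
               Idn (ihom A C) (comp_smf A C (tensor_smf B C G G') F)),
      FUnt = Idn (ihom A C) (unit_smf A C)\<rparr>"

definition post_functor :: "('o1, 'a1) spc \<Rightarrow> ('o2, 'a2) spc \<Rightarrow> ('o3, 'a3) spc \<Rightarrow>
    (('o2, 'a2, 'o3, 'a3) smf, ('o2, 'a2, 'o3, 'a3) smt,
     (('o1, 'a1, 'o2, 'a2) smf, ('o1, 'a1, 'o2, 'a2) smt,
      ('o1, 'a1, 'o3, 'a3) smf, ('o1, 'a1, 'o3, 'a3) smt) smf,
     (('o1, 'a1, 'o2, 'a2) smf, ('o1, 'a1, 'o2, 'a2) smt,
      ('o1, 'a1, 'o3, 'a3) smf, ('o1, 'a1, 'o3, 'a3) smt) smt) smf" where
  "post_functor A B C =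
     \<lparr>FOb = (\<lambda>G\<in>Ob (ihom B C). post A B C G),
      FAr = (\<lambda>\<tau>\<in>Ar (ihom B C). \<lparr>Src = post A B C (Src \<tau>), Trg = post A B C (Trg \<tau>),
               cpt = (\<lambda>F\<in>Ob (ihom A B).
                 \<lparr>Src = comp_smf A C (Src \<tau>) F, Trg = comp_smf A C (Trg \<tau>) F,
                  cpt = (\<lambda>a\<in>Ob A. cpt \<tau> (FOb F a))\<rparr>)\<rparr>),
      FTen = (\<lambda>G\<in>Ob (ihom B C). \<lambda>G'\<in>Ob (ihom B C).
               Idn (ihom (ihom A B) (ihom A C)) (post A B C (tensor_smf B C G G'))),
      FUnt = Idn (ihom (ihom A B) (ihom A C)) (unit_smf (ihom A B) (ihom A C))\<rparr>"


section \<open>The free symmetric Picard category on one generator\<close>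

text \<open>
  The universal property ranges over all types, so it cannot serve as a definition in HOL.
  The free category is therefore built from syntax: objects are formal expressions in the
  generator, arrows are formal composites of structural arrows modulo the congruence generated by
  the axioms of symmetric Picard categories. Freeness is proved below.
\<close>

datatype iobj = Gen (\<open>\<star>\<close>) | IUnt | ITen iobj iobj | IDual iobj

datatype iterm =
    TId iobj | TCmp iterm iterm | TInv iterm | TTen iterm iterm
  | TAsc iobj iobj iobj | TLun iobj | TRun iobj | TSym iobj iobj | TJay iobj

fun idom :: "iterm \<Rightarrow> iobj" and icod :: "iterm \<Rightarrow> iobj" where
  "idom (TId x) = x"
| "idom (TCmp t s) = idom s"
| "idom (TInv t) = icod t"
| "idom (TTen t s) = ITen (idom t) (idom s)"
| "idom (TAsc x y z) = ITen (ITen x y) z"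
| "idom (TLun x) = ITen IUnt x"
| "idom (TRun x) = ITen x IUnt"
| "idom (TSym x y) = ITen x y"
| "idom (TJay x) = IUnt"
| "icod (TId x) = x"
| "icod (TCmp t s) = icod t"
| "icod (TInv t) = idom t"
| "icod (TTen t s) = ITen (icod t) (icod s)"
| "icod (TAsc x y z) = ITen x (ITen y z)"
| "icod (TLun x) = x"
| "icod (TRun x) = x"
| "icod (TSym x y) = ITen y x"
| "icod (TJay x) = ITen (IDual x) x"

fun iwf :: "iterm \<Rightarrow> bool" where
  "iwf (TCmp t s) \<longleftrightarrow> iwf t \<and> iwf s \<and> idom t = icod s"
| "iwf (TInv t) \<longleftrightarrow> iwf t"
| "iwf (TTen t s) \<longleftrightarrow> iwf t \<and> iwf s"
| "iwf _ \<longleftrightarrow> True"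

inductive ieq :: "iterm \<Rightarrow> iterm \<Rightarrow> bool" (infix "\<approx>" 50) where
  refl: "iwf t \<Longrightarrow> t \<approx> t"
| sym: "t \<approx> s \<Longrightarrow> s \<approx> t"
| trans: "\<lbrakk>t \<approx> s; s \<approx> r\<rbrakk> \<Longrightarrow> t \<approx> r"
| TCmp: "\<lbrakk>t \<approx> t'; s \<approx> s'; idom t = icod s\<rbrakk> \<Longrightarrow> TCmp t s \<approx> TCmp t' s'"
| TInv: "t \<approx> t' \<Longrightarrow> TInv t \<approx> TInv t'"
| TTen: "\<lbrakk>t \<approx> t'; s \<approx> s'\<rbrakk> \<Longrightarrow> TTen t s \<approx> TTen t' s'"
| cmp_id: "iwf t \<Longrightarrow> TCmp t (TId (idom t)) \<approx> t"
| id_cmp: "iwf t \<Longrightarrow> TCmp (TId (icod t)) t \<approx> t"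
| cmp_assoc: "\<lbrakk>iwf t; iwf s; iwf r; idom t = icod s; idom s = icod r\<rbrakk>
    \<Longrightarrow> TCmp (TCmp t s) r \<approx> TCmp t (TCmp s r)"
| inv_left: "iwf t \<Longrightarrow> TCmp (TInv t) t \<approx> TId (idom t)"
| inv_right: "iwf t \<Longrightarrow> TCmp t (TInv t) \<approx> TId (icod t)"
| ten_id: "TTen (TId x) (TId y) \<approx> TId (ITen x y)"
| ten_cmp: "\<lbrakk>iwf t; iwf s; iwf t'; iwf s'; idom t = icod s; idom t' = icod s'\<rbrakk>
    \<Longrightarrow> TTen (TCmp t s) (TCmp t' s') \<approx> TCmp (TTen t t') (TTen s s')"
| asc_nat: "\<lbrakk>iwf t; iwf s; iwf r\<rbrakk>
    \<Longrightarrow> TCmp (TAsc (icod t) (icod s) (icod r)) (TTen (TTen t s) r)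
        \<approx> TCmp (TTen t (TTen s r)) (TAsc (idom t) (idom s) (idom r))"
| lun_nat: "iwf t \<Longrightarrow> TCmp (TLun (icod t)) (TTen (TId IUnt) t) \<approx> TCmp t (TLun (idom t))"
| run_nat: "iwf t \<Longrightarrow> TCmp (TRun (icod t)) (TTen t (TId IUnt)) \<approx> TCmp t (TRun (idom t))"
| sym_nat: "\<lbrakk>iwf t; iwf s\<rbrakk>
    \<Longrightarrow> TCmp (TSym (icod t) (icod s)) (TTen t s) \<approx> TCmp (TTen s t) (TSym (idom t) (idom s))"
| sym_sym: "TCmp (TSym y x) (TSym x y) \<approx> TId (ITen x y)"
| pentagon: "TCmp (TAsc w x (ITen y z)) (TAsc (ITen w x) y z)
    \<approx> TCmp (TTen (TId w) (TAsc x y z)) (TCmp (TAsc w (ITen x y) z) (TTen (TAsc w x y) (TId z)))"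
| triangle: "TCmp (TTen (TId x) (TLun y)) (TAsc x IUnt y) \<approx> TTen (TRun x) (TId y)"
| hexagon: "TCmp (TAsc y z x) (TCmp (TSym x (ITen y z)) (TAsc x y z))
    \<approx> TCmp (TTen (TId y) (TSym x z)) (TCmp (TAsc y x z) (TTen (TSym x y) (TId z)))"

definition icls :: "iterm \<Rightarrow> iterm set" where
  "icls t = {s. t \<approx> s}"

definition irep :: "iterm set \<Rightarrow> iterm" where
  "irep X = (SOME t. t \<in> X)"

definition FreeSPC :: "(iobj, iterm set) spc" (\<open>\<I>\<close>) where
  "\<I> =
     \<lparr>Ob = UNIV,
      Ar = icls ` {t. iwf t},
      Dom = (\<lambda>X. idom (irep X)),
      Cod = (\<lambda>X. icod (irep X)),
      Idn = (\<lambda>x. icls (TId x)),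
      Cmp = (\<lambda>X Y. icls (TCmp (irep X) (irep Y))),
      Unt = IUnt,
      Ten = ITen,
      TenA = (\<lambda>X Y. icls (TTen (irep X) (irep Y))),
      Asc = (\<lambda>x y z. icls (TAsc x y z)),
      Lun = (\<lambda>x. icls (TLun x)),
      Run = (\<lambda>x. icls (TRun x)),
      Sym = (\<lambda>x y. icls (TSym x y)),
      Dual = IDual,
      Jay = (\<lambda>x. icls (TJay x))\<rparr>"

lemma ieq_parallel:
  "t \<approx> s \<Longrightarrow> iwf t \<and> iwf s \<and> idom t = idom s \<and> icod t = icod s"
  by (induction rule: ieq.induct) auto

lemma icls_eq_iff: "iwf t \<Longrightarrow> icls t = icls s \<longleftrightarrow> t \<approx> s"
  unfolding icls_def by (auto intro: ieq.refl ieq.sym ieq.trans)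

lemma icls_eqI: "t \<approx> s \<Longrightarrow> icls t = icls s"
  using icls_eq_iff ieq_parallel by blast

lemma irep_icls: "iwf t \<Longrightarrow> t \<approx> irep (icls t)"
  unfolding irep_def icls_def by (auto intro: someI ieq.refl)

lemma irep_icls_simps [simp]:
  assumes "iwf t"
  shows "idom (irep (icls t)) = idom t" "icod (irep (icls t)) = icod t" "iwf (irep (icls t))"
  using ieq_parallel[OF irep_icls[OF assms]] by auto

lemma \<I>_simps [simp]:
  "Ob \<I> = UNIV" "Unt \<I> = IUnt" "x \<otimes>\<^bsub>\<I>\<^esub> y = ITen x y" "Dual \<I> x = IDual x"
  "Idn \<I> x = icls (TId x)" "Asc \<I> x y z = icls (TAsc x y z)" "Lun \<I> x = icls (TLun x)"
  "Run \<I> x = icls (TRun x)" "Sym \<I> x y = icls (TSym x y)" "Jay \<I> x = icls (TJay x)"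
  by (simp_all add: FreeSPC_def)

lemma \<I>_cmp [simp]:
  "\<lbrakk>iwf t; iwf s; idom t = icod s\<rbrakk> \<Longrightarrow> icls t \<cdot>\<^bsub>\<I>\<^esub> icls s = icls (TCmp t s)"
  by (auto simp: FreeSPC_def intro!: icls_eqI intro: ieq.sym ieq.TCmp irep_icls)

lemma \<I>_ten [simp]:
  "\<lbrakk>iwf t; iwf s\<rbrakk> \<Longrightarrow> icls t \<odot>\<^bsub>\<I>\<^esub> icls s = icls (TTen t s)"
  by (auto simp: FreeSPC_def intro!: icls_eqI intro: ieq.sym ieq.TTen irep_icls)

lemma \<I>_Ar: "X \<in> Ar \<I> \<longleftrightarrow> (\<exists>t. iwf t \<and> X = icls t)"
  by (auto simp: FreeSPC_def)

lemma \<I>_dom_cod [simp]: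
  "iwf t \<Longrightarrow> Dom \<I> (icls t) = idom t" "iwf t \<Longrightarrow> Cod \<I> (icls t) = icod t"
  by (auto simp: FreeSPC_def)

lemma \<I>_Hom: "X \<in> Hom \<I> x y \<longleftrightarrow> (\<exists>t. iwf t \<and> idom t = x \<and> icod t = y \<and> X = icls t)"
  by (auto simp: Hom_def \<I>_Ar)

lemma \<I>_HomI [simp]: "iwf t \<Longrightarrow> icls t \<in> Hom \<I> x y \<longleftrightarrow> idom t = x \<and> icod t = y"
  by (auto simp: Hom_def \<I>_Ar)

lemma \<I>_inverse: "iwf t \<Longrightarrow> inverse_arrows \<I> (icls t) (icls (TInv t))"
  by (auto simp: inverse_arrows_def \<I>_Ar intro!: icls_eqI ieq.inv_left ieq.inv_right)

lemma \<I>_HomE: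
  assumes "X \<in> Hom \<I> x y"
  obtains t where "iwf t" "X = icls t" "idom t = x" "icod t = y"
  using assms by (auto simp: \<I>_Hom)

lemma symmetric_picard_\<I>: "symmetric_picard \<I>"
proof
  fix f assume "f \<in> Ar \<I>"
  then show "\<exists>g. inverse_arrows \<I> f g"
    using \<I>_inverse by (auto simp: \<I>_Ar)
qed (auto elim!: \<I>_HomE del: equalityI
    intro!: icls_eqI ieq.cmp_id ieq.id_cmp ieq.cmp_assoc ieq.ten_id ieq.ten_cmp ieq.asc_nat ieq.lun_nat
      ieq.run_nat ieq.sym_nat ieq.sym_sym ieq.pentagon ieq.triangle ieq.hexagon)

text \<open>The strict arrow \<open>\<I> \<rightarrow> B\<close> determined by an object \<open>b\<close> of \<open>B\<close>.\<close>

primrec evO :: "('o, 'a) spc \<Rightarrow> 'o \<Rightarrow> iobj \<Rightarrow> 'o" where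
  "evO B b \<star> = b"
| "evO B b IUnt = Unt B"
| "evO B b (ITen x y) = evO B b x \<otimes>\<^bsub>B\<^esub> evO B b y"
| "evO B b (IDual x) = Dual B (evO B b x)"

primrec evA :: "('o, 'a) spc \<Rightarrow> 'o \<Rightarrow> iterm \<Rightarrow> 'a" where
  "evA B b (TId x) = Idn B (evO B b x)"
| "evA B b (TCmp t s) = evA B b t \<cdot>\<^bsub>B\<^esub> evA B b s"
| "evA B b (TInv t) = Inv B (evA B b t)"
| "evA B b (TTen t s) = evA B b t \<odot>\<^bsub>B\<^esub> evA B b s"
| "evA B b (TAsc x y z) = Asc B (evO B b x) (evO B b y) (evO B b z)"
| "evA B b (TLun x) = Lun B (evO B b x)"
| "evA B b (TRun x) = Run B (evO B b x)"
| "evA B b (TSym x y) = Sym B (evO B b x) (evO B b y)"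
| "evA B b (TJay x) = Jay B (evO B b x)"

definition ev :: "('o, 'a) spc \<Rightarrow> 'o \<Rightarrow> (iobj, iterm set, 'o, 'a) smf" where
  "ev B b = \<lparr>FOb = evO B b, FAr = (\<lambda>X\<in>Ar \<I>. evA B b (irep X)),
     FTen = (\<lambda>x y. Idn B (evO B b (ITen x y))), FUnt = Idn B (Unt B)\<rparr>"

lemma (in category) inverse_unique:
  assumes "inverse_arrows C f g" "inverse_arrows C f h"
  shows "g = h"
proof -
  let ?a = "Dom C f" and ?b = "Cod C f"
  have f: "f \<in> Hom C ?a ?b" and g: "g \<in> Hom C ?b ?a" and h: "h \<in> Hom C ?b ?a"
    using assms by (auto simp: inverse_arrows_def Hom_def)
  have "g = g \<cdot> (f \<cdot> h)"
    using assms cmp_idn[OF g] by (simp add: inverse_arrows_def)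
  also have "\<dots> = (g \<cdot> f) \<cdot> h"
    using cmp_assoc[OF h f g] by simp
  also have "\<dots> = h"
    using assms idn_cmp[OF h] by (simp add: inverse_arrows_def)
  finally show ?thesis .
qed

lemma (in category) Inv_eq: "inverse_arrows C f g \<Longrightarrow> Inv C f = g"
  unfolding Inv_def using inverse_unique by blast

lemma (in symmetric_picard) inverse_Inv: "f \<in> Ar C \<Longrightarrow> inverse_arrows C f (Inv C f)"
  using groupoid Inv_eq by blast

lemma (in symmetric_picard) Inv_Hom:
  assumes "f \<in> Hom C a b"
  shows "Inv C f \<in> Hom C b a" "Inv C f \<cdot> f = Idn C a" "f \<cdot> Inv C f = Idn C b"
  using assms inverse_Inv[of f] by (auto simp: inverse_arrows_def Hom_def)

context
  fixes B :: "('o, 'a) spc" and b :: 'o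
  assumes B: "symmetric_picard B" and b: "b \<in> Ob B"
begin

interpretation symmetric_picard B by (rule B)

lemma evO_Ob: "evO B b x \<in> Ob B"
  by (induction x) (auto intro: b Unt Ten Dual)

lemma evA_Hom: "iwf t \<Longrightarrow> evA B b t \<in> Hom B (evO B b (idom t)) (evO B b (icod t))"
  by (induction t) (auto intro: idn evO_Ob Inv_Hom(1) TenA Asc Lun Run Sym Jay intro!: cmp)

lemma evA_sound: "t \<approx> s \<Longrightarrow> evA B b t = evA B b s"
proof (induction rule: ieq.induct)
  case (ten_cmp t s t' s')
  note ev = evA_Hom[OF ten_cmp(1)] evA_Hom[OF ten_cmp(2)] evA_Hom[OF ten_cmp(3)]
    evA_Hom[OF ten_cmp(4)]
  show ?case
    using TenA_cmp[OF ev(2) _ ev(4)] ev(1,3) ten_cmp(5,6) by simp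
next
  case (cmp_assoc t s r)
  note ev = evA_Hom[OF cmp_assoc(1)] evA_Hom[OF cmp_assoc(2)] evA_Hom[OF cmp_assoc(3)]
  show ?case
    using category.cmp_assoc[OF category_axioms ev(3)] ev(1,2) cmp_assoc(4,5) by auto
qed (auto intro: cmp_idn idn_cmp Inv_Hom(2,3) evA_Hom TenA_idn evO_Ob Asc_nat Lun_nat Run_nat
      Sym_nat Sym_Sym pentagon triangle hexagon)

lemma evA_irep: "iwf t \<Longrightarrow> FAr (ev B b) (icls t) = evA B b t"
  using evA_sound[OF irep_icls, of t] by (auto simp: ev_def \<I>_Ar)

lemma ev_FOb: "FOb (ev B b) = evO B b"
  by (simp add: ev_def)

lemma ev_FAr_ext: "FAr (ev B b) \<in> extensional (Ar \<I>)"
  by (simp add: ev_def)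

lemma evA_ev_simps:
  "FAr (ev B b) (icls (TId x)) = Idn B (evO B b x)"
  "FTen (ev B b) x y = Idn B (evO B b x \<otimes>\<^bsub>B\<^esub> evO B b y)"
  "FUnt (ev B b) = Idn B (Unt B)"
  by (simp_all add: evA_irep) (simp_all add: ev_def)

lemma symmetric_monoidal_functor_ev: "symmetric_monoidal_functor \<I> B (ev B b)"
proof -
  interpret I: symmetric_picard \<I> by (rule symmetric_picard_\<I>)
  note ob = evO_Ob
  have cid: "f \<cdot>\<^bsub>B\<^esub> Idn B x = f" "Idn B y \<cdot>\<^bsub>B\<^esub> f = f" if "f \<in> Hom B x y" for f x y
    using that by (auto intro: cmp_idn idn_cmp)
  show ?thesis
  proof
    fix x y z
    show "FAr (ev B b) (Asc \<I> x y z) \<cdot>\<^bsub>B\<^esub> FTen (ev B b) (x \<otimes>\<^bsub>\<I>\<^esub> y) z \<cdot>\<^bsub>B\<^esub>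
          (FTen (ev B b) x y \<odot>\<^bsub>B\<^esub> Idn B (FOb (ev B b) z)) =
        FTen (ev B b) x (y \<otimes>\<^bsub>\<I>\<^esub> z) \<cdot>\<^bsub>B\<^esub> (Idn B (FOb (ev B b) x) \<odot>\<^bsub>B\<^esub> FTen (ev B b) y z) \<cdot>\<^bsub>B\<^esub>
          Asc B (FOb (ev B b) x) (FOb (ev B b) y) (FOb (ev B b) z)"
      by (simp add: evA_irep evA_ev_simps ev_FOb TenA_idn ob Ten cid[OF idn] cid[OF Asc])
  qed (auto elim!: \<I>_HomE simp: evA_irep evA_ev_simps ev_FOb TenA_idn ob Ten Unt
      cid[OF idn] cid[OF Lun] cid[OF Run] cid[OF Sym] cid[OF TenA[OF evA_Hom evA_Hom]]
      evA_Hom idn ev_FAr_ext)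
qed

lemma strict_arrow_ev: "strict_arrow \<I> B (ev B b)"
proof -
  interpret symmetric_monoidal_functor \<I> B "ev B b" by (rule symmetric_monoidal_functor_ev)
  show ?thesis
    by unfold_locales (auto simp: ev_FOb evA_ev_simps evA_irep)
qed

lemma strict_arrow_unique:
  assumes "strict_arrow \<I> B F" and "FOb F \<star> = b"
  shows "F = ev B b"
proof -
  interpret F: strict_arrow \<I> B F by (rule assms(1))
  have ob: "FOb F x = evO B b x" for x
    using F.strict_Ten F.strict_Unt F.strict_Dual assms(2) by (induction x) auto
  have FTen: "FTen F x y = Idn B (evO B b x \<otimes>\<^bsub>B\<^esub> evO B b y)" for x y
    using F.strict_FTen by (simp add: ob)
  have FUnt: "FUnt F = Idn B (Unt B)"
    by (rule F.strict_FUnt)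
  have cid: "f \<cdot>\<^bsub>B\<^esub> Idn B x = f" "Idn B y \<cdot>\<^bsub>B\<^esub> f = f" if "f \<in> Hom B x y" for f x y
    using that by (auto intro: cmp_idn idn_cmp)
  have Hom: "FAr F (icls t) \<in> Hom B (evO B b (idom t)) (evO B b (icod t))" if "iwf t" for t
    using F.FAr[of "icls t" "idom t" "icod t"] that by (simp add: ob)
  have ar: "FAr F (icls t) = evA B b t" if "iwf t" for t
    using that
  proof (induction t)
    case (TId x)
    then show ?case using F.F_idn[of x] by (simp add: ob)
  next
    case (TCmp t s)
    then show ?case using F.F_cmp[of "icls s" "idom s" "icod s" "icls t" "icod t"] by simp
  next
    case (TInv t)
    have "inverse_arrows B (FAr F (icls t)) (FAr F (icls (TInv t)))"
    proof -
      have 1: "FAr F (icls (TInv t)) \<cdot>\<^bsub>B\<^esub> FAr F (icls t) = Idn B (evO B b (idom t))"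
        using F.F_cmp[of "icls t" "idom t" "icod t" "icls (TInv t)" "idom t"] TInv.prems
          icls_eqI[OF ieq.inv_left, of t] F.F_idn[of "idom t"] by (simp add: ob)
      have 2: "FAr F (icls t) \<cdot>\<^bsub>B\<^esub> FAr F (icls (TInv t)) = Idn B (evO B b (icod t))"
        using F.F_cmp[of "icls (TInv t)" "icod t" "idom t" "icls t" "icod t"] TInv.prems
          icls_eqI[OF ieq.inv_right, of t] F.F_idn[of "icod t"] by (simp add: ob)
      from 1 2 Hom[of t] Hom[of "TInv t"] TInv.prems show ?thesis
        by (auto simp: inverse_arrows_def Hom_def)
    qed
    with TInv show ?case by (simp add: Inv_eq)
  next
    case (TTen t s)
    have "FAr F (icls (TTen t s)) \<in>
        Hom B (evO B b (idom t) \<otimes>\<^bsub>B\<^esub> evO B b (idom s)) (evO B b (icod t) \<otimes>\<^bsub>B\<^esub> evO B b (icod s))"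
      using Hom[of "TTen t s"] TTen.prems by simp
    moreover have "FAr F (icls t) \<odot>\<^bsub>B\<^esub> FAr F (icls s) \<in>
        Hom B (evO B b (idom t) \<otimes>\<^bsub>B\<^esub> evO B b (idom s)) (evO B b (icod t) \<otimes>\<^bsub>B\<^esub> evO B b (icod s))"
      using TenA[OF Hom[of t] Hom[of s]] TTen.prems by simp
    ultimately show ?case
      using F.FTen_nat[of "icls t" "idom t" "icod t" "icls s" "idom s" "icod s"] TTen
      by (simp add: FTen cid)
  next
    case (TAsc x y z)
    then show ?case
      using F.F_Asc[of x y z] Hom[of "TAsc x y z"]
      by (simp add: FTen ob evO_Ob Ten TenA_idn cid[OF idn] cid[OF Asc] cid)
  next
    case (TLun x)
    then show ?case
      using F.F_Lun[of x] Hom[of "TLun x"]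
      by (simp add: FTen FUnt ob evO_Ob Ten Unt TenA_idn cid[OF idn] cid)
  next
    case (TRun x)
    then show ?case
      using F.F_Run[of x] Hom[of "TRun x"]
      by (simp add: FTen FUnt ob evO_Ob Ten Unt TenA_idn cid[OF idn] cid)
  next
    case (TSym x y)
    then show ?case
      using F.F_Sym[of x y] Hom[of "TSym x y"]
      by (simp add: FTen ob evO_Ob Ten cid[OF Sym] cid)
  next
    case (TJay x)
    then show ?case using F.strict_Jay[of x] by (simp add: ob)
  qed
  have "FAr F = FAr (ev B b)"
  proof
    fix X
    show "FAr F X = FAr (ev B b) X"
    proof (cases "X \<in> Ar \<I>")
      case True
      then show ?thesis by (auto simp: \<I>_Ar ar evA_irep)
    next
      case False
      then show ?thesis using F.FAr_ext by (simp add: ev_def extensional_def)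
    qed
  qed
  then show ?thesis
    by (intro smf.equality) (auto simp: ob FTen FUnt ev_FOb evA_ev_simps fun_eq_iff)
qed

end

theorem \<I>_free:
  assumes "symmetric_picard B" and "b \<in> Ob B"
  shows "\<exists>!F. strict_arrow \<I> B F \<and> FOb F \<star> = b"
proof (rule ex1I)
  show "strict_arrow \<I> B (ev B b) \<and> FOb (ev B b) \<star> = b"
    using strict_arrow_ev[OF assms] by (simp add: ev_FOb[OF assms])
qed (use strict_arrow_unique[OF assms] in blast)

definition act_map :: "('o, 'a) spc \<Rightarrow>
    (iobj, iterm set, ('o, 'a, 'o, 'a) smf, ('o, 'a, 'o, 'a) smt) smf" where
  "act_map A = (THE V. strict_arrow \<I> (ihom A A) V \<and> FOb V \<star> = id_smf A)"

text \<open>The multiplication of the unit 2-ring; its unit is \<open>\<star>\<close>.\<close>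

definition imult :: "iobj \<Rightarrow> iobj \<Rightarrow> iobj" (infixl "\<bullet>" 70) where
  "t \<bullet> s = FOb (FOb (act_map \<I>) t) s"


section \<open>Modules over the unit 2-ring\<close>

type_synonym ('o, 'a) lin_map = "('o, 'a, 'o, 'a) smf"
type_synonym ('o, 'a) lin_trans = "('o, 'a, 'o, 'a) smt"
type_synonym ('o, 'a) bilin_map = "(iobj, iterm set, ('o, 'a) lin_map, ('o, 'a) lin_trans) smf"
type_synonym ('o, 'a) bilin_trans = "(iobj, iterm set, ('o, 'a) lin_map, ('o, 'a) lin_trans) smt"
type_synonym ('o, 'a) trilin_map =
  "(iobj, iterm set, ('o, 'a) bilin_map, ('o, 'a) bilin_trans) smf"
type_synonym ('o, 'a) trilin_trans =
  "(iobj, iterm set, ('o, 'a) bilin_map, ('o, 'a) bilin_trans) smt"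

record ('o, 'a) imod =
  Und :: "('o, 'a) spc"
  Act :: "('o, 'a) bilin_map"
  Beta :: "('o, 'a) trilin_trans"
  Gamma :: "('o, 'a) lin_trans"

text \<open>
  The trilinear maps \<open>(t\<^sub>1, t\<^sub>2, m) \<mapsto> t\<^sub>1 \<times> (t\<^sub>2 \<times> m)\<close>, i.e.
  \<open>\<I> \<rightarrow> [M, M] \<rightarrow> [[M, M], [M, M]] \<rightarrow> [\<I>, [M, M]]\<close>, and \<open>(t\<^sub>1, t\<^sub>2, m) \<mapsto> (t\<^sub>1 \<bullet> t\<^sub>2) \<times> m\<close>, i.e.
  \<open>\<I> \<rightarrow> [\<I>, \<I>] \<rightarrow> [\<I>, [M, M]]\<close>.
\<close>

definition act_act :: "('o, 'a) spc \<Rightarrow> ('o, 'a) bilin_map \<Rightarrow> ('o, 'a) trilin_map" where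
  "act_act M \<phi> =
     comp_smf \<I> (ihom \<I> (ihom M M))
       (comp_smf (ihom M M) (ihom \<I> (ihom M M))
          (pre \<I> (ihom M M) (ihom M M) \<phi>) (post_functor M M M)) \<phi>"

definition mult_act :: "('o, 'a) spc \<Rightarrow> ('o, 'a) bilin_map \<Rightarrow> ('o, 'a) trilin_map" where
  "mult_act M \<phi> =
     comp_smf \<I> (ihom \<I> (ihom M M)) (post \<I> \<I> (ihom M M) \<phi>) (act_map \<I>)"

definition act_ob :: "('o, 'a) imod \<Rightarrow> iobj \<Rightarrow> 'o \<Rightarrow> 'o" where
  "act_ob M t m = FOb (FOb (Act M) t) m"

definition act_ar :: "('o, 'a) imod \<Rightarrow> iobj \<Rightarrow> 'a \<Rightarrow> 'a" where
  "act_ar M t f = FAr (FOb (Act M) t) f"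

definition beta :: "('o, 'a) imod \<Rightarrow> iobj \<Rightarrow> iobj \<Rightarrow> 'o \<Rightarrow> 'a" where
  "beta M t s m = cpt (cpt (cpt (Beta M) t) s) m"

definition gamma :: "('o, 'a) imod \<Rightarrow> 'o \<Rightarrow> 'a" where
  "gamma M m = cpt (Gamma M) m"

locale imodule =
  fixes M :: "('o, 'a) imod"
  assumes Und: "symmetric_picard (Und M)"
    and Act: "Act M \<in> Ob (ihom \<I> (ihom (Und M) (Und M)))"
    and Beta: "Beta M \<in> Hom (ihom \<I> (ihom \<I> (ihom (Und M) (Und M))))
      (act_act (Und M) (Act M)) (mult_act (Und M) (Act M))"
    and Gamma: "Gamma M \<in> Hom (ihom (Und M) (Und M)) (id_smf (Und M)) (FOb (Act M) \<star>)"
    and beta_beta: "m \<in> Ob (Und M) \<Longrightarrow>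
      beta M (t\<^sub>1 \<bullet> t\<^sub>2) t\<^sub>3 m \<cdot>\<^bsub>Und M\<^esub> beta M t\<^sub>1 t\<^sub>2 (act_ob M t\<^sub>3 m) =
      beta M t\<^sub>1 (t\<^sub>2 \<bullet> t\<^sub>3) m \<cdot>\<^bsub>Und M\<^esub> act_ar M t\<^sub>1 (beta M t\<^sub>2 t\<^sub>3 m)"
    and beta_gamma: "m \<in> Ob (Und M) \<Longrightarrow>
      beta M t \<star> m \<cdot>\<^bsub>Und M\<^esub> act_ar M t (gamma M m) = Idn (Und M) (act_ob M t m)"
    and gamma_beta: "m \<in> Ob (Und M) \<Longrightarrow>
      beta M \<star> t m \<cdot>\<^bsub>Und M\<^esub> gamma M (act_ob M t m) = Idn (Und M) (act_ob M t m)"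

locale strict_imodule = imodule +
  assumes strict_Act: "strict_arrow \<I> (ihom (Und M) (Und M)) (Act M)"
    and strict_Beta: "Beta M = Idn (ihom \<I> (ihom \<I> (ihom (Und M) (Und M)))) (act_act (Und M) (Act M))"
    and strict_Gamma: "Gamma M = Idn (ihom (Und M) (Und M)) (id_smf (Und M))"

text \<open>The bilinear maps \<open>(t, m) \<mapsto> t \<times> H m\<close> and \<open>(t, m) \<mapsto> H (t \<times> m)\<close>, as arrows \<open>\<I> \<rightarrow> [M, N]\<close>.\<close>

definition act_after :: "('o, 'a) imod \<Rightarrow> ('o, 'a) imod \<Rightarrow> ('o, 'a) lin_map \<Rightarrow>
    ('o, 'a) bilin_map" where
  "act_after M N H =
     comp_smf \<I> (ihom (Und M) (Und N)) (pre (Und M) (Und N) (Und N) H) (Act N)"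

definition act_before :: "('o, 'a) imod \<Rightarrow> ('o, 'a) imod \<Rightarrow> ('o, 'a) lin_map \<Rightarrow>
    ('o, 'a) bilin_map" where
  "act_before M N H =
     comp_smf \<I> (ihom (Und M) (Und N)) (post (Und M) (Und M) (Und N) H) (Act M)"

locale imodule_morphism = M: imodule M + N: imodule N
  for M N :: "('o, 'a) imod" +
  fixes H :: "('o, 'a) lin_map" and \<delta> :: "('o, 'a) bilin_trans"
  assumes H: "H \<in> Ob (ihom (Und M) (Und N))"
    and delta: "\<delta> \<in> Hom (ihom \<I> (ihom (Und M) (Und N))) (act_after M N H) (act_before M N H)"
    and delta_gamma: "m \<in> Ob (Und M) \<Longrightarrow>
      FAr H (gamma M m) = cpt (cpt \<delta> \<star>) m \<cdot>\<^bsub>Und N\<^esub> gamma N (FOb H m)"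
    and delta_beta: "m \<in> Ob (Und M) \<Longrightarrow>
      cpt (cpt \<delta> (t\<^sub>1 \<bullet> t\<^sub>2)) m \<cdot>\<^bsub>Und N\<^esub> beta N t\<^sub>1 t\<^sub>2 (FOb H m) =
      FAr H (beta M t\<^sub>1 t\<^sub>2 m) \<cdot>\<^bsub>Und N\<^esub> cpt (cpt \<delta> t\<^sub>1) (act_ob M t\<^sub>2 m) \<cdot>\<^bsub>Und N\<^esub>
      act_ar N t\<^sub>1 (cpt (cpt \<delta> t\<^sub>2) m)"

type_synonym ('o, 'a) imod_mor =
  "('o, 'a) imod \<times> ('o, 'a) imod \<times> ('o, 'a) lin_map \<times> ('o, 'a) bilin_trans"

definition imod_id :: "('o, 'a) imod \<Rightarrow> ('o, 'a) imod_mor" where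
  "imod_id M = (M, M, id_smf (Und M), Idn (ihom \<I> (ihom (Und M) (Und M))) (Act M))"

fun imod_comp :: "('o, 'a) imod_mor \<Rightarrow> ('o, 'a) imod_mor \<Rightarrow> ('o, 'a) imod_mor" where
  "imod_comp (N', P, K, \<epsilon>) (M, N, H, \<delta>) =
     (let KH = comp_smf (Und M) (Und P) K H;
          S = act_after M P KH;
          T = act_before M P KH
      in (M, P, KH,
          \<lparr>Src = S, Trg = T,
           cpt = (\<lambda>t. \<lparr>Src = FOb S t, Trg = FOb T t,
             cpt = (\<lambda>m\<in>Ob (Und M).
               FAr K (cpt (cpt \<delta> t) m) \<cdot>\<^bsub>Und P\<^esub> cpt (cpt \<epsilon> t) (FOb H m))\<rparr>)\<rparr>))"

definition IMod :: "(('o, 'a) imod, ('o, 'a) imod_mor) cat" where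
  "IMod = \<lparr>Ob = {M. imodule M},
     Ar = {(M, N, H, \<delta>). imodule_morphism M N H \<delta>},
     Dom = (\<lambda>(M, N, H, \<delta>). M),
     Cod = (\<lambda>(M, N, H, \<delta>). N),
     Idn = imod_id,
     Cmp = imod_comp\<rparr>"

definition forgetful :: "(('o, 'a) imod, ('o, 'a) imod_mor,
    ('o, 'a) spc, ('o, 'a) spc \<times> ('o, 'a) spc \<times> ('o, 'a) lin_map) fctr" where
  "forgetful =
     \<lparr>FOb = (\<lambda>M\<in>Ob IMod. Und M),
      FAr = (\<lambda>(M, N, H, \<delta>)\<in>Ar IMod. (Und M, Und N, H))\<rparr>"

definition IMod_strict :: "(('o, 'a) imod, ('o, 'a) imod_mor) cat" where
  "IMod_strict = full_subcategory IMod {M. strict_imodule M}"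

text \<open>The inclusion of the full subcategory is the identity on its carriers.\<close>

definition inc :: "(('o, 'a) imod, ('o, 'a) imod_mor, ('o, 'a) imod, ('o, 'a) imod_mor) fctr" where
  "inc = idF IMod_strict"

end

theory Submission
  imports Defs
begin

text \<open>
  Tensoring with an object of a symmetric Picard category is fully faithful. A monoidal
  transformation between symmetric monoidal functors on \<open>\<I>\<close> is therefore determined by its
  component at \<open>\<star>\<close>, which can be prescribed arbitrarily: the components at duals are forced by
  naturality at the arrows \<open>j\<close>.

  Let \<open>M\<close> and \<open>N\<close> be modules and \<open>H : M \<rightarrow> N\<close> an arrow of \<open>SPC\<close>. Compatibility with \<open>\<gamma>\<close> says that
  the component at \<open>\<star>\<close> of a module structure \<open>\<delta>\<close> on \<open>H\<close> is \<open>H \<gamma>\<close> after the inverse of \<open>\<gamma> H\<close>, so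
  there is exactly one bilinear candidate. Both sides of its compatibility with \<open>\<beta>\<close> are monoidal
  transformations in \<open>t\<^sub>1\<close>, and at \<open>t\<^sub>1 = \<star>\<close> they agree by the unit axiom \<open>\<beta>\<^sub>\<star> \<circ> \<gamma> = id\<close>. Hence the
  forgetful functor is fully faithful. On the other hand, the strict action of \<open>\<I>\<close> on \<open>A\<close> is
  unique by freeness, and it is a module because \<open>t\<^sub>1 \<times> (t\<^sub>2 \<times> m)\<close> and \<open>(t\<^sub>1 \<bullet> t\<^sub>2) \<times> m\<close> are both
  strict in \<open>t\<^sub>1\<close> with the same value at \<open>\<star>\<close>.

  That the internal homs are symmetric Picard categories needs coherence of the interchange
  isomorphism, which is obtained from Mac Lane's theorem.
\<close>

section \<open>Symmetric monoidal groupoids\<close>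

text \<open>Freeness of \<open>\<I>\<close> concerns strict arrows and equality on the nose. This is
  why precomposition, postcomposition with a strict arrow and \<open>post_functor\<close> are shown
  to preserve units, tensor products and duals as equations of functors: only then is
  \<open>act_act\<close> a strict arrow that freeness can compare with \<open>mult_act\<close>. The
  delicate item is the dual of a functor, which is given by a description. Its existence is settled
  once, for the identity functor, and transported to \<open>F\<close> by precomposition; strictness
  with respect to duals comes from uniqueness in that description.

  The conditions on a module morphism are equations between families of arrows indexed by objects,
  and their two sides are not given as transformations between functors. Packaging them in iterated
  internal homs is avoided by a uniqueness lemma for families that respect tensor, unit and
  \<open>j\<close> alone. As a morphism is determined by its underlying arrow \<open>H\<close>, it
  is written \<open>mor M N H\<close>, and the laws of composition of module morphisms reduce to
  those of arrows of \<open>SPC\<close>.\<close>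

context category
begin

lemma Hom_ob: "f \<in> Hom C a b \<Longrightarrow> a \<in> Ob C" "f \<in> Hom C a b \<Longrightarrow> b \<in> Ob C"
  using dom_cod by (auto simp: Hom_def)

lemma Hom_ar: "f \<in> Hom C a b \<Longrightarrow> f \<in> Ar C" "f \<in> Hom C a b \<Longrightarrow> Dom C f = a"
  "f \<in> Hom C a b \<Longrightarrow> Cod C f = b"
  by (auto simp: Hom_def)

lemma dom_ob [simp]: "f \<in> Ar C \<Longrightarrow> Dom C f \<in> Ob C" "f \<in> Ar C \<Longrightarrow> Cod C f \<in> Ob C"
  using dom_cod by auto

lemma idn_ar [simp]:
  "a \<in> Ob C \<Longrightarrow> Idn C a \<in> Ar C" "a \<in> Ob C \<Longrightarrow> Dom C (Idn C a) = a"
  "a \<in> Ob C \<Longrightarrow> Cod C (Idn C a) = a"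
  using idn by (auto simp: Hom_def)

lemma cmp_ar [simp]:
  "\<lbrakk>f \<in> Ar C; g \<in> Ar C; Dom C g = Cod C f\<rbrakk> \<Longrightarrow> g \<cdot> f \<in> Ar C"
  "\<lbrakk>f \<in> Ar C; g \<in> Ar C; Dom C g = Cod C f\<rbrakk> \<Longrightarrow> Dom C (g \<cdot> f) = Dom C f"
  "\<lbrakk>f \<in> Ar C; g \<in> Ar C; Dom C g = Cod C f\<rbrakk> \<Longrightarrow> Cod C (g \<cdot> f) = Cod C g"
  using cmp[of f "Dom C f" "Cod C f" g "Cod C g"] by (auto simp: Hom_def)

lemma idn_cmp' [simp]: "\<lbrakk>f \<in> Ar C; Cod C f = b\<rbrakk> \<Longrightarrow> Idn C b \<cdot> f = f"
  and cmp_idn' [simp]: "\<lbrakk>f \<in> Ar C; Dom C f = a\<rbrakk> \<Longrightarrow> f \<cdot> Idn C a = f"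
  using idn_cmp[of f "Dom C f" b] cmp_idn[of f a "Cod C f"] by (auto simp: Hom_def)

lemma assoc [simp]:
  "\<lbrakk>f \<in> Ar C; g \<in> Ar C; h \<in> Ar C; Dom C g = Cod C f; Dom C h = Cod C g\<rbrakk>
    \<Longrightarrow> (h \<cdot> g) \<cdot> f = h \<cdot> (g \<cdot> f)"
  using cmp_assoc[of f "Dom C f" "Cod C f" g "Cod C g" h "Cod C h"] by (auto simp: Hom_def)

text \<open>Simplification nests composites to the right, where the left side of an equation
  \<open>g \<cdot> f = h\<close> is no longer a subterm once something precedes it. This is the
  version with a tail \<open>k\<close>; most later calculations rewrite with
  \<open>chain[OF ...]\<close>.\<close>

lemma chain:
  "\<lbrakk>g \<cdot> f = h; f \<in> Ar C; g \<in> Ar C; Dom C g = Cod C f; k \<in> Ar C; Dom C f = Cod C k\<rbrakk>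
    \<Longrightarrow> g \<cdot> (f \<cdot> k) = h \<cdot> k"
  using assoc[of k f g] by simp

end

context symmetric_picard
begin

lemma inv_ar [simp]:
  "f \<in> Ar C \<Longrightarrow> Inv C f \<in> Ar C" "f \<in> Ar C \<Longrightarrow> Dom C (Inv C f) = Cod C f"
  "f \<in> Ar C \<Longrightarrow> Cod C (Inv C f) = Dom C f"
  using Inv_Hom(1)[of f "Dom C f" "Cod C f"] by (auto simp: Hom_def)

lemma inv_cmp [simp]: "f \<in> Ar C \<Longrightarrow> Inv C f \<cdot> f = Idn C (Dom C f)"
  and cmp_inv [simp]: "f \<in> Ar C \<Longrightarrow> f \<cdot> Inv C f = Idn C (Cod C f)"
  using Inv_Hom(2,3)[of f "Dom C f" "Cod C f"] by (auto simp: Hom_def)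

lemma inv_cmp_cmp [simp]:
  "\<lbrakk>f \<in> Ar C; g \<in> Ar C; Dom C f = Cod C g\<rbrakk> \<Longrightarrow> Inv C f \<cdot> (f \<cdot> g) = g"
  "\<lbrakk>f \<in> Ar C; g \<in> Ar C; Cod C f = Cod C g\<rbrakk> \<Longrightarrow> f \<cdot> (Inv C f \<cdot> g) = g"
  using chain[OF inv_cmp, of f g] chain[OF cmp_inv, of f g] by auto

lemma cancel_left:
  "\<lbrakk>f \<cdot> g = f \<cdot> h; f \<in> Ar C; g \<in> Ar C; h \<in> Ar C; Dom C f = Cod C g; Dom C f = Cod C h\<rbrakk>
    \<Longrightarrow> g = h"
  by (metis inv_cmp_cmp(1))

lemma cancel_right:
  assumes "f \<cdot> h = g \<cdot> h" "f \<in> Ar C" "g \<in> Ar C" "h \<in> Ar C" "Dom C f = Cod C h" "Dom C g = Cod C h"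
  shows "f = g"
proof -
  have "(f \<cdot> h) \<cdot> Inv C h = (g \<cdot> h) \<cdot> Inv C h" using assms(1) by simp
  then show ?thesis using assms(2-) by simp
qed

lemma inv_eqI: "\<lbrakk>g \<cdot> f = Idn C a; f \<in> Ar C; g \<in> Ar C; Dom C g = Cod C f; Dom C f = a\<rbrakk> \<Longrightarrow> Inv C f = g"
  by (rule cancel_right[of _ f]) auto

lemma inv_idn [simp]: "a \<in> Ob C \<Longrightarrow> Inv C (Idn C a) = Idn C a"
  by (rule inv_eqI) auto

lemma unt_ob [simp]: "Unt C \<in> Ob C"
  by (rule Unt)

lemma ten_ob [simp]: "\<lbrakk>a \<in> Ob C; b \<in> Ob C\<rbrakk> \<Longrightarrow> a \<otimes> b \<in> Ob C"
  by (rule Ten)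

lemma dual_ob [simp]: "a \<in> Ob C \<Longrightarrow> Dual C a \<in> Ob C"
  by (rule Dual)

lemma tenA_ar [simp]:
  "\<lbrakk>f \<in> Ar C; g \<in> Ar C\<rbrakk> \<Longrightarrow> f \<odot> g \<in> Ar C"
  "\<lbrakk>f \<in> Ar C; g \<in> Ar C\<rbrakk> \<Longrightarrow> Dom C (f \<odot> g) = Dom C f \<otimes> Dom C g"
  "\<lbrakk>f \<in> Ar C; g \<in> Ar C\<rbrakk> \<Longrightarrow> Cod C (f \<odot> g) = Cod C f \<otimes> Cod C g"
  using TenA[of f "Dom C f" "Cod C f" g "Dom C g" "Cod C g"] by (auto simp: Hom_def)

lemma tenA_idn [simp]: "\<lbrakk>a \<in> Ob C; b \<in> Ob C\<rbrakk> \<Longrightarrow> Idn C a \<odot> Idn C b = Idn C (a \<otimes> b)"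
  by (rule TenA_idn)

text \<open>Functoriality of the tensor product, oriented to gather everything into a single tensor
  of composites; \<open>merge_chain\<close> is the form with a tail.\<close>

lemma merge:
  "\<lbrakk>f \<in> Ar C; f' \<in> Ar C; g \<in> Ar C; g' \<in> Ar C; Dom C f' = Cod C f; Dom C g' = Cod C g\<rbrakk>
    \<Longrightarrow> (f' \<odot> g') \<cdot> (f \<odot> g) = (f' \<cdot> f) \<odot> (g' \<cdot> g)"
  using TenA_cmp[of f "Dom C f" "Cod C f" f' "Cod C f'" g "Dom C g" "Cod C g" g' "Cod C g'"]
  by (auto simp: Hom_def)

lemma merge_chain:
  "\<lbrakk>f \<in> Ar C; f' \<in> Ar C; g \<in> Ar C; g' \<in> Ar C; Dom C f' = Cod C f; Dom C g' = Cod C g;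
    k \<in> Ar C; Cod C k = Dom C f \<otimes> Dom C g\<rbrakk>
    \<Longrightarrow> (f' \<odot> g') \<cdot> ((f \<odot> g) \<cdot> k) = ((f' \<cdot> f) \<odot> (g' \<cdot> g)) \<cdot> k"
  by (rule chain[OF merge]) auto

lemma whisker_left:
  "\<lbrakk>a \<in> Ob C; f \<in> Ar C; g \<in> Ar C; Dom C g = Cod C f\<rbrakk>
    \<Longrightarrow> Idn C a \<odot> (g \<cdot> f) = (Idn C a \<odot> g) \<cdot> (Idn C a \<odot> f)"
  and whisker_right:
  "\<lbrakk>a \<in> Ob C; f \<in> Ar C; g \<in> Ar C; Dom C g = Cod C f\<rbrakk>
    \<Longrightarrow> (g \<cdot> f) \<odot> Idn C a = (g \<odot> Idn C a) \<cdot> (f \<odot> Idn C a)"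
  by (auto simp: merge)

lemma inv_tenA [simp]: "\<lbrakk>f \<in> Ar C; g \<in> Ar C\<rbrakk> \<Longrightarrow> Inv C (f \<odot> g) = Inv C f \<odot> Inv C g"
  by (rule inv_eqI[of _ _ "Dom C f \<otimes> Dom C g"]) (auto simp: merge)

lemma inv_cmp_distrib:
  "\<lbrakk>f \<in> Ar C; g \<in> Ar C; Dom C g = Cod C f\<rbrakk> \<Longrightarrow> Inv C (g \<cdot> f) = Inv C f \<cdot> Inv C g"
  by (rule inv_eqI[of _ _ "Dom C f"]) auto

lemma asc_ar [simp]:
  assumes "a \<in> Ob C" "b \<in> Ob C" "c \<in> Ob C"
  shows "Asc C a b c \<in> Ar C" "Dom C (Asc C a b c) = (a \<otimes> b) \<otimes> c" "Cod C (Asc C a b c) = a \<otimes> (b \<otimes> c)"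
  using Asc[OF assms] by (auto simp: Hom_def)

lemma sym_ar [simp]:
  assumes "a \<in> Ob C" "b \<in> Ob C"
  shows "Sym C a b \<in> Ar C" "Dom C (Sym C a b) = a \<otimes> b" "Cod C (Sym C a b) = b \<otimes> a"
  using Sym[OF assms] by (auto simp: Hom_def)

lemma lun_run_ar [simp]:
  assumes "a \<in> Ob C"
  shows "Lun C a \<in> Ar C" "Dom C (Lun C a) = Unt C \<otimes> a" "Cod C (Lun C a) = a"
    "Run C a \<in> Ar C" "Dom C (Run C a) = a \<otimes> Unt C" "Cod C (Run C a) = a"
    "Jay C a \<in> Ar C" "Dom C (Jay C a) = Unt C" "Cod C (Jay C a) = Dual C a \<otimes> a"
  using Lun[OF assms] Run[OF assms] Jay[OF assms] by (auto simp: Hom_def)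

lemma asc_nat:
  "\<lbrakk>f \<in> Ar C; g \<in> Ar C; h \<in> Ar C; Cod C f = a; Cod C g = b; Cod C h = c\<rbrakk> \<Longrightarrow>
    Asc C a b c \<cdot> ((f \<odot> g) \<odot> h) = (f \<odot> (g \<odot> h)) \<cdot> Asc C (Dom C f) (Dom C g) (Dom C h)"
  using Asc_nat[of f "Dom C f" a g "Dom C g" b h "Dom C h" c] by (auto simp: Hom_def)

lemma asc_nat_idn:
  "\<lbrakk>a \<in> Ob C; b \<in> Ob C; h \<in> Ar C; Cod C h = c\<rbrakk> \<Longrightarrow>
    Asc C a b c \<cdot> (Idn C (a \<otimes> b) \<odot> h) = (Idn C a \<odot> (Idn C b \<odot> h)) \<cdot> Asc C a b (Dom C h)"
  using asc_nat[of "Idn C a" "Idn C b" h a b c] by simp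

lemma sym_nat:
  "\<lbrakk>f \<in> Ar C; g \<in> Ar C; Cod C f = a; Cod C g = b\<rbrakk> \<Longrightarrow>
    Sym C a b \<cdot> (f \<odot> g) = (g \<odot> f) \<cdot> Sym C (Dom C f) (Dom C g)"
  using Sym_nat[of f "Dom C f" a g "Dom C g" b] by (auto simp: Hom_def)

lemma lun_nat: "\<lbrakk>f \<in> Ar C; Cod C f = a\<rbrakk> \<Longrightarrow> Lun C a \<cdot> (Idn C (Unt C) \<odot> f) = f \<cdot> Lun C (Dom C f)"
  and run_nat: "\<lbrakk>f \<in> Ar C; Cod C f = a\<rbrakk> \<Longrightarrow> Run C a \<cdot> (f \<odot> Idn C (Unt C)) = f \<cdot> Run C (Dom C f)"
  using Lun_nat[of f "Dom C f" a] Run_nat[of f "Dom C f" a] by (auto simp: Hom_def)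

lemma sym_sym [simp]: "\<lbrakk>a \<in> Ob C; b \<in> Ob C\<rbrakk> \<Longrightarrow> Sym C b a \<cdot> Sym C a b = Idn C (a \<otimes> b)"
  by (rule Sym_Sym)

section \<open>Coherence of the unit isomorphisms\<close>

lemma unit_tenA_cancel:
  assumes "Idn C (Unt C) \<odot> f = Idn C (Unt C) \<odot> g" "f \<in> Ar C" "g \<in> Ar C" "Dom C f = Dom C g" "Cod C f = Cod C g"
  shows "f = g"
  using lun_nat[of f "Cod C f"] lun_nat[of g "Cod C f"] assms
  by (intro cancel_right[of f "Lun C (Dom C f)" g]) auto

lemma tenA_unit_cancel:
  assumes "f \<odot> Idn C (Unt C) = g \<odot> Idn C (Unt C)" "f \<in> Ar C" "g \<in> Ar C" "Dom C f = Dom C g" "Cod C f = Cod C g"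
  shows "f = g"
  using run_nat[of f "Cod C f"] run_nat[of g "Cod C f"] assms
  by (intro cancel_right[of f "Run C (Dom C f)" g]) auto

text \<open>Kelly's argument: tensored with the unit and precomposed with the invertible
  \<open>?X\<close>, both sides are evaluated by the pentagon, the triangle and naturality of
  \<open>Asc\<close>. The unit factor is then cancelled.\<close>

lemma lun_asc:
  assumes [simp]: "a \<in> Ob C" "b \<in> Ob C"
  shows "Lun C (a \<otimes> b) \<cdot> Asc C (Unt C) a b = Lun C a \<odot> Idn C b"
proof (rule unit_tenA_cancel)
  let ?I = "Unt C"
  let ?X = "Asc C ?I (?I \<otimes> a) b \<cdot> (Asc C ?I ?I a \<odot> Idn C b)"
  have "(Idn C ?I \<odot> (Lun C (a \<otimes> b) \<cdot> Asc C ?I a b)) \<cdot> ?X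
      = (Idn C ?I \<odot> Lun C (a \<otimes> b)) \<cdot> ((Idn C ?I \<odot> Asc C ?I a b) \<cdot> ?X)"
    using merge_chain[of "Idn C ?I" "Idn C ?I" "Asc C ?I a b" "Lun C (a \<otimes> b)" ?X] by simp
  also have "\<dots> = (Idn C ?I \<odot> Lun C (a \<otimes> b)) \<cdot> (Asc C ?I ?I (a \<otimes> b) \<cdot> Asc C (?I \<otimes> ?I) a b)"
    using pentagon[of ?I ?I a b] by simp
  also have "\<dots> = (Run C ?I \<odot> Idn C (a \<otimes> b)) \<cdot> Asc C (?I \<otimes> ?I) a b"
    by (rule chain[OF triangle]) auto
  also have "\<dots> = Asc C ?I a b \<cdot> ((Run C ?I \<odot> Idn C a) \<odot> Idn C b)"
    by (simp add: asc_nat)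
  also have "(Run C ?I \<odot> Idn C a) \<odot> Idn C b =
      ((Idn C ?I \<odot> Lun C a) \<odot> Idn C b) \<cdot> (Asc C ?I ?I a \<odot> Idn C b)"
    using triangle[of ?I a] by (simp add: merge)
  also have "Asc C ?I a b \<cdot> \<dots> = (Idn C ?I \<odot> (Lun C a \<odot> Idn C b)) \<cdot> ?X"
    using chain[OF asc_nat, of "Idn C ?I" "Lun C a" "Idn C b" ?I a b "Asc C ?I ?I a \<odot> Idn C b"]
    by simp
  finally show "Idn C ?I \<odot> (Lun C (a \<otimes> b) \<cdot> Asc C ?I a b) = Idn C ?I \<odot> (Lun C a \<odot> Idn C b)"
    by (rule cancel_right) auto
qed auto

text \<open>The hexagon for \<open>a\<close> and two units, read through \<open>lun_asc\<close> and
  the triangle, gives the equation tensored with the unit and preceded on both sides by the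
  invertible \<open>Sym C a ?I\<close>.\<close>

lemma lun_sym:
  assumes [simp]: "a \<in> Ob C"
  shows "Lun C a \<cdot> Sym C a (Unt C) = Run C a"
proof (rule tenA_unit_cancel)
  let ?I = "Unt C"
  have "Sym C a ?I \<cdot> (Run C a \<odot> Idn C ?I)
      = Sym C a ?I \<cdot> ((Idn C a \<odot> Lun C ?I) \<cdot> Asc C a ?I ?I)"
    by (simp add: triangle)
  also have "\<dots> = (Lun C ?I \<odot> Idn C a) \<cdot> (Sym C a (?I \<otimes> ?I) \<cdot> Asc C a ?I ?I)"
    by (subst chain[OF sym_nat]) auto
  also have "\<dots> = Lun C (?I \<otimes> a) \<cdot> (Asc C ?I ?I a \<cdot> Sym C a (?I \<otimes> ?I) \<cdot> Asc C a ?I ?I)"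
    by (simp add: chain[OF lun_asc])
  also have "\<dots> = Lun C (?I \<otimes> a) \<cdot> ((Idn C ?I \<odot> Sym C a ?I) \<cdot> Asc C ?I a ?I \<cdot> (Sym C a ?I \<odot> Idn C ?I))"
    by (subst hexagon) auto
  also have "\<dots> = Sym C a ?I \<cdot> (Lun C (a \<otimes> ?I) \<cdot> (Asc C ?I a ?I \<cdot> (Sym C a ?I \<odot> Idn C ?I)))"
    by (subst chain[OF lun_nat]) auto
  also have "\<dots> = Sym C a ?I \<cdot> ((Lun C a \<cdot> Sym C a ?I) \<odot> Idn C ?I)"
    by (simp add: chain[OF lun_asc] merge)
  finally show "(Lun C a \<cdot> Sym C a ?I) \<odot> Idn C ?I = Run C a \<odot> Idn C ?I"
    by (rule cancel_left[OF HOL.sym]) auto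
qed auto

section \<open>Exchange of the first two factors of a right-nested tensor product\<close>

definition swp :: "'o \<Rightarrow> 'o \<Rightarrow> 'o \<Rightarrow> 'a" where
  "swp a b c = Asc C b a c \<cdot> (Sym C a b \<odot> Idn C c) \<cdot> Inv C (Asc C a b c)"

lemma swp_ar [simp]:
  assumes "a \<in> Ob C" "b \<in> Ob C" "c \<in> Ob C"
  shows "swp a b c \<in> Ar C" "Dom C (swp a b c) = a \<otimes> (b \<otimes> c)" "Cod C (swp a b c) = b \<otimes> (a \<otimes> c)"
  using assms by (auto simp: swp_def)

lemma swp_asc:
  "\<lbrakk>a \<in> Ob C; b \<in> Ob C; c \<in> Ob C\<rbrakk> \<Longrightarrow> swp a b c \<cdot> Asc C a b c = Asc C b a c \<cdot> (Sym C a b \<odot> Idn C c)"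
  by (simp add: swp_def)

lemma swp_swp [simp]:
  "\<lbrakk>a \<in> Ob C; b \<in> Ob C; c \<in> Ob C\<rbrakk> \<Longrightarrow> swp b a c \<cdot> swp a b c = Idn C (a \<otimes> (b \<otimes> c))"
  by (simp add: swp_def merge_chain)

lemma inv_asc_nat:
  assumes "f \<in> Ar C" "g \<in> Ar C" "h \<in> Ar C" "Cod C f = a" "Cod C g = b" "Cod C h = c"
  shows "Inv C (Asc C a b c) \<cdot> (f \<odot> (g \<odot> h)) =
    ((f \<odot> g) \<odot> h) \<cdot> Inv C (Asc C (Dom C f) (Dom C g) (Dom C h))"
proof (rule cancel_left[of "Asc C a b c"])
  show "Asc C a b c \<cdot> Inv C (Asc C a b c) \<cdot> (f \<odot> (g \<odot> h)) =
    Asc C a b c \<cdot> ((f \<odot> g) \<odot> h) \<cdot> Inv C (Asc C (Dom C f) (Dom C g) (Dom C h))"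
    using assms by (auto simp: chain[OF asc_nat])
qed (use assms in auto)

lemma swp_nat:
  assumes "f \<in> Ar C" "g \<in> Ar C" "h \<in> Ar C" "Cod C f = a" "Cod C g = b" "Cod C h = c"
  shows "swp a b c \<cdot> (f \<odot> (g \<odot> h)) = (g \<odot> (f \<odot> h)) \<cdot> swp (Dom C f) (Dom C g) (Dom C h)"
proof -
  have "swp a b c \<cdot> (f \<odot> (g \<odot> h)) = Asc C b a c \<cdot> (Sym C a b \<odot> Idn C c) \<cdot>
      ((f \<odot> g) \<odot> h) \<cdot> Inv C (Asc C (Dom C f) (Dom C g) (Dom C h))"
    using assms by (auto simp: swp_def inv_asc_nat)
  also have "\<dots> = Asc C b a c \<cdot> ((g \<odot> f) \<odot> h) \<cdot> (Sym C (Dom C f) (Dom C g) \<odot> Idn C (Dom C h)) \<cdot>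
      Inv C (Asc C (Dom C f) (Dom C g) (Dom C h))"
    using assms by (auto simp: merge_chain sym_nat)
  also have "\<dots> = (g \<odot> (f \<odot> h)) \<cdot> swp (Dom C f) (Dom C g) (Dom C h)"
    using assms by (auto simp: swp_def chain[OF asc_nat])
  finally show ?thesis .
qed

text \<open>The hexagon in right-nested form: \<open>a\<close> passes \<open>b \<otimes> c\<close>
  by passing \<open>b\<close> and afterwards \<open>c\<close>. Pentagons carry the extra factor
  \<open>d\<close> along.\<close>

lemma swp_ten_right:
  assumes [simp]: "a \<in> Ob C" "b \<in> Ob C" "c \<in> Ob C" "d \<in> Ob C"
  shows "Asc C b c (a \<otimes> d) \<cdot> swp a (b \<otimes> c) d =
    (Idn C b \<odot> swp a c d) \<cdot> swp a b (c \<otimes> d) \<cdot> (Idn C a \<odot> Asc C b c d)"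
proof (rule cancel_right)
  let ?R = "Asc C a (b \<otimes> c) d \<cdot> (Asc C a b c \<odot> Idn C d)"
  have "(Asc C b c (a \<otimes> d) \<cdot> swp a (b \<otimes> c) d) \<cdot> ?R
      = Asc C b c (a \<otimes> d) \<cdot> Asc C (b \<otimes> c) a d \<cdot> ((Sym C a (b \<otimes> c) \<cdot> Asc C a b c) \<odot> Idn C d)"
    by (simp add: chain[OF swp_asc] merge)
  also have "\<dots> = (Idn C b \<odot> Asc C c a d) \<cdot> Asc C b (c \<otimes> a) d \<cdot>
      ((Asc C b c a \<cdot> Sym C a (b \<otimes> c) \<cdot> Asc C a b c) \<odot> Idn C d)"
    by (simp add: chain[OF pentagon] merge)
  also have "\<dots> = (Idn C b \<odot> Asc C c a d) \<cdot> Asc C b (c \<otimes> a) d \<cdot>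
      (((Idn C b \<odot> Sym C a c) \<cdot> Asc C b a c \<cdot> (Sym C a b \<odot> Idn C c)) \<odot> Idn C d)"
    by (simp only: hexagon assms)
  also have "\<dots> = (Idn C b \<odot> Asc C c a d) \<cdot> Asc C b (c \<otimes> a) d \<cdot>
      (((Idn C b \<odot> Sym C a c) \<odot> Idn C d) \<cdot> (Asc C b a c \<odot> Idn C d) \<cdot> ((Sym C a b \<odot> Idn C c) \<odot> Idn C d))"
    by (simp add: merge)
  also have "\<dots> = (Idn C b \<odot> Asc C c a d) \<cdot> (Idn C b \<odot> (Sym C a c \<odot> Idn C d)) \<cdot>
      Asc C b (a \<otimes> c) d \<cdot> (Asc C b a c \<odot> Idn C d) \<cdot> ((Sym C a b \<odot> Idn C c) \<odot> Idn C d)"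
    by (simp add: chain[OF asc_nat])
  also have "\<dots> = (Idn C b \<odot> swp a c d) \<cdot> (Idn C b \<odot> Asc C a c d) \<cdot>
      Asc C b (a \<otimes> c) d \<cdot> (Asc C b a c \<odot> Idn C d) \<cdot> ((Sym C a b \<odot> Idn C c) \<odot> Idn C d)"
    by (simp add: merge_chain swp_asc)
  also have "\<dots> = (Idn C b \<odot> swp a c d) \<cdot>
      ((Idn C b \<odot> Asc C a c d) \<cdot> Asc C b (a \<otimes> c) d \<cdot> (Asc C b a c \<odot> Idn C d)) \<cdot> ((Sym C a b \<odot> Idn C c) \<odot> Idn C d)"
    by simp
  also have "\<dots> = (Idn C b \<odot> swp a c d) \<cdot> (Asc C b a (c \<otimes> d) \<cdot> Asc C (b \<otimes> a) c d) \<cdot>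
      ((Sym C a b \<odot> Idn C c) \<odot> Idn C d)"
    by (simp only: pentagon assms)
  also have "\<dots> = (Idn C b \<odot> swp a c d) \<cdot> Asc C b a (c \<otimes> d) \<cdot> (Sym C a b \<odot> Idn C (c \<otimes> d)) \<cdot> Asc C (a \<otimes> b) c d"
    by (simp add: asc_nat)
  also have "\<dots> = (Idn C b \<odot> swp a c d) \<cdot> swp a b (c \<otimes> d) \<cdot> (Asc C a b (c \<otimes> d) \<cdot> Asc C (a \<otimes> b) c d)"
    by (simp add: chain[OF swp_asc])
  also have "\<dots> = ((Idn C b \<odot> swp a c d) \<cdot> swp a b (c \<otimes> d) \<cdot> (Idn C a \<odot> Asc C b c d)) \<cdot> ?R"
    by (simp add: pentagon)
  finally show "(Asc C b c (a \<otimes> d) \<cdot> swp a (b \<otimes> c) d) \<cdot> ?R =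
    ((Idn C b \<odot> swp a c d) \<cdot> swp a b (c \<otimes> d) \<cdot> (Idn C a \<odot> Asc C b c d)) \<cdot> ?R" .
qed auto

text \<open>The Yang-Baxter equation. By \<open>swp_ten_right\<close> each side is, up to
  associators, \<open>a\<close> moving past a product of \<open>b\<close> and \<open>c\<close>, and
  \<open>swp_nat\<close> at the symmetry of \<open>b\<close> and \<open>c\<close> identifies the
  two.\<close>

lemma swp_braid:
  assumes [simp]: "a \<in> Ob C" "b \<in> Ob C" "c \<in> Ob C" "d \<in> Ob C"
  shows "(Idn C c \<odot> swp a b d) \<cdot> swp a c (b \<otimes> d) \<cdot> (Idn C a \<odot> swp b c d) =
    swp b c (a \<otimes> d) \<cdot> (Idn C b \<odot> swp a c d) \<cdot> swp a b (c \<otimes> d)"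
proof (rule cancel_right)
  let ?R = "Idn C a \<odot> Asc C b c d"
  have "((Idn C c \<odot> swp a b d) \<cdot> swp a c (b \<otimes> d) \<cdot> (Idn C a \<odot> swp b c d)) \<cdot> ?R
      = ((Idn C c \<odot> swp a b d) \<cdot> swp a c (b \<otimes> d) \<cdot> (Idn C a \<odot> Asc C c b d)) \<cdot> (Idn C a \<odot> (Sym C b c \<odot> Idn C d))"
    by (simp add: merge swp_asc)
  also have "\<dots> = Asc C c b (a \<otimes> d) \<cdot> swp a (c \<otimes> b) d \<cdot> (Idn C a \<odot> (Sym C b c \<odot> Idn C d))"
    by (simp flip: swp_ten_right)
  also have "\<dots> = swp b c (a \<otimes> d) \<cdot> Asc C b c (a \<otimes> d) \<cdot> swp a (b \<otimes> c) d"
    by (simp add: swp_nat chain[OF swp_asc])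
  also have "\<dots> = (swp b c (a \<otimes> d) \<cdot> (Idn C b \<odot> swp a c d) \<cdot> swp a b (c \<otimes> d)) \<cdot> ?R"
    by (simp add: swp_ten_right)
  finally show "((Idn C c \<odot> swp a b d) \<cdot> swp a c (b \<otimes> d) \<cdot> (Idn C a \<odot> swp b c d)) \<cdot> ?R =
    (swp b c (a \<otimes> d) \<cdot> (Idn C b \<odot> swp a c d) \<cdot> swp a b (c \<otimes> d)) \<cdot> ?R" .
qed auto

lemma swp_unit:
  assumes [simp]: "a \<in> Ob C" "c \<in> Ob C"
  shows "Lun C (a \<otimes> c) \<cdot> swp a (Unt C) c = Idn C a \<odot> Lun C c"
proof (rule cancel_right)
  show "(Lun C (a \<otimes> c) \<cdot> swp a (Unt C) c) \<cdot> Asc C a (Unt C) c = (Idn C a \<odot> Lun C c) \<cdot> Asc C a (Unt C) c"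
    by (simp add: swp_asc chain[OF lun_asc] merge lun_sym triangle)
qed auto

end

section \<open>Coherence for symmetric monoidal categories\<close>

datatype fobj = FVar nat | FUnit | FTens fobj fobj

datatype farr =
    FId fobj | FCmp farr farr | FInv farr | FTenA farr farr
  | FAsc fobj fobj fobj | FLun fobj | FRun fobj | FSym fobj fobj

fun fdom :: "farr \<Rightarrow> fobj" and fcod :: "farr \<Rightarrow> fobj" where
  "fdom (FId x) = x"
| "fdom (FCmp t s) = fdom s"
| "fdom (FInv t) = fcod t"
| "fdom (FTenA t s) = FTens (fdom t) (fdom s)"
| "fdom (FAsc x y z) = FTens (FTens x y) z"
| "fdom (FLun x) = FTens FUnit x"
| "fdom (FRun x) = FTens x FUnit"
| "fdom (FSym x y) = FTens x y"
| "fcod (FId x) = x"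
| "fcod (FCmp t s) = fcod t"
| "fcod (FInv t) = fdom t"
| "fcod (FTenA t s) = FTens (fcod t) (fcod s)"
| "fcod (FAsc x y z) = FTens x (FTens y z)"
| "fcod (FLun x) = x"
| "fcod (FRun x) = x"
| "fcod (FSym x y) = FTens y x"

primrec fvars :: "fobj \<Rightarrow> nat set" where
  "fvars (FVar k) = {k}"
| "fvars FUnit = {}"
| "fvars (FTens x y) = fvars x \<union> fvars y"

text \<open>
  Symmetries are restricted to expressions without a common variable: \<open>Sym a a\<close> need not be an
  identity.
\<close>

fun fwf :: "farr \<Rightarrow> bool" where
  "fwf (FCmp t s) \<longleftrightarrow> fwf t \<and> fwf s \<and> fdom t = fcod s"
| "fwf (FInv t) \<longleftrightarrow> fwf t"
| "fwf (FTenA t s) \<longleftrightarrow> fwf t \<and> fwf s"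
| "fwf (FSym x y) \<longleftrightarrow> fvars x \<inter> fvars y = {}"
| "fwf _ \<longleftrightarrow> True"

text \<open>The normal form of an expression is the sorted list of its variables. The accumulator
  \<open>L\<close> turns tensor products into composition of maps on lists, so rebracketing does not
  change the normal form.\<close>

primrec insort_all :: "fobj \<Rightarrow> nat list \<Rightarrow> nat list" where
  "insort_all (FVar k) L = insort k L"
| "insort_all FUnit L = L"
| "insort_all (FTens x y) L = insort_all x (insort_all y L)"

lemma insort_insort_all: "insort k (insort_all x L) = insort_all x (insort k L)"
  by (induction x arbitrary: L) (auto simp: insort_left_comm)

lemma insort_all_commute: "insort_all x (insort_all y L) = insort_all y (insort_all x L)"
  by (induction x arbitrary: L) (auto simp: insort_insort_all)

text \<open>
  The arrow \<open>nrm x L : x \<otimes> L \<rightarrow> insort_all x L\<close> sorts the variables of \<open>x\<close> into the list \<open>L\<close>.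
  Structural arrows \<open>t : x \<rightarrow> y\<close> satisfy \<open>nrm y L \<circ> (t \<otimes> 1) = nrm x L\<close>, so they are determined by
  their domain and codomain.
\<close>

locale valuation = symmetric_picard C for C :: "('o, 'a) spc" (structure) +
  fixes v :: "nat \<Rightarrow> 'o"
  assumes v_ob [simp]: "v k \<in> Ob C"
begin

primrec oval :: "fobj \<Rightarrow> 'o" where
  "oval (FVar k) = v k"
| "oval FUnit = Unt C"
| "oval (FTens x y) = oval x \<otimes> oval y"

primrec aval :: "farr \<Rightarrow> 'a" where
  "aval (FId x) = Idn C (oval x)"
| "aval (FCmp t s) = aval t \<cdot> aval s"
| "aval (FInv t) = Inv C (aval t)"
| "aval (FTenA t s) = aval t \<odot> aval s"
| "aval (FAsc x y z) = Asc C (oval x) (oval y) (oval z)"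
| "aval (FLun x) = Lun C (oval x)"
| "aval (FRun x) = Run C (oval x)"
| "aval (FSym x y) = Sym C (oval x) (oval y)"

primrec lval :: "nat list \<Rightarrow> 'o" where
  "lval [] = Unt C"
| "lval (k # L) = v k \<otimes> lval L"

primrec ins :: "nat \<Rightarrow> nat list \<Rightarrow> 'a" where
  "ins k [] = Idn C (v k \<otimes> Unt C)"
| "ins k (h # L) =
    (if k \<le> h then Idn C (v k \<otimes> lval (h # L)) else (Idn C (v h) \<odot> ins k L) \<cdot> swp (v k) (v h) (lval L))"

primrec nrm :: "fobj \<Rightarrow> nat list \<Rightarrow> 'a" where
  "nrm (FVar k) L = ins k L"
| "nrm FUnit L = Lun C (lval L)"
| "nrm (FTens x y) L =
    nrm x (insort_all y L) \<cdot> (Idn C (oval x) \<odot> nrm y L) \<cdot> Asc C (oval x) (oval y) (lval L)"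

lemma oval_ob [simp]: "oval x \<in> Ob C"
  by (induction x) auto

lemma aval_ar [simp]:
  "fwf t \<Longrightarrow> aval t \<in> Ar C" "fwf t \<Longrightarrow> Dom C (aval t) = oval (fdom t)"
  "fwf t \<Longrightarrow> Cod C (aval t) = oval (fcod t)"
  by (induction t) auto

lemma lval_ob [simp]: "lval L \<in> Ob C"
  by (induction L) auto

lemma ins_ar [simp]:
  "ins k L \<in> Ar C" "Dom C (ins k L) = v k \<otimes> lval L" "Cod C (ins k L) = lval (insort k L)"
  by (induction L) auto

lemma nrm_ar [simp]:
  "nrm x L \<in> Ar C \<and> Dom C (nrm x L) = oval x \<otimes> lval L \<and> Cod C (nrm x L) = lval (insort_all x L)"
  by (induction x arbitrary: L) auto

text \<open>Induction along the list. If \<open>k \<le> h\<close>, inserting \<open>k\<close> is an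
  identity and the two exchanges of \<open>k\<close> and \<open>j\<close> on the right cancel.
  Otherwise both variables pass \<open>h\<close>, and the two orders of the three exchanges agree by
  \<open>swp_braid\<close>.\<close>

lemma ins_swap_less:
  "k < j \<Longrightarrow> ins k (insort j L) \<cdot> (Idn C (v k) \<odot> ins j L) =
    ins j (insort k L) \<cdot> (Idn C (v j) \<odot> ins k L) \<cdot> swp (v k) (v j) (lval L)"
proof (induction L)
  case Nil
  then show ?case by simp
next
  case (Cons h L)
  show ?case
  proof (cases "k \<le> h")
    case True
    with Cons.prems show ?thesis by (auto simp: merge_chain)
  next
    case False
    have "ins k (insort j (h # L)) \<cdot> (Idn C (v k) \<odot> ins j (h # L))
       = (Idn C (v h) \<odot> ins k (insort j L)) \<cdot> swp (v k) (v h) (lval (insort j L)) \<cdot>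
         (Idn C (v k) \<odot> (Idn C (v h) \<odot> ins j L)) \<cdot> (Idn C (v k) \<odot> swp (v j) (v h) (lval L))"
      using False Cons.prems by (simp add: merge)
    also have "\<dots> = (Idn C (v h) \<odot> (ins k (insort j L) \<cdot> (Idn C (v k) \<odot> ins j L))) \<cdot>
         swp (v k) (v h) (v j \<otimes> lval L) \<cdot> (Idn C (v k) \<odot> swp (v j) (v h) (lval L))"
      by (simp add: chain[OF swp_nat] merge_chain)
    also have "\<dots> = (Idn C (v h) \<odot> ins j (insort k L)) \<cdot> (Idn C (v h) \<odot> (Idn C (v j) \<odot> ins k L)) \<cdot>
         ((Idn C (v h) \<odot> swp (v k) (v j) (lval L)) \<cdot>
         swp (v k) (v h) (v j \<otimes> lval L) \<cdot> (Idn C (v k) \<odot> swp (v j) (v h) (lval L)))"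
      unfolding Cons.IH[OF Cons.prems]
      by (simp add: merge_chain insort_left_comm)
    also have "\<dots> = (Idn C (v h) \<odot> ins j (insort k L)) \<cdot> (Idn C (v h) \<odot> (Idn C (v j) \<odot> ins k L)) \<cdot>
         (swp (v j) (v h) (v k \<otimes> lval L) \<cdot> (Idn C (v j) \<odot> swp (v k) (v h) (lval L)) \<cdot>
         swp (v k) (v j) (v h \<otimes> lval L))"
      by (simp only: swp_braid v_ob lval_ob)
    also have "\<dots> = (Idn C (v h) \<odot> ins j (insort k L)) \<cdot> swp (v j) (v h) (lval (insort k L)) \<cdot>
         (Idn C (v j) \<odot> ((Idn C (v h) \<odot> ins k L) \<cdot> swp (v k) (v h) (lval L))) \<cdot>
         swp (v k) (v j) (v h \<otimes> lval L)"
      by (simp add: chain[OF swp_nat] whisker_left)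
    also have "\<dots> = ins j (insort k (h # L)) \<cdot> (Idn C (v j) \<odot> ins k (h # L)) \<cdot>
         swp (v k) (v j) (lval (h # L))"
      using False Cons.prems by simp
    finally show ?thesis .
  qed
qed

text \<open>Invariance of \<open>nrm\<close> under the symmetry of \<open>x\<close> and
  \<open>y\<close>, as a relation whose two arguments can be decomposed into variables separately.
  For \<open>x = y = FVar k\<close> it would force the exchange of two equal factors to be an
  identity.\<close>

definition commutes :: "fobj \<Rightarrow> fobj \<Rightarrow> bool" where
  "commutes x y \<longleftrightarrow> (\<forall>L. nrm x (insort_all y L) \<cdot> (Idn C (oval x) \<odot> nrm y L) =
    nrm y (insort_all x L) \<cdot> (Idn C (oval y) \<odot> nrm x L) \<cdot> swp (oval x) (oval y) (lval L))"

lemma commutes_sym: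
  assumes "commutes x y"
  shows "commutes y x"
  unfolding commutes_def
proof
  fix L
  have "nrm x (insort_all y L) \<cdot> (Idn C (oval x) \<odot> nrm y L) =
      nrm y (insort_all x L) \<cdot> (Idn C (oval y) \<odot> nrm x L) \<cdot> swp (oval x) (oval y) (lval L)"
    using assms by (simp add: commutes_def)
  then have "(nrm x (insort_all y L) \<cdot> (Idn C (oval x) \<odot> nrm y L)) \<cdot> swp (oval y) (oval x) (lval L) =
      (nrm y (insort_all x L) \<cdot> (Idn C (oval y) \<odot> nrm x L) \<cdot> swp (oval x) (oval y) (lval L)) \<cdot>
      swp (oval y) (oval x) (lval L)"
    by (simp only:)
  then show "nrm y (insort_all x L) \<cdot> (Idn C (oval y) \<odot> nrm x L) =
      nrm x (insort_all y L) \<cdot> (Idn C (oval x) \<odot> nrm y L) \<cdot> swp (oval y) (oval x) (lval L)"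
    by (simp add: insort_all_commute[of x y])
qed

lemma commutes_FVar: "k \<noteq> j \<Longrightarrow> commutes (FVar k) (FVar j)"
proof (cases "k < j")
  case True
  then show ?thesis by (simp add: commutes_def ins_swap_less)
next
  case False
  moreover assume "k \<noteq> j"
  ultimately have "commutes (FVar j) (FVar k)" by (simp add: commutes_def ins_swap_less)
  then show ?thesis by (rule commutes_sym)
qed

text \<open>By \<open>swp_ten_right\<close>, moving \<open>x\<close> past a tensor product is moving
  it past the two factors in turn, so the relation is inherited by tensor products;
  \<open>swp_unit\<close> is the case of the unit.\<close>

lemma commutes_right: "(\<And>k. k \<in> fvars y \<Longrightarrow> commutes x (FVar k)) \<Longrightarrow> commutes x y"
proof (induction y)
  case (FVar k)
  then show ?case by simp
next
  case FUnit
  show ?case by (simp add: commutes_def chain[OF lun_nat] swp_unit)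
next
  case (FTens y z)
  have y: "nrm x (insort_all y L) \<cdot> (Idn C (oval x) \<odot> nrm y L) =
      nrm y (insort_all x L) \<cdot> (Idn C (oval y) \<odot> nrm x L) \<cdot> swp (oval x) (oval y) (lval L)" for L
    using FTens.IH(1) FTens.prems by (simp add: commutes_def)
  have z: "nrm x (insort_all z L) \<cdot> (Idn C (oval x) \<odot> nrm z L) =
      nrm z (insort_all x L) \<cdot> (Idn C (oval z) \<odot> nrm x L) \<cdot> swp (oval x) (oval z) (lval L)" for L
    using FTens.IH(2) FTens.prems by (simp add: commutes_def)
  note ic = insort_all_commute[of x]
  show ?case
    unfolding commutes_def
  proof
    fix L
    let ?x = "oval x" and ?y = "oval y" and ?z = "oval z" and ?l = "lval L"
    have "nrm x (insort_all (FTens y z) L) \<cdot> (Idn C ?x \<odot> nrm (FTens y z) L)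
       = (nrm x (insort_all y (insort_all z L)) \<cdot> (Idn C ?x \<odot> nrm y (insort_all z L))) \<cdot>
         (Idn C ?x \<odot> (Idn C ?y \<odot> nrm z L)) \<cdot> (Idn C ?x \<odot> Asc C ?y ?z ?l)"
      by (simp add: merge_chain merge)
    also have "\<dots> = nrm y (insort_all x (insort_all z L)) \<cdot> (Idn C ?y \<odot> nrm x (insort_all z L)) \<cdot>
         (Idn C ?y \<odot> (Idn C ?x \<odot> nrm z L)) \<cdot> swp ?x ?y (?z \<otimes> ?l) \<cdot> (Idn C ?x \<odot> Asc C ?y ?z ?l)"
      by (simp only: y) (simp add: chain[OF swp_nat] ic)
    also have "\<dots> = nrm y (insort_all x (insort_all z L)) \<cdot>
         (Idn C ?y \<odot> (nrm x (insort_all z L) \<cdot> (Idn C ?x \<odot> nrm z L))) \<cdot> swp ?x ?y (?z \<otimes> ?l) \<cdot>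
         (Idn C ?x \<odot> Asc C ?y ?z ?l)"
      by (simp add: merge_chain)
    also have "\<dots> = nrm y (insort_all x (insort_all z L)) \<cdot> (Idn C ?y \<odot> nrm z (insort_all x L)) \<cdot>
         (Idn C ?y \<odot> (Idn C ?z \<odot> nrm x L)) \<cdot>
         ((Idn C ?y \<odot> swp ?x ?z ?l) \<cdot> swp ?x ?y (?z \<otimes> ?l) \<cdot> (Idn C ?x \<odot> Asc C ?y ?z ?l))"
      by (simp only: z) (simp add: merge_chain ic)
    also have "\<dots> = nrm y (insort_all x (insort_all z L)) \<cdot> (Idn C ?y \<odot> nrm z (insort_all x L)) \<cdot>
         (Idn C ?y \<odot> (Idn C ?z \<odot> nrm x L)) \<cdot> (Asc C ?y ?z (?x \<otimes> ?l) \<cdot> swp ?x (?y \<otimes> ?z) ?l)"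
      by (simp only: swp_ten_right oval_ob lval_ob)
    also have "\<dots> = nrm (FTens y z) (insort_all x L) \<cdot> (Idn C (oval (FTens y z)) \<odot> nrm x L) \<cdot>
         swp ?x (oval (FTens y z)) ?l"
      by (simp add: chain[OF asc_nat_idn] ic)
    finally show "nrm x (insort_all (FTens y z) L) \<cdot> (Idn C (oval x) \<odot> nrm (FTens y z) L) =
      nrm (FTens y z) (insort_all x L) \<cdot> (Idn C (oval (FTens y z)) \<odot> nrm x L) \<cdot>
      swp (oval x) (oval (FTens y z)) (lval L)" .
  qed
qed

lemma commutes_disjoint: "fvars x \<inter> fvars y = {} \<Longrightarrow> commutes x y"
  by (rule commutes_right, rule commutes_sym, rule commutes_right, rule commutes_FVar) auto

text \<open>Each generator is matched by one fact: the pentagon for \<open>FAsc\<close>,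
  \<open>lun_asc\<close> for \<open>FLun\<close>, the triangle for \<open>FRun\<close>,
  \<open>commutes\<close> for \<open>FSym\<close>. Equality of the normal forms goes through the
  same induction, since without it the two arrows would have different codomains.\<close>

lemma nrm_invariant:
  "fwf t \<Longrightarrow> insort_all (fcod t) L = insort_all (fdom t) L \<and>
    nrm (fcod t) L \<cdot> (aval t \<odot> Idn C (lval L)) = nrm (fdom t) L"
proof (induction t arbitrary: L)
  case (FCmp t s)
  have "nrm (fcod t) L \<cdot> ((aval t \<cdot> aval s) \<odot> Idn C (lval L)) =
      (nrm (fcod t) L \<cdot> (aval t \<odot> Idn C (lval L))) \<cdot> (aval s \<odot> Idn C (lval L))"
    using FCmp.prems by (simp add: merge)
  with FCmp show ?case by (simp del: assoc)
next
  case (FInv t)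
  have "nrm (fdom t) L \<cdot> (Inv C (aval t) \<odot> Idn C (lval L)) =
      (nrm (fcod t) L \<cdot> (aval t \<odot> Idn C (lval L))) \<cdot> (Inv C (aval t) \<odot> Idn C (lval L))"
    using FInv by simp
  also have "\<dots> = nrm (fcod t) L"
    using FInv.prems by (simp add: merge)
  finally show ?case using FInv by simp
next
  case (FTenA t s)
  let ?x = "oval (fdom t)" and ?x' = "oval (fcod t)" and ?y' = "oval (fcod s)"
  note [simp] = FTenA.IH(2)[THEN conjunct1] FTenA.IH(1)[THEN conjunct1]
  have "nrm (fcod (FTenA t s)) L \<cdot> (aval (FTenA t s) \<odot> Idn C (lval L))
     = nrm (fcod t) (insort_all (fcod s) L) \<cdot> (aval t \<odot> (nrm (fcod s) L \<cdot> (aval s \<odot> Idn C (lval L)))) \<cdot>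
       Asc C ?x (oval (fdom s)) (lval L)"
    using FTenA.prems by (simp add: asc_nat merge_chain)
  also have "\<dots> = (nrm (fcod t) (insort_all (fdom s) L) \<cdot> (aval t \<odot> Idn C (lval (insort_all (fdom s) L)))) \<cdot>
       (Idn C ?x \<odot> nrm (fdom s) L) \<cdot> Asc C ?x (oval (fdom s)) (lval L)"
    using FTenA.prems by (simp add: merge_chain FTenA.IH(2)[THEN conjunct2])
  also have "\<dots> = nrm (fdom (FTenA t s)) L"
    using FTenA.prems by (simp only: FTenA.IH(1) fwf.simps) simp
  finally show ?case using FTenA.prems by simp
next
  case (FAsc x y z)
  show ?case
    by (simp add: chain[OF asc_nat_idn] pentagon merge_chain)
next
  case (FLun x)
  show ?case by (simp add: lun_asc chain[OF lun_nat])
next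
  case (FRun x)
  show ?case by (simp add: triangle)
next
  case (FSym x y)
  then have "commutes x y" by (simp add: commutes_disjoint)
  then have "nrm y (insort_all x L) \<cdot> (Idn C (oval y) \<odot> nrm x L) \<cdot> swp (oval x) (oval y) (lval L) =
      nrm x (insort_all y L) \<cdot> (Idn C (oval x) \<odot> nrm y L)"
    by (simp add: commutes_def)
  then have "(nrm y (insort_all x L) \<cdot> (Idn C (oval y) \<odot> nrm x L) \<cdot> swp (oval x) (oval y) (lval L)) \<cdot>
      Asc C (oval x) (oval y) (lval L) =
      (nrm x (insort_all y L) \<cdot> (Idn C (oval x) \<odot> nrm y L)) \<cdot> Asc C (oval x) (oval y) (lval L)"
    by (simp only:)
  then show ?case
    by (simp add: insort_all_commute[of y x] swp_asc)
qed auto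

text \<open>At the empty list, \<open>nrm\<close> of the common codomain is invertible and can be
  cancelled from the two invariance equations. This leaves the two values tensored with the
  unit.\<close>

theorem coherence:
  assumes "fwf t" "fwf s" "fdom t = fdom s" "fcod t = fcod s"
  shows "aval t = aval s"
proof (rule tenA_unit_cancel)
  have "nrm (fcod s) [] \<cdot> (aval t \<odot> Idn C (Unt C)) = nrm (fcod s) [] \<cdot> (aval s \<odot> Idn C (Unt C))"
    using nrm_invariant[OF assms(1), of "[]"] nrm_invariant[OF assms(2), of "[]"] assms by simp
  then show "aval t \<odot> Idn C (Unt C) = aval s \<odot> Idn C (Unt C)"
    by (rule cancel_left) (use assms in auto)
qed (use assms in auto)

end

section \<open>Interchange and duality\<close>

text \<open>The syntactic counterpart of \<open>Interchange\<close>, by which identities between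
  interchange isomorphisms become instances of \<open>coherence\<close>.\<close>

definition FInterchange :: "fobj \<Rightarrow> fobj \<Rightarrow> fobj \<Rightarrow> fobj \<Rightarrow> farr" where
  "FInterchange a b c d =
     FCmp (FInv (FAsc a c (FTens b d)))
      (FCmp (FTenA (FId a) (FAsc c b d))
       (FCmp (FTenA (FId a) (FTenA (FSym b c) (FId d)))
        (FCmp (FTenA (FId a) (FInv (FAsc b c d))) (FAsc a b (FTens c d)))))"

lemma FInterchange_simps [simp]:
  "fdom (FInterchange a b c d) = FTens (FTens a b) (FTens c d)"
  "fcod (FInterchange a b c d) = FTens (FTens a c) (FTens b d)"
  "fwf (FInterchange a b c d) \<longleftrightarrow> fvars b \<inter> fvars c = {}"
  by (auto simp: FInterchange_def)

lemma (in valuation) aval_FInterchange [simp]: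
  "aval (FInterchange a b c d) = Interchange C (oval a) (oval b) (oval c) (oval d)"
  by (simp add: FInterchange_def Interchange_def)

context symmetric_picard
begin

text \<open>A valuation assigns an object to every natural number; beyond the end of the list it
  takes the unit.\<close>

lemma valuation_list:
  "set xs \<subseteq> Ob C \<Longrightarrow> valuation C (\<lambda>k. if k < length xs then xs ! k else Unt C)"
  by unfold_locales (use nth_mem in fastforce)

lemma interchange_ar [simp]:
  assumes "a \<in> Ob C" "b \<in> Ob C" "c \<in> Ob C" "d \<in> Ob C"
  shows "Interchange C a b c d \<in> Ar C"
    "Dom C (Interchange C a b c d) = (a \<otimes> b) \<otimes> (c \<otimes> d)"
    "Cod C (Interchange C a b c d) = (a \<otimes> c) \<otimes> (b \<otimes> d)"
  using assms by (auto simp: Interchange_def)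

lemma interchange_nat:
  assumes [simp]: "f \<in> Ar C" "g \<in> Ar C" "h \<in> Ar C" "k \<in> Ar C"
    and "Cod C f = a" "Cod C g = b" "Cod C h = c" "Cod C k = d"
  shows "Interchange C a b c d \<cdot> ((f \<odot> g) \<odot> (h \<odot> k)) =
    ((f \<odot> h) \<odot> (g \<odot> k)) \<cdot> Interchange C (Dom C f) (Dom C g) (Dom C h) (Dom C k)"
proof -
  have [simp]: "a = Cod C f" "b = Cod C g" "c = Cod C h" "d = Cod C k" using assms by auto
  have 1: "Asc C a b (c \<otimes> d) \<cdot> ((f \<odot> g) \<odot> (h \<odot> k)) =
      (f \<odot> (g \<odot> (h \<odot> k))) \<cdot> Asc C (Dom C f) (Dom C g) (Dom C h \<otimes> Dom C k)"
    by (simp add: asc_nat)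
  have 2: "(Idn C a \<odot> Inv C (Asc C b c d)) \<cdot> (f \<odot> (g \<odot> (h \<odot> k))) =
      (f \<odot> ((g \<odot> h) \<odot> k)) \<cdot> (Idn C (Dom C f) \<odot> Inv C (Asc C (Dom C g) (Dom C h) (Dom C k)))"
    by (simp add: merge inv_asc_nat)
  have 3: "(Idn C a \<odot> (Sym C b c \<odot> Idn C d)) \<cdot> (f \<odot> ((g \<odot> h) \<odot> k)) =
      (f \<odot> ((h \<odot> g) \<odot> k)) \<cdot> (Idn C (Dom C f) \<odot> (Sym C (Dom C g) (Dom C h) \<odot> Idn C (Dom C k)))"
    by (simp add: merge sym_nat)
  have 4: "(Idn C a \<odot> Asc C c b d) \<cdot> (f \<odot> ((h \<odot> g) \<odot> k)) =
      (f \<odot> (h \<odot> (g \<odot> k))) \<cdot> (Idn C (Dom C f) \<odot> Asc C (Dom C h) (Dom C g) (Dom C k))"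
    by (simp add: merge asc_nat)
  have 5: "Inv C (Asc C a c (b \<otimes> d)) \<cdot> (f \<odot> (h \<odot> (g \<odot> k))) =
      ((f \<odot> h) \<odot> (g \<odot> k)) \<cdot> Inv C (Asc C (Dom C f) (Dom C h) (Dom C g \<otimes> Dom C k))"
    by (simp add: inv_asc_nat)
  show ?thesis
    using 1 2 3 4 5 chain[OF 2] chain[OF 3] chain[OF 4] chain[OF 5]
    by (simp add: Interchange_def)
qed

text \<open>The first equation is the associativity axiom that makes the tensor product a monoidal
  functor with constraint \<open>Interchange\<close>; the second says that \<open>Asc\<close> is a
  monoidal transformation. They serve \<open>smf_tensor\<close> and \<open>mt_asc\<close>. Each
  object gets its own variable, so the symmetries inside the interchanges satisfy the disjointness
  condition.\<close>

lemma interchange_asc: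
  assumes [simp]: "a \<in> Ob C" "b \<in> Ob C" "c \<in> Ob C" "d \<in> Ob C" "e \<in> Ob C" "f \<in> Ob C"
  shows "(Asc C a c e \<odot> Asc C b d f) \<cdot> Interchange C (a \<otimes> c) (b \<otimes> d) e f \<cdot>
      (Interchange C a b c d \<odot> Idn C (e \<otimes> f)) =
    Interchange C a b (c \<otimes> e) (d \<otimes> f) \<cdot> (Idn C (a \<otimes> b) \<odot> Interchange C c d e f) \<cdot>
      Asc C (a \<otimes> b) (c \<otimes> d) (e \<otimes> f)" (is ?th1)
    and "Asc C (a \<otimes> d) (b \<otimes> e) (c \<otimes> f) \<cdot> (Interchange C a b d e \<odot> Idn C (c \<otimes> f)) \<cdot>
      Interchange C (a \<otimes> b) c (d \<otimes> e) f =
    (Idn C (a \<otimes> d) \<odot> Interchange C b c e f) \<cdot> Interchange C a (b \<otimes> c) d (e \<otimes> f) \<cdot>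
      (Asc C a b c \<odot> Asc C d e f)" (is ?th2)
proof -
  define v where "v k = (if k < length [a, b, c, d, e, f] then [a, b, c, d, e, f] ! k else Unt C)" for k
  interpret valuation C v
    unfolding v_def by (rule valuation_list) simp
  let ?a = "FVar 0" and ?b = "FVar 1" and ?c = "FVar 2" and ?d = "FVar 3" and ?e = "FVar 4" and ?f = "FVar 5"
  show ?th1
    using coherence[of "FCmp (FTenA (FAsc ?a ?c ?e) (FAsc ?b ?d ?f))
          (FCmp (FInterchange (FTens ?a ?c) (FTens ?b ?d) ?e ?f) (FTenA (FInterchange ?a ?b ?c ?d) (FId (FTens ?e ?f))))"
        "FCmp (FInterchange ?a ?b (FTens ?c ?e) (FTens ?d ?f))
          (FCmp (FTenA (FId (FTens ?a ?b)) (FInterchange ?c ?d ?e ?f)) (FAsc (FTens ?a ?b) (FTens ?c ?d) (FTens ?e ?f)))"]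
    by (simp add: v_def)
  show ?th2
    using coherence[of "FCmp (FAsc (FTens ?a ?d) (FTens ?b ?e) (FTens ?c ?f))
          (FCmp (FTenA (FInterchange ?a ?b ?d ?e) (FId (FTens ?c ?f))) (FInterchange (FTens ?a ?b) ?c (FTens ?d ?e) ?f))"
        "FCmp (FTenA (FId (FTens ?a ?d)) (FInterchange ?b ?c ?e ?f))
          (FCmp (FInterchange ?a (FTens ?b ?c) ?d (FTens ?e ?f)) (FTenA (FAsc ?a ?b ?c) (FAsc ?d ?e ?f)))"]
    by (simp add: v_def)
qed

text \<open>The first equation is the symmetry axiom for the tensor product as a monoidal functor,
  the second the monoidality of \<open>Sym\<close>.\<close>

lemma interchange_sym:
  assumes [simp]: "a \<in> Ob C" "b \<in> Ob C" "c \<in> Ob C" "d \<in> Ob C"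
  shows "(Sym C a c \<odot> Sym C b d) \<cdot> Interchange C a b c d = Interchange C c d a b \<cdot> Sym C (a \<otimes> b) (c \<otimes> d)"
    (is ?th1)
    and "Sym C (a \<otimes> c) (b \<otimes> d) \<cdot> Interchange C a b c d = Interchange C b a d c \<cdot> (Sym C a b \<odot> Sym C c d)"
    (is ?th2)
proof -
  define v where "v k = (if k < length [a, b, c, d] then [a, b, c, d] ! k else Unt C)" for k
  interpret valuation C v
    unfolding v_def by (rule valuation_list) simp
  let ?a = "FVar 0" and ?b = "FVar 1" and ?c = "FVar 2" and ?d = "FVar 3"
  show ?th1
    using coherence[of "FCmp (FTenA (FSym ?a ?c) (FSym ?b ?d)) (FInterchange ?a ?b ?c ?d)"
        "FCmp (FInterchange ?c ?d ?a ?b) (FSym (FTens ?a ?b) (FTens ?c ?d))"]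
    by (simp add: v_def)
  show ?th2
    using coherence[of "FCmp (FSym (FTens ?a ?c) (FTens ?b ?d)) (FInterchange ?a ?b ?c ?d)"
        "FCmp (FInterchange ?b ?a ?d ?c) (FTenA (FSym ?a ?b) (FSym ?c ?d))"]
    by (simp add: v_def)
qed

text \<open>The first two equations are the unit axioms for the tensor product as a monoidal
  functor, the last two the monoidality of \<open>Lun\<close> and \<open>Run\<close>.\<close>

lemma interchange_unit:
  assumes [simp]: "a \<in> Ob C" "b \<in> Ob C"
  shows "(Lun C a \<odot> Lun C b) \<cdot> Interchange C (Unt C) (Unt C) a b \<cdot> (Inv C (Lun C (Unt C)) \<odot> Idn C (a \<otimes> b)) =
      Lun C (a \<otimes> b)" (is ?th1)
    and "(Run C a \<odot> Run C b) \<cdot> Interchange C a b (Unt C) (Unt C) \<cdot> (Idn C (a \<otimes> b) \<odot> Inv C (Lun C (Unt C))) =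
      Run C (a \<otimes> b)" (is ?th2)
    and "Lun C (a \<otimes> b) \<cdot> (Lun C (Unt C) \<odot> Idn C (a \<otimes> b)) \<cdot> Interchange C (Unt C) a (Unt C) b =
      Lun C a \<odot> Lun C b" (is ?th3)
    and "Run C (a \<otimes> b) \<cdot> (Idn C (a \<otimes> b) \<odot> Lun C (Unt C)) \<cdot> Interchange C a (Unt C) b (Unt C) =
      Run C a \<odot> Run C b" (is ?th4)
proof -
  define v where "v k = (if k < length [a, b] then [a, b] ! k else Unt C)" for k
  interpret valuation C v
    unfolding v_def by (rule valuation_list) simp
  let ?a = "FVar 0" and ?b = "FVar 1"
  show ?th1
    using coherence[of "FCmp (FTenA (FLun ?a) (FLun ?b))
        (FCmp (FInterchange FUnit FUnit ?a ?b) (FTenA (FInv (FLun FUnit)) (FId (FTens ?a ?b))))" "FLun (FTens ?a ?b)"]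
    by (simp add: v_def)
  show ?th2
    using coherence[of "FCmp (FTenA (FRun ?a) (FRun ?b))
        (FCmp (FInterchange ?a ?b FUnit FUnit) (FTenA (FId (FTens ?a ?b)) (FInv (FLun FUnit))))" "FRun (FTens ?a ?b)"]
    by (simp add: v_def)
  show ?th3
    using coherence[of "FCmp (FLun (FTens ?a ?b)) (FCmp (FTenA (FLun FUnit) (FId (FTens ?a ?b)))
        (FInterchange FUnit ?a FUnit ?b))" "FTenA (FLun ?a) (FLun ?b)"]
    by (simp add: v_def)
  show ?th4
    using coherence[of "FCmp (FRun (FTens ?a ?b)) (FCmp (FTenA (FId (FTens ?a ?b)) (FLun FUnit))
        (FInterchange ?a FUnit ?b FUnit))" "FTenA (FRun ?a) (FRun ?b)"]
    by (simp add: v_def)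
qed

text \<open>An expression without variables is disjoint from itself, so coherence also covers the
  symmetry of the unit with itself.\<close>

lemma unit_coherence:
  shows run_unit: "Run C (Unt C) = Lun C (Unt C)"
    and sym_unit [simp]: "Sym C (Unt C) (Unt C) = Idn C (Unt C \<otimes> Unt C)"
    and asc_unit: "Lun C (Unt C) \<cdot> (Idn C (Unt C) \<odot> Lun C (Unt C)) \<cdot> Asc C (Unt C) (Unt C) (Unt C) =
      Lun C (Unt C) \<cdot> (Lun C (Unt C) \<odot> Idn C (Unt C))"
    and asc_unit_inv: "Asc C (Unt C) (Unt C) (Unt C) \<cdot> (Inv C (Lun C (Unt C)) \<odot> Idn C (Unt C)) =
      Idn C (Unt C) \<odot> Inv C (Lun C (Unt C))"
proof -
  interpret valuation C "\<lambda>k. Unt C"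
    by unfold_locales simp
  show "Run C (Unt C) = Lun C (Unt C)" using coherence[of "FRun FUnit" "FLun FUnit"] by simp
  show "Sym C (Unt C) (Unt C) = Idn C (Unt C \<otimes> Unt C)"
    using coherence[of "FSym FUnit FUnit" "FId (FTens FUnit FUnit)"] by simp
  show "Lun C (Unt C) \<cdot> (Idn C (Unt C) \<odot> Lun C (Unt C)) \<cdot> Asc C (Unt C) (Unt C) (Unt C) =
      Lun C (Unt C) \<cdot> (Lun C (Unt C) \<odot> Idn C (Unt C))"
    using coherence[of "FCmp (FLun FUnit) (FCmp (FTenA (FId FUnit) (FLun FUnit)) (FAsc FUnit FUnit FUnit))"
        "FCmp (FLun FUnit) (FTenA (FLun FUnit) (FId FUnit))"] by simp
  show "Asc C (Unt C) (Unt C) (Unt C) \<cdot> (Inv C (Lun C (Unt C)) \<odot> Idn C (Unt C)) =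
      Idn C (Unt C) \<odot> Inv C (Lun C (Unt C))"
    using coherence[of "FCmp (FAsc FUnit FUnit FUnit) (FTenA (FInv (FLun FUnit)) (FId FUnit))"
        "FTenA (FId FUnit) (FInv (FLun FUnit))"] by simp
qed

text \<open>Tensoring with an object is an equivalence, because \<open>a \<otimes> Dual C a\<close> is isomorphic to the unit.\<close>

lemma tenA_idn_faithful:
  assumes "f \<odot> Idn C x = g \<odot> Idn C x" and x [simp]: "x \<in> Ob C"
    and fg [simp]: "f \<in> Ar C" "g \<in> Ar C" "Dom C g = Dom C f" "Cod C g = Cod C f"
  shows "f = g"
proof (rule tenA_unit_cancel)
  \<comment> \<open>An isomorphism from the unit to \<open>x \<otimes> Dual C x\<close>. Through it,
    \<open>h \<odot> Idn C (Unt C)\<close> is recovered from \<open>h \<odot> Idn C x\<close> by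
    tensoring with \<open>Dual C x\<close> and rebracketing.\<close>
  let ?k = "Sym C (Dual C x) x \<cdot> Jay C x"
  have conj: "h \<odot> Idn C (Unt C) = (Idn C (Cod C h) \<odot> Inv C ?k) \<cdot> Asc C (Cod C h) x (Dual C x) \<cdot>
      ((h \<odot> Idn C x) \<odot> Idn C (Dual C x)) \<cdot> Inv C (Asc C (Dom C h) x (Dual C x)) \<cdot> (Idn C (Dom C h) \<odot> ?k)"
    if [simp]: "h \<in> Ar C" for h
    by (simp add: chain[OF asc_nat] merge_chain merge inv_cmp_distrib chain[OF sym_sym])
  show "f \<odot> Idn C (Unt C) = g \<odot> Idn C (Unt C)"
    using assms(1) by (simp add: conj)
qed auto

lemma tenA_faithful:
  assumes "f \<odot> u = g \<odot> u" and [simp]: "u \<in> Ar C" "f \<in> Ar C" "g \<in> Ar C" "Dom C g = Dom C f" "Cod C g = Cod C f"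
  shows "f = g"
proof (rule tenA_idn_faithful[where x = "Dom C u"])
  have "(Idn C (Cod C f) \<odot> Inv C u) \<cdot> (f \<odot> u) = (Idn C (Cod C f) \<odot> Inv C u) \<cdot> (g \<odot> u)"
    using assms(1) by simp
  then show "f \<odot> Idn C (Dom C u) = g \<odot> Idn C (Dom C u)"
    by (simp add: merge)
qed auto

text \<open>Fullness. After \<open>u\<close> is replaced by an identity, the natural isomorphism
  \<open>i c : c -> (c \<otimes> x) \<otimes> Dual C x\<close> conjugates
  \<open>q \<odot> Idn C (Dual C x)\<close> into the candidate \<open>f\<close>.\<close>

lemma tenA_ex:
  assumes u [simp]: "u \<in> Ar C" "a \<in> Ob C" "b \<in> Ob C"
    and p [simp]: "p \<in> Ar C" "Dom C p = a \<otimes> Dom C u" "Cod C p = b \<otimes> Cod C u"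
  shows "\<exists>f. f \<in> Hom C a b \<and> f \<odot> u = p"
proof -
  define x where "x = Dom C u"
  define q where "q = (Idn C b \<odot> Inv C u) \<cdot> p"
  have [simp]: "x \<in> Ob C" "q \<in> Ar C" "Dom C q = a \<otimes> x" "Cod C q = b \<otimes> x" by (auto simp: x_def q_def)
  let ?k = "Sym C (Dual C x) x \<cdot> Jay C x"
  define i where "i c = Inv C (Asc C c x (Dual C x)) \<cdot> (Idn C c \<odot> ?k) \<cdot> Inv C (Run C c)" for c
  have [simp]: "i c \<in> Ar C" "Dom C (i c) = c" "Cod C (i c) = (c \<otimes> x) \<otimes> Dual C x" if "c \<in> Ob C" for c
    using that by (auto simp: i_def)
  have i_nat: "i (Cod C h) \<cdot> h = ((h \<odot> Idn C x) \<odot> Idn C (Dual C x)) \<cdot> i (Dom C h)"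
    if [simp]: "h \<in> Ar C" for h
  proof -
    have run: "Inv C (Run C (Cod C h)) \<cdot> h = (h \<odot> Idn C (Unt C)) \<cdot> Inv C (Run C (Dom C h))"
    proof (rule cancel_left[of "Run C (Cod C h)"])
      show "Run C (Cod C h) \<cdot> Inv C (Run C (Cod C h)) \<cdot> h =
        Run C (Cod C h) \<cdot> (h \<odot> Idn C (Unt C)) \<cdot> Inv C (Run C (Dom C h))"
        by (simp add: chain[OF run_nat])
    qed auto
    have asc: "Inv C (Asc C (Cod C h) x (Dual C x)) \<cdot> (h \<odot> Idn C (x \<otimes> Dual C x)) =
        ((h \<odot> Idn C x) \<odot> Idn C (Dual C x)) \<cdot> Inv C (Asc C (Dom C h) x (Dual C x))"
      using inv_asc_nat[of h "Idn C x" "Idn C (Dual C x)" "Cod C h" x "Dual C x"] by simp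
    have "i (Cod C h) \<cdot> h = Inv C (Asc C (Cod C h) x (Dual C x)) \<cdot>
        ((Idn C (Cod C h) \<odot> ?k) \<cdot> (h \<odot> Idn C (Unt C))) \<cdot> Inv C (Run C (Dom C h))"
      by (simp add: i_def run)
    also have "(Idn C (Cod C h) \<odot> ?k) \<cdot> (h \<odot> Idn C (Unt C)) =
        (h \<odot> Idn C (x \<otimes> Dual C x)) \<cdot> (Idn C (Dom C h) \<odot> ?k)"
      by (simp add: merge)
    finally show ?thesis
      by (simp add: i_def chain[OF asc])
  qed
  define f where "f = Inv C (i b) \<cdot> (q \<odot> Idn C (Dual C x)) \<cdot> i a"
  have [simp]: "f \<in> Ar C" "Dom C f = a" "Cod C f = b" by (auto simp: f_def)
  \<comment> \<open>Naturality of \<open>i\<close> at \<open>f\<close> compares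
    \<open>f \<odot> Idn C x\<close> with \<open>q\<close> only after tensoring with
    \<open>Dual C x\<close>; faithfulness removes that factor.\<close>
  have "(f \<odot> Idn C x) \<odot> Idn C (Dual C x) = q \<odot> Idn C (Dual C x)"
  proof (rule cancel_right)
    show "((f \<odot> Idn C x) \<odot> Idn C (Dual C x)) \<cdot> i a = (q \<odot> Idn C (Dual C x)) \<cdot> i a"
      using i_nat[of f] by (simp add: f_def)
  qed auto
  then have "f \<odot> Idn C x = q"
    by (rule tenA_idn_faithful) auto
  moreover have "f \<odot> u = (Idn C b \<odot> u) \<cdot> (f \<odot> Idn C x)"
    by (simp add: merge x_def)
  ultimately have "f \<odot> u = p"
    by (simp add: q_def merge_chain)
  then show ?thesis by (intro exI[of _ f]) (simp add: Hom_def)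
qed

end

section \<open>Symmetric monoidal functors\<close>

context symmetric_monoidal_functor
begin

lemma F_ob [simp]: "a \<in> Ob A \<Longrightarrow> FOb F a \<in> Ob B"
  by (rule FOb)

lemma F_ar [simp]:
  "f \<in> Ar A \<Longrightarrow> FAr F f \<in> Ar B"
  "f \<in> Ar A \<Longrightarrow> Dom B (FAr F f) = FOb F (Dom A f)"
  "f \<in> Ar A \<Longrightarrow> Cod B (FAr F f) = FOb F (Cod A f)"
  using FAr[of f "Dom A f" "Cod A f"] by (auto simp: Hom_def)

lemma F_idn' [simp]: "a \<in> Ob A \<Longrightarrow> FAr F (Idn A a) = Idn B (FOb F a)"
  by (rule F_idn)

lemma F_cmp' [simp]:
  "\<lbrakk>f \<in> Ar A; g \<in> Ar A; Dom A g = Cod A f\<rbrakk> \<Longrightarrow> FAr F (g \<cdot>\<^bsub>A\<^esub> f) = FAr F g \<cdot>\<^bsub>B\<^esub> FAr F f"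
  using F_cmp[of f "Dom A f" "Cod A f" g "Cod A g"] by (auto simp: Hom_def)

lemma F_inv [simp]: "f \<in> Ar A \<Longrightarrow> FAr F (Inv A f) = Inv B (FAr F f)"
  using F_cmp'[of f "Inv A f"]
  by (intro B.inv_eqI[symmetric, of _ _ "FOb F (Dom A f)"]) (auto simp del: F_cmp')

lemma FTen_ar [simp]:
  assumes "a \<in> Ob A" "b \<in> Ob A"
  shows "FTen F a b \<in> Ar B" "Dom B (FTen F a b) = FOb F a \<otimes>\<^bsub>B\<^esub> FOb F b"
    "Cod B (FTen F a b) = FOb F (a \<otimes>\<^bsub>A\<^esub> b)"
  using FTen[OF assms] by (auto simp: Hom_def)

lemma FUnt_ar [simp]:
  "FUnt F \<in> Ar B" "Dom B (FUnt F) = Unt B" "Cod B (FUnt F) = FOb F (Unt A)"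
  using FUnt by (auto simp: Hom_def)

lemma FTen_nat':
  "\<lbrakk>f \<in> Ar A; g \<in> Ar A; Cod A f = a; Cod A g = b\<rbrakk> \<Longrightarrow>
    FTen F a b \<cdot>\<^bsub>B\<^esub> (FAr F f \<odot>\<^bsub>B\<^esub> FAr F g) = FAr F (f \<odot>\<^bsub>A\<^esub> g) \<cdot>\<^bsub>B\<^esub> FTen F (Dom A f) (Dom A g)"
  using FTen_nat[of f "Dom A f" a g "Dom A g" b] by (auto simp: Hom_def)

lemma FTen_nat_right:
  "\<lbrakk>f \<in> Ar A; Cod A f = a; b \<in> Ob A\<rbrakk> \<Longrightarrow>
    FTen F a b \<cdot>\<^bsub>B\<^esub> (FAr F f \<odot>\<^bsub>B\<^esub> Idn B (FOb F b)) = FAr F (f \<odot>\<^bsub>A\<^esub> Idn A b) \<cdot>\<^bsub>B\<^esub> FTen F (Dom A f) b"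
  and FTen_nat_left:
  "\<lbrakk>f \<in> Ar A; Cod A f = a; b \<in> Ob A\<rbrakk> \<Longrightarrow>
    FTen F b a \<cdot>\<^bsub>B\<^esub> (Idn B (FOb F b) \<odot>\<^bsub>B\<^esub> FAr F f) = FAr F (Idn A b \<odot>\<^bsub>A\<^esub> f) \<cdot>\<^bsub>B\<^esub> FTen F b (Dom A f)"
  using FTen_nat'[of f "Idn A b" a b] FTen_nat'[of "Idn A b" f b a] by auto

lemmas smf_axioms = symmetric_monoidal_functor_axioms

end

text \<open>The axioms restated with \<open>Ar\<close>, \<open>Dom\<close> and \<open>Cod\<close> in
  place of \<open>Hom\<close>, which is the vocabulary of the simp rules.\<close>

lemma symmetric_monoidal_functorI:
  fixes B (structure)
  assumes "symmetric_picard A" "symmetric_picard B"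
    and "FOb F \<in> extensional (Ob A)" "FAr F \<in> extensional (Ar A)" "FTen F \<in> extensional (Ob A)"
    and "\<And>a. a \<in> Ob A \<Longrightarrow> FTen F a \<in> extensional (Ob A)"
    and "\<And>a. a \<in> Ob A \<Longrightarrow> FOb F a \<in> Ob B"
    and "\<And>f. f \<in> Ar A \<Longrightarrow> FAr F f \<in> Ar B \<and> Dom B (FAr F f) = FOb F (Dom A f) \<and>
      Cod B (FAr F f) = FOb F (Cod A f)"
    and "\<And>a. a \<in> Ob A \<Longrightarrow> FAr F (Idn A a) = Idn B (FOb F a)"
    and "\<And>f g. \<lbrakk>f \<in> Ar A; g \<in> Ar A; Dom A g = Cod A f\<rbrakk> \<Longrightarrow> FAr F (g \<cdot>\<^bsub>A\<^esub> f) = FAr F g \<cdot> FAr F f"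
    and "\<And>a b. \<lbrakk>a \<in> Ob A; b \<in> Ob A\<rbrakk> \<Longrightarrow> FTen F a b \<in> Ar B \<and>
      Dom B (FTen F a b) = FOb F a \<otimes> FOb F b \<and> Cod B (FTen F a b) = FOb F (a \<otimes>\<^bsub>A\<^esub> b)"
    and "FUnt F \<in> Ar B \<and> Dom B (FUnt F) = Unt B \<and> Cod B (FUnt F) = FOb F (Unt A)"
    and "\<And>f g. \<lbrakk>f \<in> Ar A; g \<in> Ar A\<rbrakk> \<Longrightarrow> FTen F (Cod A f) (Cod A g) \<cdot> (FAr F f \<odot> FAr F g) =
      FAr F (f \<odot>\<^bsub>A\<^esub> g) \<cdot> FTen F (Dom A f) (Dom A g)"
    and "\<And>a b c. \<lbrakk>a \<in> Ob A; b \<in> Ob A; c \<in> Ob A\<rbrakk> \<Longrightarrow>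
      FAr F (Asc A a b c) \<cdot> FTen F (a \<otimes>\<^bsub>A\<^esub> b) c \<cdot> (FTen F a b \<odot> Idn B (FOb F c)) =
      FTen F a (b \<otimes>\<^bsub>A\<^esub> c) \<cdot> (Idn B (FOb F a) \<odot> FTen F b c) \<cdot> Asc B (FOb F a) (FOb F b) (FOb F c)"
    and "\<And>a. a \<in> Ob A \<Longrightarrow>
      FAr F (Lun A a) \<cdot> FTen F (Unt A) a \<cdot> (FUnt F \<odot> Idn B (FOb F a)) = Lun B (FOb F a)"
    and "\<And>a. a \<in> Ob A \<Longrightarrow>
      FAr F (Run A a) \<cdot> FTen F a (Unt A) \<cdot> (Idn B (FOb F a) \<odot> FUnt F) = Run B (FOb F a)"
    and "\<And>a b. \<lbrakk>a \<in> Ob A; b \<in> Ob A\<rbrakk> \<Longrightarrow>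
      FAr F (Sym A a b) \<cdot> FTen F a b = FTen F b a \<cdot> Sym B (FOb F a) (FOb F b)"
  shows "symmetric_monoidal_functor A B F"
proof -
  interpret A: symmetric_picard A by fact
  interpret B: symmetric_picard B by fact
  show ?thesis
    by unfold_locales (use assms in \<open>auto simp: Hom_def\<close>)
qed

lemma smf_eqI:
  assumes "symmetric_monoidal_functor A B F" "symmetric_monoidal_functor A B G"
    and "\<And>a. a \<in> Ob A \<Longrightarrow> FOb F a = FOb G a" "\<And>f. f \<in> Ar A \<Longrightarrow> FAr F f = FAr G f"
    and "\<And>a b. \<lbrakk>a \<in> Ob A; b \<in> Ob A\<rbrakk> \<Longrightarrow> FTen F a b = FTen G a b" "FUnt F = FUnt G"
  shows "F = G"
proof -
  interpret F: symmetric_monoidal_functor A B F by fact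
  interpret G: symmetric_monoidal_functor A B G by fact
  have "FTen F = FTen G"
    by (intro extensionalityI[OF F.FTen_ext G.FTen_ext] extensionalityI[OF F.FTen_ext' G.FTen_ext'])
      (auto simp: assms)
  moreover have "FOb F = FOb G" "FAr F = FAr G"
    using extensionalityI[OF F.FOb_ext G.FOb_ext] extensionalityI[OF F.FAr_ext G.FAr_ext] assms by auto
  ultimately show ?thesis using assms(6) by (intro smf.equality) auto
qed

section \<open>Identity, composites, unit and tensor product of functors\<close>

lemma (in symmetric_picard) smf_id: "symmetric_monoidal_functor C C (id_smf C)"
  by (rule symmetric_monoidal_functorI)
    (auto simp: id_smf_def symmetric_picard_axioms)

lemma id_smf_simps [simp]:
  "a \<in> Ob A \<Longrightarrow> FOb (id_smf A) a = a" "f \<in> Ar A \<Longrightarrow> FAr (id_smf A) f = f"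
  "a \<in> Ob A \<Longrightarrow> b \<in> Ob A \<Longrightarrow> FTen (id_smf A) a b = Idn A (a \<otimes>\<^bsub>A\<^esub> b)" "FUnt (id_smf A) = Idn A (Unt A)"
  by (auto simp: id_smf_def)

lemma comp_smf_simps [simp]:
  "a \<in> Ob A \<Longrightarrow> FOb (comp_smf A C G F) a = FOb G (FOb F a)"
  "f \<in> Ar A \<Longrightarrow> FAr (comp_smf A C G F) f = FAr G (FAr F f)"
  "a \<in> Ob A \<Longrightarrow> b \<in> Ob A \<Longrightarrow>
    FTen (comp_smf A C G F) a b = FAr G (FTen F a b) \<cdot>\<^bsub>C\<^esub> FTen G (FOb F a) (FOb F b)"
  "FUnt (comp_smf A C G F) = FAr G (FUnt F) \<cdot>\<^bsub>C\<^esub> FUnt G"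
  by (auto simp: comp_smf_def)

lemma unit_smf_simps [simp]:
  "a \<in> Ob A \<Longrightarrow> FOb (unit_smf A B) a = Unt B" "f \<in> Ar A \<Longrightarrow> FAr (unit_smf A B) f = Idn B (Unt B)"
  "a \<in> Ob A \<Longrightarrow> b \<in> Ob A \<Longrightarrow> FTen (unit_smf A B) a b = Lun B (Unt B)"
  "FUnt (unit_smf A B) = Idn B (Unt B)"
  by (auto simp: unit_smf_def)

lemma tensor_smf_simps [simp]:
  "a \<in> Ob A \<Longrightarrow> FOb (tensor_smf A B F G) a = FOb F a \<otimes>\<^bsub>B\<^esub> FOb G a"
  "f \<in> Ar A \<Longrightarrow> FAr (tensor_smf A B F G) f = FAr F f \<odot>\<^bsub>B\<^esub> FAr G f"
  "a \<in> Ob A \<Longrightarrow> b \<in> Ob A \<Longrightarrow> FTen (tensor_smf A B F G) a b = (FTen F a b \<odot>\<^bsub>B\<^esub> FTen G a b) \<cdot>\<^bsub>B\<^esub>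
                Interchange B (FOb F a) (FOb G a) (FOb F b) (FOb G b)"
  "FUnt (tensor_smf A B F G) = (FUnt F \<odot>\<^bsub>B\<^esub> FUnt G) \<cdot>\<^bsub>B\<^esub> Inv B (Lun B (Unt B))"
  by (auto simp: tensor_smf_def)

text \<open>Each axiom is the image under \<open>G\<close> of the axiom for \<open>F\<close>, pasted
  with the axiom for \<open>G\<close> along naturality of the constraint of
  \<open>G\<close>.\<close>

lemma smf_comp:
  fixes C (structure)
  assumes "symmetric_monoidal_functor A B F" "symmetric_monoidal_functor B C G"
  shows "symmetric_monoidal_functor A C (comp_smf A C G F)"
proof -
  interpret F: symmetric_monoidal_functor A B F by fact
  interpret G: symmetric_monoidal_functor B C G by fact
  let ?GF = "comp_smf A C G F"
  show ?thesis
  proof (rule symmetric_monoidal_functorI)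
    fix a b c assume [simp]: "a \<in> Ob A" "b \<in> Ob A" "c \<in> Ob A"
    have "FAr G (FAr F (Asc A a b c) \<cdot>\<^bsub>B\<^esub> FTen F (a \<otimes>\<^bsub>A\<^esub> b) c \<cdot>\<^bsub>B\<^esub> (FTen F a b \<odot>\<^bsub>B\<^esub> Idn B (FOb F c))) \<cdot>
        FTen G (FOb F a \<otimes>\<^bsub>B\<^esub> FOb F b) (FOb F c) \<cdot> (FTen G (FOb F a) (FOb F b) \<odot> Idn C (FOb G (FOb F c))) =
      FAr G (FTen F a (b \<otimes>\<^bsub>A\<^esub> c) \<cdot>\<^bsub>B\<^esub> (Idn B (FOb F a) \<odot>\<^bsub>B\<^esub> FTen F b c)) \<cdot>
        (FAr G (Asc B (FOb F a) (FOb F b) (FOb F c)) \<cdot>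
        FTen G (FOb F a \<otimes>\<^bsub>B\<^esub> FOb F b) (FOb F c) \<cdot> (FTen G (FOb F a) (FOb F b) \<odot> Idn C (FOb G (FOb F c))))"
      unfolding F.F_Asc[of a b c, simplified] by simp
    then show "FAr (?GF) (Asc A a b c) \<cdot> FTen (?GF) (a \<otimes>\<^bsub>A\<^esub> b) c \<cdot>
        (FTen (?GF) a b \<odot> Idn C (FOb (?GF) c)) =
      FTen (?GF) a (b \<otimes>\<^bsub>A\<^esub> c) \<cdot>
        (Idn C (FOb (?GF) a) \<odot> FTen (?GF) b c) \<cdot>
        Asc C (FOb (?GF) a) (FOb (?GF) b) (FOb (?GF) c)"
      by (simp add: G.B.whisker_left G.B.whisker_right G.F_Asc G.B.chain[OF G.FTen_nat_right]
          G.B.chain[OF G.FTen_nat_left])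
  next
    fix a assume [simp]: "a \<in> Ob A"
    have "FAr G (FAr F (Lun A a) \<cdot>\<^bsub>B\<^esub> FTen F (Unt A) a \<cdot>\<^bsub>B\<^esub> (FUnt F \<odot>\<^bsub>B\<^esub> Idn B (FOb F a))) \<cdot>
        FTen G (Unt B) (FOb F a) \<cdot> (FUnt G \<odot> Idn C (FOb G (FOb F a))) = Lun C (FOb G (FOb F a))"
      unfolding F.F_Lun[of a, simplified] by (simp add: G.F_Lun)
    then show "FAr (?GF) (Lun A a) \<cdot> FTen (?GF) (Unt A) a \<cdot>
        (FUnt (?GF) \<odot> Idn C (FOb (?GF) a)) = Lun C (FOb (?GF) a)"
      by (simp add: G.B.whisker_right G.B.chain[OF G.FTen_nat_right])
    have "FAr G (FAr F (Run A a) \<cdot>\<^bsub>B\<^esub> FTen F a (Unt A) \<cdot>\<^bsub>B\<^esub> (Idn B (FOb F a) \<odot>\<^bsub>B\<^esub> FUnt F)) \<cdot>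
        FTen G (FOb F a) (Unt B) \<cdot> (Idn C (FOb G (FOb F a)) \<odot> FUnt G) = Run C (FOb G (FOb F a))"
      unfolding F.F_Run[of a, simplified] by (simp add: G.F_Run)
    then show "FAr (?GF) (Run A a) \<cdot> FTen (?GF) a (Unt A) \<cdot>
        (Idn C (FOb (?GF) a) \<odot> FUnt (?GF)) = Run C (FOb (?GF) a)"
      by (simp add: G.B.whisker_left G.B.chain[OF G.FTen_nat_left])
  next
    fix a b assume [simp]: "a \<in> Ob A" "b \<in> Ob A"
    have "FAr G (FAr F (Sym A a b) \<cdot>\<^bsub>B\<^esub> FTen F a b) \<cdot> FTen G (FOb F a) (FOb F b) =
        FAr G (FTen F b a) \<cdot> FTen G (FOb F b) (FOb F a) \<cdot> Sym C (FOb G (FOb F a)) (FOb G (FOb F b))"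
      unfolding F.F_Sym[of a b, simplified] by (simp add: G.F_Sym)
    then show "FAr (?GF) (Sym A a b) \<cdot> FTen (?GF) a b =
        FTen (?GF) b a \<cdot> Sym C (FOb (?GF) a) (FOb (?GF) b)"
      by simp
  next
    fix f g assume [simp]: "f \<in> Ar A" "g \<in> Ar A"
    have "FAr G (FTen F (Cod A f) (Cod A g) \<cdot>\<^bsub>B\<^esub> (FAr F f \<odot>\<^bsub>B\<^esub> FAr F g)) \<cdot>
          FTen G (FOb F (Dom A f)) (FOb F (Dom A g)) =
        FAr G (FAr F (f \<odot>\<^bsub>A\<^esub> g)) \<cdot> FAr G (FTen F (Dom A f) (Dom A g)) \<cdot>
          FTen G (FOb F (Dom A f)) (FOb F (Dom A g))"
      by (simp add: F.FTen_nat')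
    then show "FTen (?GF) (Cod A f) (Cod A g) \<cdot> (FAr (?GF) f \<odot> FAr (?GF) g) =
        FAr (?GF) (f \<odot>\<^bsub>A\<^esub> g) \<cdot> FTen (?GF) (Dom A f) (Dom A g)"
      by (simp add: G.FTen_nat')
  qed (auto simp: comp_smf_def F.A.symmetric_picard_axioms G.B.symmetric_picard_axioms)
qed

lemma comp_smf_assoc:
  assumes "symmetric_monoidal_functor A B F" "symmetric_monoidal_functor B C G" "symmetric_monoidal_functor C D H"
  shows "comp_smf A D H (comp_smf A C G F) = comp_smf A D (comp_smf B D H G) F"
proof -
  interpret F: symmetric_monoidal_functor A B F by fact
  interpret G: symmetric_monoidal_functor B C G by fact
  interpret H: symmetric_monoidal_functor C D H by fact
  show ?thesis
    by (rule smf_eqI) (auto intro!: smf_comp[where B = C] smf_comp[where B = B] assms smf_comp)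
qed

lemma comp_id_smf:
  assumes "symmetric_monoidal_functor A B F"
  shows "comp_smf A B F (id_smf A) = F" "comp_smf A B (id_smf B) F = F"
proof -
  interpret F: symmetric_monoidal_functor A B F by fact
  have "symmetric_monoidal_functor A B (comp_smf A B F (id_smf A))"
    "symmetric_monoidal_functor A B (comp_smf A B (id_smf B) F)"
    by (auto intro: smf_comp F.A.smf_id F.B.smf_id assms)
  then show "comp_smf A B F (id_smf A) = F" "comp_smf A B (id_smf B) F = F"
    by (auto intro!: smf_eqI assms)
qed

lemma smf_unit:
  assumes "symmetric_picard A" "symmetric_picard B"
  shows "symmetric_monoidal_functor A B (unit_smf A B)"
proof -
  interpret A: symmetric_picard A by fact
  interpret B: symmetric_picard B by fact
  show ?thesis
    by (rule symmetric_monoidal_functorI)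
      (auto simp: assms unit_smf_def B.run_unit B.asc_unit)
qed

text \<open>\<open>tensor_smf\<close> is the pair of \<open>F\<close> and \<open>G\<close> followed
  by the tensor product of \<open>B\<close>, so each axiom pastes those of \<open>F\<close> and
  \<open>G\<close> with a coherence law of \<open>Interchange\<close>.\<close>

lemma smf_tensor:
  fixes B (structure)
  assumes "symmetric_monoidal_functor A B F" "symmetric_monoidal_functor A B G"
  shows "symmetric_monoidal_functor A B (tensor_smf A B F G)"
proof -
  interpret F: symmetric_monoidal_functor A B F by fact
  interpret G: symmetric_monoidal_functor A B G by fact
  let ?T = "tensor_smf A B F G"
  show ?thesis
  proof (rule symmetric_monoidal_functorI)
    fix a b c assume [simp]: "a \<in> Ob A" "b \<in> Ob A" "c \<in> Ob A"
    let ?c = "Interchange B"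
    let ?L = "\<lambda>F. FAr F (Asc A a b c) \<cdot> FTen F (a \<otimes>\<^bsub>A\<^esub> b) c \<cdot> (FTen F a b \<odot> Idn B (FOb F c))"
    let ?R = "\<lambda>F. FTen F a (b \<otimes>\<^bsub>A\<^esub> c) \<cdot> (Idn B (FOb F a) \<odot> FTen F b c)"
    let ?A = "\<lambda>F. Asc B (FOb F a) (FOb F b) (FOb F c)"
    have "FAr (?T) (Asc A a b c) \<cdot> FTen (?T) (a \<otimes>\<^bsub>A\<^esub> b) c \<cdot>
        (FTen (?T) a b \<odot> Idn B (FOb (?T) c)) =
      (?L F \<odot> ?L G) \<cdot> ?c (FOb F a \<otimes> FOb F b) (FOb G a \<otimes> FOb G b) (FOb F c) (FOb G c) \<cdot>
      (?c (FOb F a) (FOb G a) (FOb F b) (FOb G b) \<odot> Idn B (FOb F c \<otimes> FOb G c))"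
      using F.B.whisker_right[of "FOb F c \<otimes> FOb G c" "?c (FOb F a) (FOb G a) (FOb F b) (FOb G b)"
          "FTen F a b \<odot> FTen G a b"]
        F.B.chain[OF F.B.interchange_nat[of "FTen F a b" "FTen G a b" "Idn B (FOb F c)" "Idn B (FOb G c)"
          "FOb F (a \<otimes>\<^bsub>A\<^esub> b)" "FOb G (a \<otimes>\<^bsub>A\<^esub> b)" "FOb F c" "FOb G c"]]
      by (simp add: F.B.merge_chain)
    also have "\<dots> = (?R F \<odot> ?R G) \<cdot> (?A F \<odot> ?A G) \<cdot>
      ?c (FOb F a \<otimes> FOb F b) (FOb G a \<otimes> FOb G b) (FOb F c) (FOb G c) \<cdot>
      (?c (FOb F a) (FOb G a) (FOb F b) (FOb G b) \<odot> Idn B (FOb F c \<otimes> FOb G c))"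
      by (simp add: F.F_Asc G.F_Asc F.B.merge F.B.merge_chain)
    also have "\<dots> = (?R F \<odot> ?R G) \<cdot>
      ?c (FOb F a) (FOb G a) (FOb F b \<otimes> FOb F c) (FOb G b \<otimes> FOb G c) \<cdot>
      (Idn B (FOb F a \<otimes> FOb G a) \<odot> ?c (FOb F b) (FOb G b) (FOb F c) (FOb G c)) \<cdot>
      Asc B (FOb F a \<otimes> FOb G a) (FOb F b \<otimes> FOb G b) (FOb F c \<otimes> FOb G c)"
      by (simp only: F.B.interchange_asc F.F_ob G.F_ob \<open>a \<in> Ob A\<close> \<open>b \<in> Ob A\<close> \<open>c \<in> Ob A\<close>)
    also have "\<dots> = FTen (?T) a (b \<otimes>\<^bsub>A\<^esub> c) \<cdot>
        (Idn B (FOb (?T) a) \<odot> FTen (?T) b c) \<cdot>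
        Asc B (FOb (?T) a) (FOb (?T) b) (FOb (?T) c)"
      using F.B.chain[OF F.B.interchange_nat[of "Idn B (FOb F a)" "Idn B (FOb G a)" "FTen F b c" "FTen G b c"
          "FOb F a" "FOb G a" "FOb F (b \<otimes>\<^bsub>A\<^esub> c)" "FOb G (b \<otimes>\<^bsub>A\<^esub> c)"]]
      by (simp add: F.B.whisker_left[of "FOb F a \<otimes> FOb G a" "?c (FOb F b) (FOb G b) (FOb F c) (FOb G c)"
          "FTen F b c \<odot> FTen G b c"]) (simp add: F.B.merge_chain)
    finally show "FAr (?T) (Asc A a b c) \<cdot> FTen (?T) (a \<otimes>\<^bsub>A\<^esub> b) c \<cdot>
        (FTen (?T) a b \<odot> Idn B (FOb (?T) c)) =
      FTen (?T) a (b \<otimes>\<^bsub>A\<^esub> c) \<cdot>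
        (Idn B (FOb (?T) a) \<odot> FTen (?T) b c) \<cdot>
        Asc B (FOb (?T) a) (FOb (?T) b) (FOb (?T) c)" .
  next
    fix a assume [simp]: "a \<in> Ob A"
    let ?I = "Inv B (Lun B (Unt B))"
    have nat: "Interchange B (FOb F (Unt A)) (FOb G (Unt A)) (FOb F a) (FOb G a) \<cdot>
        ((FUnt F \<odot> FUnt G) \<odot> Idn B (FOb F a \<otimes> FOb G a)) =
        ((FUnt F \<odot> Idn B (FOb F a)) \<odot> (FUnt G \<odot> Idn B (FOb G a))) \<cdot>
        Interchange B (Unt B) (Unt B) (FOb F a) (FOb G a)"
      using F.B.interchange_nat[of "FUnt F" "FUnt G" "Idn B (FOb F a)" "Idn B (FOb G a)"
          "FOb F (Unt A)" "FOb G (Unt A)" "FOb F a" "FOb G a"] by simp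
    show "FAr (?T) (Lun A a) \<cdot> FTen (?T) (Unt A) a \<cdot>
        (FUnt (?T) \<odot> Idn B (FOb (?T) a)) = Lun B (FOb (?T) a)"
      by (simp add: F.B.whisker_right[of _ ?I "FUnt F \<odot> FUnt G"] F.B.chain[OF nat] F.B.merge_chain F.F_Lun G.F_Lun F.B.interchange_unit)
    have nat: "Interchange B (FOb F a) (FOb G a) (FOb F (Unt A)) (FOb G (Unt A)) \<cdot>
        (Idn B (FOb F a \<otimes> FOb G a) \<odot> (FUnt F \<odot> FUnt G)) =
        ((Idn B (FOb F a) \<odot> FUnt F) \<odot> (Idn B (FOb G a) \<odot> FUnt G)) \<cdot>
        Interchange B (FOb F a) (FOb G a) (Unt B) (Unt B)"
      using F.B.interchange_nat[of "Idn B (FOb F a)" "Idn B (FOb G a)" "FUnt F" "FUnt G"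
          "FOb F a" "FOb G a" "FOb F (Unt A)" "FOb G (Unt A)"] by simp
    show "FAr (?T) (Run A a) \<cdot> FTen (?T) a (Unt A) \<cdot>
        (Idn B (FOb (?T) a) \<odot> FUnt (?T)) = Run B (FOb (?T) a)"
      by (simp add: F.B.whisker_left[of _ ?I "FUnt F \<odot> FUnt G"] F.B.chain[OF nat] F.B.merge_chain F.F_Run G.F_Run F.B.interchange_unit)
  next
    fix a b assume [simp]: "a \<in> Ob A" "b \<in> Ob A"
    have "FAr (?T) (Sym A a b) \<cdot> FTen (?T) a b =
        ((FTen F b a \<odot> FTen G b a) \<cdot> (Sym B (FOb F a) (FOb F b) \<odot> Sym B (FOb G a) (FOb G b))) \<cdot>
        Interchange B (FOb F a) (FOb G a) (FOb F b) (FOb G b)"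
      by (simp add: F.B.merge F.B.merge_chain F.F_Sym G.F_Sym)
    also have "\<dots> = FTen (?T) b a \<cdot> Sym B (FOb (?T) a) (FOb (?T) b)"
      by (simp add: F.B.interchange_sym)
    finally show "FAr (?T) (Sym A a b) \<cdot> FTen (?T) a b =
        FTen (?T) b a \<cdot> Sym B (FOb (?T) a) (FOb (?T) b)" .
  next
    fix f g assume [simp]: "f \<in> Ar A" "g \<in> Ar A"
    show "FTen (?T) (Cod A f) (Cod A g) \<cdot>
        (FAr (?T) f \<odot> FAr (?T) g) =
        FAr (?T) (f \<odot>\<^bsub>A\<^esub> g) \<cdot> FTen (?T) (Dom A f) (Dom A g)"
      by (simp add: F.B.interchange_nat F.B.merge_chain F.FTen_nat' G.FTen_nat')
  qed (auto simp: tensor_smf_def F.A.symmetric_picard_axioms F.B.symmetric_picard_axioms F.B.merge)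
qed

context symmetric_monoidal_functor
begin

text \<open>A symmetric monoidal functor respects every structural arrow. \<open>Interchange\<close>
  is a chain of five of them through different bracketings of four factors, so the four-fold
  constraint is moved along one link at a time.\<close>

lemma F_Interchange:
  assumes [simp]: "a \<in> Ob A" "b \<in> Ob A" "c \<in> Ob A" "d \<in> Ob A"
  shows "FAr F (Interchange A a b c d) \<cdot>\<^bsub>B\<^esub> FTen F (a \<otimes>\<^bsub>A\<^esub> b) (c \<otimes>\<^bsub>A\<^esub> d) \<cdot>\<^bsub>B\<^esub> (FTen F a b \<odot>\<^bsub>B\<^esub> FTen F c d) =
    FTen F (a \<otimes>\<^bsub>A\<^esub> c) (b \<otimes>\<^bsub>A\<^esub> d) \<cdot>\<^bsub>B\<^esub> (FTen F a c \<odot>\<^bsub>B\<^esub> FTen F b d) \<cdot>\<^bsub>B\<^esub>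
      Interchange B (FOb F a) (FOb F b) (FOb F c) (FOb F d)"
proof -
  let ?i = "\<lambda>x. Idn B (FOb F x)"
  \<comment> \<open>\<open>R\<close>, \<open>Q\<close> and \<open>X\<close> are the constraints of
    \<open>F\<close> for the bracketings \<open>x(y(zw))\<close>, \<open>x((yz)w)\<close> and
    \<open>(xy)(zw)\<close>.\<close>
  define R where "R x y z w = FTen F x (y \<otimes>\<^bsub>A\<^esub> (z \<otimes>\<^bsub>A\<^esub> w)) \<cdot>\<^bsub>B\<^esub>
    (?i x \<odot>\<^bsub>B\<^esub> (FTen F y (z \<otimes>\<^bsub>A\<^esub> w) \<cdot>\<^bsub>B\<^esub> (?i y \<odot>\<^bsub>B\<^esub> FTen F z w)))" for x y z w
  define Q where "Q x y z w = FTen F x ((y \<otimes>\<^bsub>A\<^esub> z) \<otimes>\<^bsub>A\<^esub> w) \<cdot>\<^bsub>B\<^esub>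
    (?i x \<odot>\<^bsub>B\<^esub> (FTen F (y \<otimes>\<^bsub>A\<^esub> z) w \<cdot>\<^bsub>B\<^esub> (FTen F y z \<odot>\<^bsub>B\<^esub> ?i w)))" for x y z w
  define X where "X x y z w = FTen F (x \<otimes>\<^bsub>A\<^esub> y) (z \<otimes>\<^bsub>A\<^esub> w) \<cdot>\<^bsub>B\<^esub> (FTen F x y \<odot>\<^bsub>B\<^esub> FTen F z w)" for x y z w
  have R [simp]: "R x y z w \<in> Ar B" "Dom B (R x y z w) = FOb F x \<otimes>\<^bsub>B\<^esub> (FOb F y \<otimes>\<^bsub>B\<^esub> (FOb F z \<otimes>\<^bsub>B\<^esub> FOb F w))"
      "Cod B (R x y z w) = FOb F (x \<otimes>\<^bsub>A\<^esub> (y \<otimes>\<^bsub>A\<^esub> (z \<otimes>\<^bsub>A\<^esub> w)))"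
    and Q [simp]: "Q x y z w \<in> Ar B" "Dom B (Q x y z w) = FOb F x \<otimes>\<^bsub>B\<^esub> ((FOb F y \<otimes>\<^bsub>B\<^esub> FOb F z) \<otimes>\<^bsub>B\<^esub> FOb F w)"
      "Cod B (Q x y z w) = FOb F (x \<otimes>\<^bsub>A\<^esub> ((y \<otimes>\<^bsub>A\<^esub> z) \<otimes>\<^bsub>A\<^esub> w))"
    and X [simp]: "X x y z w \<in> Ar B" "Dom B (X x y z w) = (FOb F x \<otimes>\<^bsub>B\<^esub> FOb F y) \<otimes>\<^bsub>B\<^esub> (FOb F z \<otimes>\<^bsub>B\<^esub> FOb F w)"
      "Cod B (X x y z w) = FOb F ((x \<otimes>\<^bsub>A\<^esub> y) \<otimes>\<^bsub>A\<^esub> (z \<otimes>\<^bsub>A\<^esub> w))"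
    if "x \<in> Ob A" "y \<in> Ob A" "z \<in> Ob A" "w \<in> Ob A" for x y z w
    using that by (auto simp: R_def Q_def X_def)
  have XR: "FAr F (Asc A x y (z \<otimes>\<^bsub>A\<^esub> w)) \<cdot>\<^bsub>B\<^esub> X x y z w = R x y z w \<cdot>\<^bsub>B\<^esub> Asc B (FOb F x) (FOb F y) (FOb F z \<otimes>\<^bsub>B\<^esub> FOb F w)"
    if [simp]: "x \<in> Ob A" "y \<in> Ob A" "z \<in> Ob A" "w \<in> Ob A" for x y z w
  proof -
    have "FAr F (Asc A x y (z \<otimes>\<^bsub>A\<^esub> w)) \<cdot>\<^bsub>B\<^esub> X x y z w = (FAr F (Asc A x y (z \<otimes>\<^bsub>A\<^esub> w)) \<cdot>\<^bsub>B\<^esub>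
        FTen F (x \<otimes>\<^bsub>A\<^esub> y) (z \<otimes>\<^bsub>A\<^esub> w) \<cdot>\<^bsub>B\<^esub> (FTen F x y \<odot>\<^bsub>B\<^esub> Idn B (FOb F (z \<otimes>\<^bsub>A\<^esub> w)))) \<cdot>\<^bsub>B\<^esub>
        (Idn B (FOb F x \<otimes>\<^bsub>B\<^esub> FOb F y) \<odot>\<^bsub>B\<^esub> FTen F z w)"
      by (simp add: X_def B.merge)
    also have "\<dots> = R x y z w \<cdot>\<^bsub>B\<^esub> Asc B (FOb F x) (FOb F y) (FOb F z \<otimes>\<^bsub>B\<^esub> FOb F w)"
      unfolding F_Asc[OF that(1,2) A.ten_ob[OF that(3,4)]]
      by (simp add: B.asc_nat_idn R_def B.merge_chain B.merge)
    finally show ?thesis .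
  qed
  have QR: "FAr F (Idn A x \<odot>\<^bsub>A\<^esub> Asc A y z w) \<cdot>\<^bsub>B\<^esub> Q x y z w =
      R x y z w \<cdot>\<^bsub>B\<^esub> (?i x \<odot>\<^bsub>B\<^esub> Asc B (FOb F y) (FOb F z) (FOb F w))"
    if [simp]: "x \<in> Ob A" "y \<in> Ob A" "z \<in> Ob A" "w \<in> Ob A" for x y z w
  proof -
    have "FAr F (Idn A x \<odot>\<^bsub>A\<^esub> Asc A y z w) \<cdot>\<^bsub>B\<^esub> FTen F x ((y \<otimes>\<^bsub>A\<^esub> z) \<otimes>\<^bsub>A\<^esub> w) =
        FTen F x (y \<otimes>\<^bsub>A\<^esub> (z \<otimes>\<^bsub>A\<^esub> w)) \<cdot>\<^bsub>B\<^esub> (?i x \<odot>\<^bsub>B\<^esub> FAr F (Asc A y z w))"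
      using FTen_nat_left[of "Asc A y z w" "y \<otimes>\<^bsub>A\<^esub> (z \<otimes>\<^bsub>A\<^esub> w)" x] by simp
    note nat = B.chain[OF this]
    show ?thesis
      by (simp add: Q_def R_def nat B.merge F_Asc)
  qed
  have QQ: "FAr F (Idn A x \<odot>\<^bsub>A\<^esub> (Sym A y z \<odot>\<^bsub>A\<^esub> Idn A w)) \<cdot>\<^bsub>B\<^esub> Q x y z w =
      Q x z y w \<cdot>\<^bsub>B\<^esub> (?i x \<odot>\<^bsub>B\<^esub> (Sym B (FOb F y) (FOb F z) \<odot>\<^bsub>B\<^esub> ?i w))"
    if [simp]: "x \<in> Ob A" "y \<in> Ob A" "z \<in> Ob A" "w \<in> Ob A" for x y z w
  proof -
    have "FAr F (Idn A x \<odot>\<^bsub>A\<^esub> (Sym A y z \<odot>\<^bsub>A\<^esub> Idn A w)) \<cdot>\<^bsub>B\<^esub> FTen F x ((y \<otimes>\<^bsub>A\<^esub> z) \<otimes>\<^bsub>A\<^esub> w) =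
        FTen F x ((z \<otimes>\<^bsub>A\<^esub> y) \<otimes>\<^bsub>A\<^esub> w) \<cdot>\<^bsub>B\<^esub> (?i x \<odot>\<^bsub>B\<^esub> FAr F (Sym A y z \<odot>\<^bsub>A\<^esub> Idn A w))"
      using FTen_nat_left[of "Sym A y z \<odot>\<^bsub>A\<^esub> Idn A w" "(z \<otimes>\<^bsub>A\<^esub> y) \<otimes>\<^bsub>A\<^esub> w" x] by simp
    note nat1 = B.chain[OF this]
    have "FAr F (Sym A y z \<odot>\<^bsub>A\<^esub> Idn A w) \<cdot>\<^bsub>B\<^esub> FTen F (y \<otimes>\<^bsub>A\<^esub> z) w =
        FTen F (z \<otimes>\<^bsub>A\<^esub> y) w \<cdot>\<^bsub>B\<^esub> (FAr F (Sym A y z) \<odot>\<^bsub>B\<^esub> ?i w)"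
      using FTen_nat_right[of "Sym A y z" "z \<otimes>\<^bsub>A\<^esub> y" w] by simp
    note nat2 = B.chain[OF this]
    show ?thesis
      by (simp add: Q_def nat1 nat2 B.merge F_Sym)
  qed
  have RQ: "FAr F (Idn A x \<odot>\<^bsub>A\<^esub> Inv A (Asc A y z w)) \<cdot>\<^bsub>B\<^esub> R x y z w =
      Q x y z w \<cdot>\<^bsub>B\<^esub> (?i x \<odot>\<^bsub>B\<^esub> Inv B (Asc B (FOb F y) (FOb F z) (FOb F w)))"
    if [simp]: "x \<in> Ob A" "y \<in> Ob A" "z \<in> Ob A" "w \<in> Ob A" for x y z w
  proof (rule B.cancel_left[of "FAr F (Idn A x \<odot>\<^bsub>A\<^esub> Asc A y z w)"])
    show "FAr F (Idn A x \<odot>\<^bsub>A\<^esub> Asc A y z w) \<cdot>\<^bsub>B\<^esub> FAr F (Idn A x \<odot>\<^bsub>A\<^esub> Inv A (Asc A y z w)) \<cdot>\<^bsub>B\<^esub> R x y z w =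
      FAr F (Idn A x \<odot>\<^bsub>A\<^esub> Asc A y z w) \<cdot>\<^bsub>B\<^esub>
      Q x y z w \<cdot>\<^bsub>B\<^esub> (?i x \<odot>\<^bsub>B\<^esub> Inv B (Asc B (FOb F y) (FOb F z) (FOb F w)))"
      by (simp add: B.chain[OF QR] B.merge A.merge B.chain[OF F_cmp'[symmetric]])
  qed auto
  have RX: "Inv B (FAr F (Asc A x y (z \<otimes>\<^bsub>A\<^esub> w))) \<cdot>\<^bsub>B\<^esub> R x y z w =
      X x y z w \<cdot>\<^bsub>B\<^esub> Inv B (Asc B (FOb F x) (FOb F y) (FOb F z \<otimes>\<^bsub>B\<^esub> FOb F w))"
    if [simp]: "x \<in> Ob A" "y \<in> Ob A" "z \<in> Ob A" "w \<in> Ob A" for x y z w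
  proof (rule B.cancel_left[of "FAr F (Asc A x y (z \<otimes>\<^bsub>A\<^esub> w))"])
    show "FAr F (Asc A x y (z \<otimes>\<^bsub>A\<^esub> w)) \<cdot>\<^bsub>B\<^esub> Inv B (FAr F (Asc A x y (z \<otimes>\<^bsub>A\<^esub> w))) \<cdot>\<^bsub>B\<^esub> R x y z w =
      FAr F (Asc A x y (z \<otimes>\<^bsub>A\<^esub> w)) \<cdot>\<^bsub>B\<^esub>
      X x y z w \<cdot>\<^bsub>B\<^esub> Inv B (Asc B (FOb F x) (FOb F y) (FOb F z \<otimes>\<^bsub>B\<^esub> FOb F w))"
      by (simp add: B.chain[OF XR])
  qed auto
  have "FAr F (Interchange A a b c d) \<cdot>\<^bsub>B\<^esub> X a b c d = X a c b d \<cdot>\<^bsub>B\<^esub> Interchange B (FOb F a) (FOb F b) (FOb F c) (FOb F d)"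
    by (simp add: Interchange_def XR B.chain[OF RQ] B.chain[OF QQ] B.chain[OF QR] B.chain[OF RX])
  then show ?thesis by (simp add: X_def)
qed

end

section \<open>Transformations and duals of functors\<close>

context monoidal_transformation
begin

lemma cpt_ar [simp]:
  "a \<in> Ob A \<Longrightarrow> cpt \<sigma> a \<in> Ar B" "a \<in> Ob A \<Longrightarrow> Dom B (cpt \<sigma> a) = FOb (Src \<sigma>) a"
  "a \<in> Ob A \<Longrightarrow> Cod B (cpt \<sigma> a) = FOb (Trg \<sigma>) a"
  using cpt[of a] by (auto simp: Hom_def)

lemma cpt_nat':
  "\<lbrakk>f \<in> Ar A; Cod A f = b\<rbrakk> \<Longrightarrow> cpt \<sigma> b \<cdot>\<^bsub>B\<^esub> FAr (Src \<sigma>) f = FAr (Trg \<sigma>) f \<cdot>\<^bsub>B\<^esub> cpt \<sigma> (Dom A f)"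
  using cpt_nat[of f "Dom A f" b] by (auto simp: Hom_def)

lemma src_smf: "symmetric_monoidal_functor A B (Src \<sigma>)"
  and trg_smf: "symmetric_monoidal_functor A B (Trg \<sigma>)"
  by unfold_locales

end

lemma monoidal_transformationI:
  fixes B (structure)
  assumes "symmetric_monoidal_functor A B (Src \<sigma>)" "symmetric_monoidal_functor A B (Trg \<sigma>)"
    and "cpt \<sigma> \<in> extensional (Ob A)"
    and "\<And>a. a \<in> Ob A \<Longrightarrow> cpt \<sigma> a \<in> Ar B \<and> Dom B (cpt \<sigma> a) = FOb (Src \<sigma>) a \<and> Cod B (cpt \<sigma> a) = FOb (Trg \<sigma>) a"
    and "\<And>f. f \<in> Ar A \<Longrightarrow> cpt \<sigma> (Cod A f) \<cdot> FAr (Src \<sigma>) f = FAr (Trg \<sigma>) f \<cdot> cpt \<sigma> (Dom A f)"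
    and "\<And>a b. \<lbrakk>a \<in> Ob A; b \<in> Ob A\<rbrakk> \<Longrightarrow>
      cpt \<sigma> (a \<otimes>\<^bsub>A\<^esub> b) \<cdot> FTen (Src \<sigma>) a b = FTen (Trg \<sigma>) a b \<cdot> (cpt \<sigma> a \<odot> cpt \<sigma> b)"
    and "cpt \<sigma> (Unt A) \<cdot> FUnt (Src \<sigma>) = FUnt (Trg \<sigma>)"
  shows "monoidal_transformation A B \<sigma>"
proof -
  interpret S: symmetric_monoidal_functor A B "Src \<sigma>" by fact
  interpret T: symmetric_monoidal_functor A B "Trg \<sigma>" by fact
  show ?thesis
    by unfold_locales (use assms in \<open>auto simp: Hom_def\<close>)
qed

lemma smt_eqI:
  fixes \<sigma> \<tau> :: "('o1, 'a1, 'o2, 'a2) smt"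
  assumes "Src \<sigma> = Src \<tau>" "Trg \<sigma> = Trg \<tau>" "cpt \<sigma> \<in> extensional X" "cpt \<tau> \<in> extensional X"
    and "\<And>a. a \<in> X \<Longrightarrow> cpt \<sigma> a = cpt \<tau> a"
  shows "\<sigma> = \<tau>"
  using assms extensionalityI[OF assms(3,4)] by (intro smt.equality) auto

lemma comp_unit_smf:
  assumes "symmetric_monoidal_functor A B F" "symmetric_picard C"
  shows "comp_smf A C (unit_smf B C) F = unit_smf A C"
proof -
  interpret F: symmetric_monoidal_functor A B F by fact
  interpret C: symmetric_picard C by fact
  show ?thesis
    by (rule smf_eqI)
      (auto intro: smf_comp smf_unit assms F.A.symmetric_picard_axioms F.B.symmetric_picard_axioms)
qed

lemma comp_tensor_smf:
  assumes "symmetric_monoidal_functor A B F" "symmetric_monoidal_functor B C G" "symmetric_monoidal_functor B C G'"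
  shows "comp_smf A C (tensor_smf B C G G') F = tensor_smf A C (comp_smf A C G F) (comp_smf A C G' F)"
proof -
  interpret F: symmetric_monoidal_functor A B F by fact
  interpret G: symmetric_monoidal_functor B C G by fact
  interpret G': symmetric_monoidal_functor B C G' by fact
  show ?thesis
    by (rule smf_eqI) (auto intro!: smf_comp[OF assms(1)] smf_tensor assms simp: G.B.merge_chain)
qed

lemma whisker_functor_right:
  assumes "monoidal_transformation B C \<sigma>" "symmetric_monoidal_functor A B F"
  shows "monoidal_transformation A C \<lparr>Src = comp_smf A C (Src \<sigma>) F, Trg = comp_smf A C (Trg \<sigma>) F,
    cpt = (\<lambda>a\<in>Ob A. cpt \<sigma> (FOb F a))\<rparr>"
    (is "monoidal_transformation A C ?\<tau>")
proof -
  interpret \<sigma>: monoidal_transformation B C \<sigma> by fact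
  interpret F: symmetric_monoidal_functor A B F by fact
  show ?thesis
  proof (rule monoidal_transformationI)
    fix a b assume [simp]: "a \<in> Ob A" "b \<in> Ob A"
    show "cpt ?\<tau> (a \<otimes>\<^bsub>A\<^esub> b) \<cdot>\<^bsub>C\<^esub> FTen (Src ?\<tau>) a b =
        FTen (Trg ?\<tau>) a b \<cdot>\<^bsub>C\<^esub> (cpt ?\<tau> a \<odot>\<^bsub>C\<^esub> cpt ?\<tau> b)"
      by (simp add: \<sigma>.cpt_Ten \<sigma>.S.B.chain[OF \<sigma>.cpt_nat'])
  next
    show "cpt ?\<tau> (Unt A) \<cdot>\<^bsub>C\<^esub> FUnt (Src ?\<tau>) = FUnt (Trg ?\<tau>)"
      by (simp add: \<sigma>.cpt_Unt \<sigma>.S.B.chain[OF \<sigma>.cpt_nat'])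
  qed (auto simp: \<sigma>.cpt_nat' intro: smf_comp[OF assms(2)] \<sigma>.src_smf \<sigma>.trg_smf)
qed

lemma whisker_functor_left:
  fixes C (structure)
  assumes "monoidal_transformation A B \<sigma>" "symmetric_monoidal_functor B C K"
  shows "monoidal_transformation A C \<lparr>Src = comp_smf A C K (Src \<sigma>), Trg = comp_smf A C K (Trg \<sigma>),
    cpt = (\<lambda>a\<in>Ob A. FAr K (cpt \<sigma> a))\<rparr>" (is "monoidal_transformation A C ?\<tau>")
proof -
  interpret \<sigma>: monoidal_transformation A B \<sigma> by fact
  interpret K: symmetric_monoidal_functor B C K by fact
  show ?thesis
  proof (rule monoidal_transformationI)
    fix f assume [simp]: "f \<in> Ar A"
    have "FAr K (cpt \<sigma> (Cod A f) \<cdot>\<^bsub>B\<^esub> FAr (Src \<sigma>) f) = FAr K (FAr (Trg \<sigma>) f \<cdot>\<^bsub>B\<^esub> cpt \<sigma> (Dom A f))"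
      by (simp only: \<sigma>.cpt_nat' \<open>f \<in> Ar A\<close>)
    then show "cpt ?\<tau> (Cod A f) \<cdot> FAr (Src ?\<tau>) f = FAr (Trg ?\<tau>) f \<cdot> cpt ?\<tau> (Dom A f)"
      by simp
  next
    fix a b assume [simp]: "a \<in> Ob A" "b \<in> Ob A"
    have "FAr K (cpt \<sigma> (a \<otimes>\<^bsub>A\<^esub> b) \<cdot>\<^bsub>B\<^esub> FTen (Src \<sigma>) a b) \<cdot> FTen K (FOb (Src \<sigma>) a) (FOb (Src \<sigma>) b) =
        FAr K (FTen (Trg \<sigma>) a b) \<cdot> FAr K (cpt \<sigma> a \<odot>\<^bsub>B\<^esub> cpt \<sigma> b) \<cdot> FTen K (FOb (Src \<sigma>) a) (FOb (Src \<sigma>) b)"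
      by (simp add: \<sigma>.cpt_Ten)
    then show "cpt ?\<tau> (a \<otimes>\<^bsub>A\<^esub> b) \<cdot> FTen (Src ?\<tau>) a b = FTen (Trg ?\<tau>) a b \<cdot> (cpt ?\<tau> a \<odot> cpt ?\<tau> b)"
      by (simp add: K.FTen_nat')
  next
    have "FAr K (cpt \<sigma> (Unt A) \<cdot>\<^bsub>B\<^esub> FUnt (Src \<sigma>)) \<cdot> FUnt K = FAr K (FUnt (Trg \<sigma>)) \<cdot> FUnt K"
      by (simp only: \<sigma>.cpt_Unt)
    then show "cpt ?\<tau> (Unt A) \<cdot> FUnt (Src ?\<tau>) = FUnt (Trg ?\<tau>)"
      by simp
  qed (auto intro: smf_comp[OF _ assms(2)] \<sigma>.src_smf \<sigma>.trg_smf)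
qed

section \<open>Dualities and the dual of the identity functor\<close>

context symmetric_picard
begin

text \<open>Tensoring with \<open>u\<close> is faithful and \<open>h\<close> is invertible. The
  equations about duals below are reduced to this rule.\<close>

lemma lift_unique:
  assumes "(g \<odot> u) \<cdot> h = (g' \<odot> u) \<cdot> h" and [simp]: "g \<in> Ar C" "g' \<in> Ar C" "u \<in> Ar C" "h \<in> Ar C"
    and "Dom C g' = Dom C g" "Cod C g' = Cod C g" "Cod C h = Dom C g \<otimes> Dom C u"
  shows "g = g'"
  by (rule tenA_faithful[where u = u], rule cancel_right[where h = h]) (use assms in auto)

lemma lift_ex:
  assumes [simp]: "u \<in> Ar C" "h \<in> Ar C" "k \<in> Ar C" "c \<in> Ob C" "d \<in> Ob C"
    and [simp]: "Dom C h = Dom C k" "Cod C h = c \<otimes> Dom C u" "Cod C k = d \<otimes> Cod C u"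
  shows "\<exists>g. g \<in> Hom C c d \<and> (g \<odot> u) \<cdot> h = k"
proof -
  obtain g where g: "g \<in> Hom C c d" "g \<odot> u = k \<cdot> Inv C h"
    using tenA_ex[of u c d "k \<cdot> Inv C h"] by auto
  then have "(g \<odot> u) \<cdot> h = k" by simp
  with g show ?thesis by auto
qed

text \<open>For dualities \<open>h : I -> c \<otimes> a\<close> and
  \<open>k : I -> d \<otimes> b\<close> and an arrow \<open>u : a -> b\<close>, this is the induced
  arrow \<open>c -> d\<close> of duals. It is covariant in \<open>u\<close> because all arrows are
  invertible.\<close>

definition lift where
  "lift c d u h k = (THE g. g \<in> Hom C c d \<and> (g \<odot> u) \<cdot> h = k)"

lemma lift:
  assumes [simp]: "u \<in> Ar C" "h \<in> Ar C" "k \<in> Ar C" "c \<in> Ob C" "d \<in> Ob C"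
    and [simp]: "Dom C h = Dom C k" "Cod C h = c \<otimes> Dom C u" "Cod C k = d \<otimes> Cod C u"
  shows "lift c d u h k \<in> Ar C" "Dom C (lift c d u h k) = c" "Cod C (lift c d u h k) = d"
    "(lift c d u h k \<odot> u) \<cdot> h = k"
proof -
  have "\<exists>!g. g \<in> Hom C c d \<and> (g \<odot> u) \<cdot> h = k"
  proof (rule ex_ex1I)
    show "\<exists>g. g \<in> Hom C c d \<and> (g \<odot> u) \<cdot> h = k" by (rule lift_ex) auto
    show "g = g'" if "g \<in> Hom C c d \<and> (g \<odot> u) \<cdot> h = k" "g' \<in> Hom C c d \<and> (g' \<odot> u) \<cdot> h = k" for g g'
      by (rule lift_unique[of _ u h]) (use that in \<open>auto simp: Hom_def\<close>)
  qed
  from theI'[OF this] show "lift c d u h k \<in> Ar C" "Dom C (lift c d u h k) = c" "Cod C (lift c d u h k) = d"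
    "(lift c d u h k \<odot> u) \<cdot> h = k"
    by (auto simp: lift_def Hom_def)
qed

text \<open>
  Objects \<open>a\<close> with a dual \<open>h : I \<rightarrow> c \<otimes> a\<close> form a symmetric monoidal category with the following
  tensor product of dualities, and \<open>lift\<close> says that its projection to \<open>a\<close> is fully faithful.
  This is why the chosen duals are part of a symmetric monoidal functor.
\<close>

definition pairing where
  "pairing c a d b h k = Interchange C c a d b \<cdot> (h \<odot> k) \<cdot> Inv C (Lun C (Unt C))"

abbreviation "duality c a h \<equiv> c \<in> Ob C \<and> a \<in> Ob C \<and> h \<in> Ar C \<and> Dom C h = Unt C \<and> Cod C h = c \<otimes> a"

lemma pairing_ar [simp]:
  assumes "duality c a h" "duality d b k"
  shows "pairing c a d b h k \<in> Ar C" "Dom C (pairing c a d b h k) = Unt C"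
    "Cod C (pairing c a d b h k) = (c \<otimes> d) \<otimes> (a \<otimes> b)"
  using assms by (auto simp: pairing_def)

text \<open>Naturality of \<open>Interchange\<close>: if \<open>(g, u)\<close> and
  \<open>(g', u')\<close> carry dualities to dualities, so does their tensor product.\<close>

lemma pairing_nat:
  assumes "duality (Dom C g) (Dom C u) h" "duality (Dom C g') (Dom C u') k"
    "g \<in> Ar C" "u \<in> Ar C" "g' \<in> Ar C" "u' \<in> Ar C"
  shows "((g \<odot> g') \<odot> (u \<odot> u')) \<cdot> pairing (Dom C g) (Dom C u) (Dom C g') (Dom C u') h k =
    pairing (Cod C g) (Cod C u) (Cod C g') (Cod C u') ((g \<odot> u) \<cdot> h) ((g' \<odot> u') \<cdot> k)"
proof -
  have "pairing (Cod C g) (Cod C u) (Cod C g') (Cod C u') ((g \<odot> u) \<cdot> h) ((g' \<odot> u') \<cdot> k) =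
      Interchange C (Cod C g) (Cod C u) (Cod C g') (Cod C u') \<cdot> (((g \<odot> u) \<odot> (g' \<odot> u')) \<cdot> (h \<odot> k)) \<cdot>
      Inv C (Lun C (Unt C))"
    using assms unfolding pairing_def by (subst merge) auto
  also have "\<dots> = ((g \<odot> g') \<odot> (u \<odot> u')) \<cdot> pairing (Dom C g) (Dom C u) (Dom C g') (Dom C u') h k"
    using assms by (simp add: pairing_def chain[OF interchange_nat])
  finally show ?thesis ..
qed

text \<open>Associators respect dualities, by \<open>interchange_asc\<close> for the objects and
  \<open>asc_unit_inv\<close> for the three copies of the unit.\<close>

lemma pairing_asc:
  assumes "duality c a h" "duality d b k" "duality e f l"
  shows "(Asc C c d e \<odot> Asc C a b f) \<cdot> pairing (c \<otimes> d) (a \<otimes> b) e f (pairing c a d b h k) l =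
    pairing c a (d \<otimes> e) (b \<otimes> f) h (pairing d b e f k l)"
proof -
  let ?I = "Unt C"
  let ?i = "Inv C (Lun C ?I)"
  have "(Asc C c d e \<odot> Asc C a b f) \<cdot> pairing (c \<otimes> d) (a \<otimes> b) e f (pairing c a d b h k) l =
      ((Asc C c d e \<odot> Asc C a b f) \<cdot> Interchange C (c \<otimes> d) (a \<otimes> b) e f \<cdot> (Interchange C c a d b \<odot> Idn C (e \<otimes> f))) \<cdot>
      ((h \<odot> k) \<odot> l) \<cdot> (?i \<odot> Idn C ?I) \<cdot> ?i"
    using assms by (simp add: pairing_def merge merge_chain)
  also have "\<dots> = (Interchange C c a (d \<otimes> e) (b \<otimes> f) \<cdot> (Idn C (c \<otimes> a) \<odot> Interchange C d b e f) \<cdot>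
      Asc C (c \<otimes> a) (d \<otimes> b) (e \<otimes> f)) \<cdot> ((h \<odot> k) \<odot> l) \<cdot> (?i \<odot> Idn C ?I) \<cdot> ?i"
    by (simp only: interchange_asc assms)
  also have "\<dots> = Interchange C c a (d \<otimes> e) (b \<otimes> f) \<cdot> (Idn C (c \<otimes> a) \<odot> Interchange C d b e f) \<cdot>
      (h \<odot> (k \<odot> l)) \<cdot> (Asc C ?I ?I ?I \<cdot> (?i \<odot> Idn C ?I)) \<cdot> ?i"
    using assms by (simp add: chain[OF asc_nat])
  also have "\<dots> = pairing c a (d \<otimes> e) (b \<otimes> f) h (pairing d b e f k l)"
    unfolding asc_unit_inv using assms by (simp add: pairing_def merge merge_chain)
  finally show ?thesis .
qed

lemma pairing_unit:
  assumes "duality c a h"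
  shows "(Lun C c \<odot> Lun C a) \<cdot> pairing (Unt C) (Unt C) c a (Inv C (Lun C (Unt C))) h = h"
    and "(Run C c \<odot> Run C a) \<cdot> pairing c a (Unt C) (Unt C) h (Inv C (Lun C (Unt C))) = h"
proof -
  let ?I = "Unt C"
  let ?i = "Inv C (Lun C ?I)"
  have "(Lun C c \<odot> Lun C a) \<cdot> pairing ?I ?I c a ?i h =
      ((Lun C c \<odot> Lun C a) \<cdot> Interchange C ?I ?I c a \<cdot> (?i \<odot> Idn C (c \<otimes> a))) \<cdot> (Idn C ?I \<odot> h) \<cdot> ?i"
    using assms by (simp add: pairing_def merge_chain)
  also have "\<dots> = Lun C (c \<otimes> a) \<cdot> (Idn C ?I \<odot> h) \<cdot> ?i"
    by (simp only: interchange_unit assms)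
  also have "\<dots> = h" using assms by (simp add: chain[OF lun_nat])
  finally show "(Lun C c \<odot> Lun C a) \<cdot> pairing ?I ?I c a ?i h = h" .
  have "(Run C c \<odot> Run C a) \<cdot> pairing c a ?I ?I h ?i =
      ((Run C c \<odot> Run C a) \<cdot> Interchange C c a ?I ?I \<cdot> (Idn C (c \<otimes> a) \<odot> ?i)) \<cdot> (h \<odot> Idn C ?I) \<cdot> ?i"
    using assms by (simp add: pairing_def merge_chain)
  also have "\<dots> = Run C (c \<otimes> a) \<cdot> (h \<odot> Idn C ?I) \<cdot> ?i"
    by (simp only: interchange_unit assms)
  also have "\<dots> = h" using assms by (simp add: chain[OF run_nat] run_unit)
  finally show "(Run C c \<odot> Run C a) \<cdot> pairing c a ?I ?I h ?i = h" .
qed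

lemma pairing_sym:
  assumes "duality c a h" "duality d b k"
  shows "(Sym C c d \<odot> Sym C a b) \<cdot> pairing c a d b h k = pairing d b c a k h"
  using assms by (simp add: pairing_def chain[OF interchange_sym(1)] chain[OF sym_nat])

text \<open>Each piece is the arrow of duals induced by the matching piece of the identity functor:
  \<open>f\<close>, the identity of \<open>a \<otimes> b\<close>, the identity of the unit. The unit
  has two dualities, the chosen \<open>Jay\<close> and \<open>Inv C (Lun C (Unt C))\<close>, in
  which it is its own dual; \<open>FUnt\<close> compares them.\<close>

definition dual_id :: "('o, 'a, 'o, 'a) smf" where
  "dual_id = \<lparr>FOb = (\<lambda>a\<in>Ob C. Dual C a),
     FAr = (\<lambda>f\<in>Ar C. lift (Dual C (Dom C f)) (Dual C (Cod C f)) f (Jay C (Dom C f)) (Jay C (Cod C f))),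
     FTen = (\<lambda>a\<in>Ob C. \<lambda>b\<in>Ob C. lift (Dual C a \<otimes> Dual C b) (Dual C (a \<otimes> b)) (Idn C (a \<otimes> b))
       (pairing (Dual C a) a (Dual C b) b (Jay C a) (Jay C b)) (Jay C (a \<otimes> b))),
     FUnt = lift (Unt C) (Dual C (Unt C)) (Idn C (Unt C)) (Inv C (Lun C (Unt C))) (Jay C (Unt C))\<rparr>"

lemma dual_id_ob [simp]: "a \<in> Ob C \<Longrightarrow> FOb dual_id a = Dual C a"
  by (simp add: dual_id_def)

lemma dual_id_ar [simp]:
  assumes [simp]: "f \<in> Ar C"
  shows "FAr dual_id f \<in> Ar C" "Dom C (FAr dual_id f) = Dual C (Dom C f)" "Cod C (FAr dual_id f) = Dual C (Cod C f)"
    "(FAr dual_id f \<odot> f) \<cdot> Jay C (Dom C f) = Jay C (Cod C f)"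
  by (auto simp: dual_id_def lift)

lemma dual_id_ten [simp]:
  assumes [simp]: "a \<in> Ob C" "b \<in> Ob C"
  shows "FTen dual_id a b \<in> Ar C" "Dom C (FTen dual_id a b) = Dual C a \<otimes> Dual C b"
    "Cod C (FTen dual_id a b) = Dual C (a \<otimes> b)"
    "(FTen dual_id a b \<odot> Idn C (a \<otimes> b)) \<cdot> pairing (Dual C a) a (Dual C b) b (Jay C a) (Jay C b) = Jay C (a \<otimes> b)"
  by (auto simp: dual_id_def lift)

lemma dual_id_unt [simp]:
  "FUnt dual_id \<in> Ar C" "Dom C (FUnt dual_id) = Unt C" "Cod C (FUnt dual_id) = Dual C (Unt C)"
  "(FUnt dual_id \<odot> Idn C (Unt C)) \<cdot> Inv C (Lun C (Unt C)) = Jay C (Unt C)"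
  by (auto simp: dual_id_def lift)

text \<open>In every axiom the two sides are tensored with the matching arrow between the objects
  themselves and precomposed with a duality on the source. Both then give \<open>Jay\<close> of the
  target, for the constraint axioms by the pairing lemmas, and \<open>lift_unique\<close>
  applies.\<close>

lemma smf_dual_id: "symmetric_monoidal_functor C C dual_id"
proof (rule symmetric_monoidal_functorI)
  let ?D = "dual_id" and ?I = "Unt C"
  let ?p = "\<lambda>a b. pairing (Dual C a) a (Dual C b) b (Jay C a) (Jay C b)"
  show "FAr ?D (Idn C a) = Idn C (FOb ?D a)" if [simp]: "a \<in> Ob C" for a
    by (rule lift_unique[of _ "Idn C a" "Jay C a"]) (use dual_id_ar[of "Idn C a"] in auto)
  show "FAr ?D (g \<cdot> f) = FAr ?D g \<cdot> FAr ?D f" if [simp]: "f \<in> Ar C" "g \<in> Ar C" and dom [simp]: "Dom C g = Cod C f" for f g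
  proof (rule lift_unique[of _ "g \<cdot> f" "Jay C (Dom C f)"])
    have "((FAr ?D g \<cdot> FAr ?D f) \<odot> (g \<cdot> f)) \<cdot> Jay C (Dom C f) = (FAr ?D g \<odot> g) \<cdot> ((FAr ?D f \<odot> f) \<cdot> Jay C (Dom C f))"
      by (simp add: merge_chain del: dual_id_ar(4))
    also have "\<dots> = (FAr ?D g \<odot> g) \<cdot> Jay C (Dom C g)"
      by simp
    also have "\<dots> = Jay C (Cod C g)"
      by (simp only: dual_id_ar \<open>g \<in> Ar C\<close>)
    finally show "(FAr ?D (g \<cdot> f) \<odot> (g \<cdot> f)) \<cdot> Jay C (Dom C f) = ((FAr ?D g \<cdot> FAr ?D f) \<odot> (g \<cdot> f)) \<cdot> Jay C (Dom C f)"
      using dual_id_ar(4)[of "g \<cdot> f"] by simp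
  qed auto
  show "FTen ?D (Cod C f) (Cod C g) \<cdot> (FAr ?D f \<odot> FAr ?D g) = FAr ?D (f \<odot> g) \<cdot> FTen ?D (Dom C f) (Dom C g)"
    if [simp]: "f \<in> Ar C" "g \<in> Ar C" for f g
  proof (rule lift_unique[of _ "f \<odot> g" "?p (Dom C f) (Dom C g)"])
    have "((FTen ?D (Cod C f) (Cod C g) \<cdot> (FAr ?D f \<odot> FAr ?D g)) \<odot> (f \<odot> g)) \<cdot> ?p (Dom C f) (Dom C g) =
        (FTen ?D (Cod C f) (Cod C g) \<odot> Idn C (Cod C f \<otimes> Cod C g)) \<cdot>
        ((FAr ?D f \<odot> FAr ?D g) \<odot> (f \<odot> g)) \<cdot> ?p (Dom C f) (Dom C g)"
      by (simp add: merge_chain)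
    also have "\<dots> = (FTen ?D (Cod C f) (Cod C g) \<odot> Idn C (Cod C f \<otimes> Cod C g)) \<cdot> ?p (Cod C f) (Cod C g)"
      using pairing_nat[of "FAr ?D f" f "Jay C (Dom C f)" "FAr ?D g" g "Jay C (Dom C g)"] by simp
    also have "\<dots> = Jay C (Cod C f \<otimes> Cod C g)" by simp
    also have "\<dots> = (FAr ?D (f \<odot> g) \<odot> (f \<odot> g)) \<cdot> Jay C (Dom C f \<otimes> Dom C g)"
      using dual_id_ar(4)[of "f \<odot> g"] by simp
    also have "\<dots> = (FAr ?D (f \<odot> g) \<odot> (f \<odot> g)) \<cdot>
        ((FTen ?D (Dom C f) (Dom C g) \<odot> Idn C (Dom C f \<otimes> Dom C g)) \<cdot> ?p (Dom C f) (Dom C g))"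
      by simp
    also have "\<dots> = ((FAr ?D (f \<odot> g) \<cdot> FTen ?D (Dom C f) (Dom C g)) \<odot> (f \<odot> g)) \<cdot> ?p (Dom C f) (Dom C g)"
      by (simp add: merge_chain del: dual_id_ten(4))
    finally show "((FTen ?D (Cod C f) (Cod C g) \<cdot> (FAr ?D f \<odot> FAr ?D g)) \<odot> (f \<odot> g)) \<cdot> ?p (Dom C f) (Dom C g) =
      ((FAr ?D (f \<odot> g) \<cdot> FTen ?D (Dom C f) (Dom C g)) \<odot> (f \<odot> g)) \<cdot> ?p (Dom C f) (Dom C g)" .
  qed auto
  \<comment> \<open>Following the tensor constraint by the value at an arrow \<open>f\<close> out of
    \<open>a \<otimes> b\<close> absorbs two lifts at once.\<close>
  have jay: "(FAr ?D f \<odot> f) \<cdot> ((FTen ?D a b \<odot> Idn C (a \<otimes> b)) \<cdot> ?p a b) = Jay C (Cod C f)"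
    if "f \<in> Ar C" "Dom C f = a \<otimes> b" "a \<in> Ob C" "b \<in> Ob C" for f a b
    using that dual_id_ar(4)[of f] by simp
  show "FAr ?D (Asc C a b c) \<cdot> FTen ?D (a \<otimes> b) c \<cdot> (FTen ?D a b \<odot> Idn C (FOb ?D c)) =
      FTen ?D a (b \<otimes> c) \<cdot> (Idn C (FOb ?D a) \<odot> FTen ?D b c) \<cdot> Asc C (FOb ?D a) (FOb ?D b) (FOb ?D c)"
    if [simp]: "a \<in> Ob C" "b \<in> Ob C" "c \<in> Ob C" for a b c
  proof (rule lift_unique)
    let ?h = "pairing (Dual C a \<otimes> Dual C b) (a \<otimes> b) (Dual C c) c (?p a b) (Jay C c)"
    let ?L = "FAr ?D (Asc C a b c) \<cdot> FTen ?D (a \<otimes> b) c \<cdot> (FTen ?D a b \<odot> Idn C (FOb ?D c))"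
    let ?R = "FTen ?D a (b \<otimes> c) \<cdot> (Idn C (FOb ?D a) \<odot> FTen ?D b c) \<cdot> Asc C (FOb ?D a) (FOb ?D b) (FOb ?D c)"
    have "(?L \<odot> Asc C a b c) \<cdot> ?h = (FAr ?D (Asc C a b c) \<odot> Asc C a b c) \<cdot>
        (FTen ?D (a \<otimes> b) c \<odot> Idn C ((a \<otimes> b) \<otimes> c)) \<cdot>
        ((FTen ?D a b \<odot> Idn C (Dual C c)) \<odot> (Idn C (a \<otimes> b) \<odot> Idn C c)) \<cdot> ?h"
      by (simp add: merge_chain)
    also have "((FTen ?D a b \<odot> Idn C (Dual C c)) \<odot> (Idn C (a \<otimes> b) \<odot> Idn C c)) \<cdot> ?h = ?p (a \<otimes> b) c"
      using pairing_nat[of "FTen ?D a b" "Idn C (a \<otimes> b)" "?p a b" "Idn C (Dual C c)" "Idn C c" "Jay C c"]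
      by simp
    also have "(FAr ?D (Asc C a b c) \<odot> Asc C a b c) \<cdot> (FTen ?D (a \<otimes> b) c \<odot> Idn C ((a \<otimes> b) \<otimes> c)) \<cdot> ?p (a \<otimes> b) c
        = Jay C (a \<otimes> (b \<otimes> c))"
      by (subst jay) auto
    finally have L: "(?L \<odot> Asc C a b c) \<cdot> ?h = Jay C (a \<otimes> (b \<otimes> c))" .
    have "(?R \<odot> Asc C a b c) \<cdot> ?h = (FTen ?D a (b \<otimes> c) \<odot> Idn C (a \<otimes> (b \<otimes> c))) \<cdot>
        ((Idn C (Dual C a) \<odot> FTen ?D b c) \<odot> (Idn C a \<odot> Idn C (b \<otimes> c))) \<cdot>
        ((Asc C (Dual C a) (Dual C b) (Dual C c) \<odot> Asc C a b c) \<cdot> ?h)"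
      by (simp add: merge_chain)
    also have "(Asc C (Dual C a) (Dual C b) (Dual C c) \<odot> Asc C a b c) \<cdot> ?h =
        pairing (Dual C a) a (Dual C b \<otimes> Dual C c) (b \<otimes> c) (Jay C a) (?p b c)"
      by (rule pairing_asc) auto
    also have "((Idn C (Dual C a) \<odot> FTen ?D b c) \<odot> (Idn C a \<odot> Idn C (b \<otimes> c))) \<cdot>
        pairing (Dual C a) a (Dual C b \<otimes> Dual C c) (b \<otimes> c) (Jay C a) (?p b c) = ?p a (b \<otimes> c)"
      using pairing_nat[of "Idn C (Dual C a)" "Idn C a" "Jay C a" "FTen ?D b c" "Idn C (b \<otimes> c)" "?p b c"]
      by simp
    also have "(FTen ?D a (b \<otimes> c) \<odot> Idn C (a \<otimes> (b \<otimes> c))) \<cdot> ?p a (b \<otimes> c) = Jay C (a \<otimes> (b \<otimes> c))"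
      by simp
    finally show "(?L \<odot> Asc C a b c) \<cdot> ?h = (?R \<odot> Asc C a b c) \<cdot> ?h"
      using L by simp
  qed auto
  show "FAr ?D (Lun C a) \<cdot> FTen ?D ?I a \<cdot> (FUnt ?D \<odot> Idn C (FOb ?D a)) = Lun C (FOb ?D a)"
    if [simp]: "a \<in> Ob C" for a
  proof (rule lift_unique)
    let ?h = "pairing ?I ?I (Dual C a) a (Inv C (Lun C ?I)) (Jay C a)"
    let ?L = "FAr ?D (Lun C a) \<cdot> FTen ?D ?I a \<cdot> (FUnt ?D \<odot> Idn C (FOb ?D a))"
    have "(?L \<odot> Lun C a) \<cdot> ?h = (FAr ?D (Lun C a) \<odot> Lun C a) \<cdot> (FTen ?D ?I a \<odot> Idn C (?I \<otimes> a)) \<cdot>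
        ((FUnt ?D \<odot> Idn C (Dual C a)) \<odot> (Idn C ?I \<odot> Idn C a)) \<cdot> ?h"
      by (simp add: merge_chain)
    also have "((FUnt ?D \<odot> Idn C (Dual C a)) \<odot> (Idn C ?I \<odot> Idn C a)) \<cdot> ?h = ?p ?I a"
      using pairing_nat[of "FUnt ?D" "Idn C ?I" "Inv C (Lun C ?I)" "Idn C (Dual C a)" "Idn C a" "Jay C a"] by simp
    also have "(FAr ?D (Lun C a) \<odot> Lun C a) \<cdot> (FTen ?D ?I a \<odot> Idn C (?I \<otimes> a)) \<cdot> ?p ?I a = Jay C a"
      by (subst jay) auto
    finally show "(?L \<odot> Lun C a) \<cdot> ?h = (Lun C (FOb ?D a) \<odot> Lun C a) \<cdot> ?h"
      by (simp add: pairing_unit)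
  qed auto
  show "FAr ?D (Run C a) \<cdot> FTen ?D a ?I \<cdot> (Idn C (FOb ?D a) \<odot> FUnt ?D) = Run C (FOb ?D a)"
    if [simp]: "a \<in> Ob C" for a
  proof (rule lift_unique)
    let ?h = "pairing (Dual C a) a ?I ?I (Jay C a) (Inv C (Lun C ?I))"
    let ?L = "FAr ?D (Run C a) \<cdot> FTen ?D a ?I \<cdot> (Idn C (FOb ?D a) \<odot> FUnt ?D)"
    have "(?L \<odot> Run C a) \<cdot> ?h = (FAr ?D (Run C a) \<odot> Run C a) \<cdot> (FTen ?D a ?I \<odot> Idn C (a \<otimes> ?I)) \<cdot>
        ((Idn C (Dual C a) \<odot> FUnt ?D) \<odot> (Idn C a \<odot> Idn C ?I)) \<cdot> ?h"
      by (simp add: merge_chain)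
    also have "((Idn C (Dual C a) \<odot> FUnt ?D) \<odot> (Idn C a \<odot> Idn C ?I)) \<cdot> ?h = ?p a ?I"
      using pairing_nat[of "Idn C (Dual C a)" "Idn C a" "Jay C a" "FUnt ?D" "Idn C ?I" "Inv C (Lun C ?I)"] by simp
    also have "(FAr ?D (Run C a) \<odot> Run C a) \<cdot> (FTen ?D a ?I \<odot> Idn C (a \<otimes> ?I)) \<cdot> ?p a ?I = Jay C a"
      by (subst jay) auto
    finally show "(?L \<odot> Run C a) \<cdot> ?h = (Run C (FOb ?D a) \<odot> Run C a) \<cdot> ?h"
      by (simp add: pairing_unit)
  qed auto
  show "FAr ?D (Sym C a b) \<cdot> FTen ?D a b = FTen ?D b a \<cdot> Sym C (FOb ?D a) (FOb ?D b)"
    if [simp]: "a \<in> Ob C" "b \<in> Ob C" for a b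
  proof (rule lift_unique)
    have "((FAr ?D (Sym C a b) \<cdot> FTen ?D a b) \<odot> Sym C a b) \<cdot> ?p a b =
        (FAr ?D (Sym C a b) \<odot> Sym C a b) \<cdot> (FTen ?D a b \<odot> Idn C (a \<otimes> b)) \<cdot> ?p a b"
      by (simp add: merge_chain del: dual_id_ten(4))
    also have "\<dots> = Jay C (b \<otimes> a)"
      by (subst jay) auto
    also have "\<dots> = (FTen ?D b a \<odot> Idn C (b \<otimes> a)) \<cdot> ((Sym C (Dual C a) (Dual C b) \<odot> Sym C a b) \<cdot> ?p a b)"
      by (simp add: pairing_sym)
    also have "\<dots> = ((FTen ?D b a \<cdot> Sym C (FOb ?D a) (FOb ?D b)) \<odot> Sym C a b) \<cdot> ?p a b"
      by (simp add: merge_chain)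
    finally show "((FAr ?D (Sym C a b) \<cdot> FTen ?D a b) \<odot> Sym C a b) \<cdot> ?p a b =
      ((FTen ?D b a \<cdot> Sym C (FOb ?D a) (FOb ?D b)) \<odot> Sym C a b) \<cdot> ?p a b" .
  qed auto
qed (auto simp: symmetric_picard_axioms, auto simp: dual_id_def)

text \<open>Naturality and monoidality of \<open>j\<close> are the defining equations of the lifts
  in \<open>dual_id\<close>.\<close>

lemma jay_dual_id: "monoidal_transformation C C (jay_smt C C dual_id (id_smf C))"
proof (rule monoidal_transformationI)
  fix a b assume [simp]: "a \<in> Ob C" "b \<in> Ob C"
  have "(FTen dual_id a b \<odot> Idn C (a \<otimes> b)) \<cdot> pairing (Dual C a) a (Dual C b) b (Jay C a) (Jay C b) \<cdot> Lun C (Unt C) =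
      Jay C (a \<otimes> b) \<cdot> Lun C (Unt C)"
    by (simp add: chain[OF dual_id_ten(4)])
  then show "cpt (jay_smt C C dual_id (id_smf C)) (a \<otimes> b) \<cdot> FTen (Src (jay_smt C C dual_id (id_smf C))) a b =
      FTen (Trg (jay_smt C C dual_id (id_smf C))) a b \<cdot>
      (cpt (jay_smt C C dual_id (id_smf C)) a \<odot> cpt (jay_smt C C dual_id (id_smf C)) b)"
    by (simp add: jay_smt_def pairing_def)
qed (auto simp: jay_smt_def symmetric_picard_axioms intro: smf_tensor smf_unit smf_id smf_dual_id)

end

text \<open>In each law of \<open>j\<close> the data of \<open>G\<close> occurs tensored with the
  corresponding data of \<open>F\<close>, so \<open>lift_unique\<close> reads it off.\<close>

lemma jay_unique:
  assumes "monoidal_transformation A B (jay_smt A B G F)" "monoidal_transformation A B (jay_smt A B G' F)"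
    and smf: "symmetric_monoidal_functor A B F" "symmetric_monoidal_functor A B G" "symmetric_monoidal_functor A B G'"
    and ob: "\<And>a. a \<in> Ob A \<Longrightarrow> FOb G a = Dual B (FOb F a)" "\<And>a. a \<in> Ob A \<Longrightarrow> FOb G' a = Dual B (FOb F a)"
  shows "G = G'"
proof -
  interpret F: symmetric_monoidal_functor A B F by fact
  interpret J: monoidal_transformation A B "jay_smt A B G F" by fact
  interpret J': monoidal_transformation A B "jay_smt A B G' F" by fact
  interpret G: symmetric_monoidal_functor A B G by fact
  interpret G': symmetric_monoidal_functor A B G' by fact
  show ?thesis
  proof (rule smf_eqI[OF smf(2,3)])
    show "FOb G a = FOb G' a" if "a \<in> Ob A" for a
      using that ob by simp
    show "FAr G f = FAr G' f" if "f \<in> Ar A" for f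
      by (rule F.B.lift_unique[of _ "FAr F f" "Jay B (FOb F (Dom A f))"])
        (use that J.cpt_nat'[of f] J'.cpt_nat'[of f] ob in \<open>auto simp: jay_smt_def\<close>)
    show "FTen G a b = FTen G' a b" if "a \<in> Ob A" "b \<in> Ob A" for a b
      by (rule F.B.lift_unique[of _ "FTen F a b" "Interchange B (FOb G a) (FOb F a) (FOb G b) (FOb F b) \<cdot>\<^bsub>B\<^esub>
          (Jay B (FOb F a) \<odot>\<^bsub>B\<^esub> Jay B (FOb F b))"])
        (use that J.cpt_Ten[of a b] J'.cpt_Ten[of a b] ob in \<open>auto simp: jay_smt_def\<close>)
    show "FUnt G = FUnt G'"
      by (rule F.B.lift_unique[of _ "FUnt F" "Inv B (Lun B (Unt B))"])
        (use J.cpt_Unt J'.cpt_Unt ob in \<open>auto simp: jay_smt_def\<close>)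
  qed
qed

lemma dual_smf_eqI:
  assumes "symmetric_monoidal_functor A B F" "symmetric_monoidal_functor A B G"
    and "\<And>a. a \<in> Ob A \<Longrightarrow> FOb G a = Dual B (FOb F a)" "monoidal_transformation A B (jay_smt A B G F)"
  shows "dual_smf A B F = G"
  unfolding dual_smf_def
  by (rule the_equality) (use assms in \<open>auto intro: jay_unique[of A B _ F]\<close>)

text \<open>The description is met by the dual of the identity functor after \<open>F\<close>:
  \<open>jay_dual_id\<close> whiskered with \<open>F\<close> has the required source and target,
  because precomposition preserves unit and tensor product on the nose.\<close>

lemma dual_smf:
  assumes "symmetric_monoidal_functor A B F"
  shows "symmetric_monoidal_functor A B (dual_smf A B F)"
    and "a \<in> Ob A \<Longrightarrow> FOb (dual_smf A B F) a = Dual B (FOb F a)"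
    and "monoidal_transformation A B (jay_smt A B (dual_smf A B F) F)"
proof -
  interpret F: symmetric_monoidal_functor A B F by fact
  let ?D = "comp_smf A B F.B.dual_id F"
  have D: "symmetric_monoidal_functor A B ?D"
    by (rule smf_comp[OF assms F.B.smf_dual_id])
  have "comp_smf A B (tensor_smf B B F.B.dual_id (id_smf B)) F = tensor_smf A B ?D F"
    using comp_tensor_smf[OF assms F.B.smf_dual_id F.B.smf_id] comp_id_smf[OF assms] by simp
  then have "monoidal_transformation A B (jay_smt A B ?D F)"
    using whisker_functor_right[OF F.B.jay_dual_id assms] comp_unit_smf[OF assms F.B.symmetric_picard_axioms]
    by (simp add: jay_smt_def cong: restrict_cong)
  moreover from this have "dual_smf A B F = ?D"
    by (intro dual_smf_eqI[OF assms D]) auto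
  ultimately show "symmetric_monoidal_functor A B (dual_smf A B F)"
    and "a \<in> Ob A \<Longrightarrow> FOb (dual_smf A B F) a = Dual B (FOb F a)"
    and "monoidal_transformation A B (jay_smt A B (dual_smf A B F) F)"
    using D by auto
qed

section \<open>The internal hom\<close>

lemma ihom_simps [simp]:
  "F \<in> Ob (ihom A B) \<longleftrightarrow> symmetric_monoidal_functor A B F"
  "\<sigma> \<in> Ar (ihom A B) \<longleftrightarrow> monoidal_transformation A B \<sigma>"
  "Dom (ihom A B) \<sigma> = Src \<sigma>" "Cod (ihom A B) \<sigma> = Trg \<sigma>"
  "\<sigma> \<in> Hom (ihom A B) F G \<longleftrightarrow> monoidal_transformation A B \<sigma> \<and> Src \<sigma> = F \<and> Trg \<sigma> = G"
  "Unt (ihom A B) = unit_smf A B" "F \<otimes>\<^bsub>ihom A B\<^esub> G = tensor_smf A B F G"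
  "Dual (ihom A B) F = dual_smf A B F" "Jay (ihom A B) F = jay_smt A B (dual_smf A B F) F"
  by (auto simp: ihom_def Hom_def)

lemma ihom_src [simp]:
  "Src (Idn (ihom A B) F) = F" "Src (\<tau> \<cdot>\<^bsub>ihom A B\<^esub> \<sigma>) = Src \<sigma>"
  "Src (\<sigma> \<odot>\<^bsub>ihom A B\<^esub> \<tau>) = tensor_smf A B (Src \<sigma>) (Src \<tau>)"
  "Src (Asc (ihom A B) F G H) = tensor_smf A B (tensor_smf A B F G) H"
  "Src (Lun (ihom A B) F) = tensor_smf A B (unit_smf A B) F"
  "Src (Run (ihom A B) F) = tensor_smf A B F (unit_smf A B)"
  "Src (Sym (ihom A B) F G) = tensor_smf A B F G"
  "Src (jay_smt A B G F) = unit_smf A B"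
  by (auto simp: ihom_def jay_smt_def)

lemma ihom_trg [simp]:
  "Trg (Idn (ihom A B) F) = F" "Trg (\<tau> \<cdot>\<^bsub>ihom A B\<^esub> \<sigma>) = Trg \<tau>"
  "Trg (\<sigma> \<odot>\<^bsub>ihom A B\<^esub> \<tau>) = tensor_smf A B (Trg \<sigma>) (Trg \<tau>)"
  "Trg (Asc (ihom A B) F G H) = tensor_smf A B F (tensor_smf A B G H)"
  "Trg (Lun (ihom A B) F) = F" "Trg (Run (ihom A B) F) = F"
  "Trg (Sym (ihom A B) F G) = tensor_smf A B G F"
  "Trg (jay_smt A B G F) = tensor_smf A B G F"
  by (auto simp: ihom_def jay_smt_def)

lemma ihom_cpt [simp]:
  assumes "a \<in> Ob A"
  shows "cpt (Idn (ihom A B) F) a = Idn B (FOb F a)" "cpt (\<tau> \<cdot>\<^bsub>ihom A B\<^esub> \<sigma>) a = cpt \<tau> a \<cdot>\<^bsub>B\<^esub> cpt \<sigma> a"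
  "cpt (\<sigma> \<odot>\<^bsub>ihom A B\<^esub> \<tau>) a = cpt \<sigma> a \<odot>\<^bsub>B\<^esub> cpt \<tau> a"
  "cpt (Asc (ihom A B) F G H) a = Asc B (FOb F a) (FOb G a) (FOb H a)"
  "cpt (Lun (ihom A B) F) a = Lun B (FOb F a)" "cpt (Run (ihom A B) F) a = Run B (FOb F a)"
  "cpt (Sym (ihom A B) F G) a = Sym B (FOb F a) (FOb G a)"
  "cpt (jay_smt A B G F) a = Jay B (FOb F a)"
  using assms by (auto simp: ihom_def jay_smt_def)

lemma ihom_cpt_ext [simp]:
  "cpt (Idn (ihom A B) F) \<in> extensional (Ob A)" "cpt (\<tau> \<cdot>\<^bsub>ihom A B\<^esub> \<sigma>) \<in> extensional (Ob A)"
  "cpt (\<sigma> \<odot>\<^bsub>ihom A B\<^esub> \<tau>) \<in> extensional (Ob A)" "cpt (Asc (ihom A B) F G H) \<in> extensional (Ob A)"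
  "cpt (Lun (ihom A B) F) \<in> extensional (Ob A)" "cpt (Run (ihom A B) F) \<in> extensional (Ob A)"
  "cpt (Sym (ihom A B) F G) \<in> extensional (Ob A)" "cpt (jay_smt A B G F) \<in> extensional (Ob A)"
  by (auto simp: ihom_def jay_smt_def)

lemma mt_idn:
  assumes "symmetric_monoidal_functor A B F"
  shows "monoidal_transformation A B (Idn (ihom A B) F)"
proof -
  interpret F: symmetric_monoidal_functor A B F by fact
  show ?thesis by (rule monoidal_transformationI) (auto intro: assms)
qed

lemma mt_cmp:
  assumes "monoidal_transformation A B \<sigma>" "monoidal_transformation A B \<tau>" "Src \<tau> = Trg \<sigma>"
  shows "monoidal_transformation A B (\<tau> \<cdot>\<^bsub>ihom A B\<^esub> \<sigma>)"
proof -
  interpret \<sigma>: monoidal_transformation A B \<sigma> by fact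
  interpret \<tau>: monoidal_transformation A B \<tau> by fact
  note B = \<sigma>.S.B.chain[OF \<tau>.cpt_nat'[unfolded assms(3)]] \<sigma>.S.B.chain[OF \<tau>.cpt_Ten[unfolded assms(3)]]
    \<tau>.cpt_Unt[unfolded assms(3)]
  show ?thesis
    by (rule monoidal_transformationI)
      (auto simp: assms(3) \<sigma>.cpt_nat' \<sigma>.cpt_Ten \<sigma>.cpt_Unt B \<sigma>.S.B.merge intro: \<sigma>.src_smf \<tau>.trg_smf)
qed

lemma mt_inv:
  fixes B (structure)
  assumes "monoidal_transformation A B \<sigma>"
  shows "monoidal_transformation A B \<lparr>Src = Trg \<sigma>, Trg = Src \<sigma>, cpt = (\<lambda>a\<in>Ob A. Inv B (cpt \<sigma> a))\<rparr>"
    (is "monoidal_transformation A B ?\<tau>")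
proof -
  interpret \<sigma>: monoidal_transformation A B \<sigma> by fact
  show ?thesis
  proof (rule monoidal_transformationI)
    fix f assume [simp]: "f \<in> Ar A"
    have "cpt \<sigma> (Cod A f) \<cdot> (Inv B (cpt \<sigma> (Cod A f)) \<cdot> FAr (Trg \<sigma>) f) =
        cpt \<sigma> (Cod A f) \<cdot> (FAr (Src \<sigma>) f \<cdot> Inv B (cpt \<sigma> (Dom A f)))"
      by (simp add: \<sigma>.S.B.chain[OF \<sigma>.cpt_nat'])
    then have "Inv B (cpt \<sigma> (Cod A f)) \<cdot> FAr (Trg \<sigma>) f = FAr (Src \<sigma>) f \<cdot> Inv B (cpt \<sigma> (Dom A f))"
      by (rule \<sigma>.S.B.cancel_left) auto
    then show "cpt ?\<tau> (Cod A f) \<cdot> FAr (Src ?\<tau>) f = FAr (Trg ?\<tau>) f \<cdot> cpt ?\<tau> (Dom A f)"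
      by simp
  next
    fix a b assume [simp]: "a \<in> Ob A" "b \<in> Ob A"
    have "cpt \<sigma> (a \<otimes>\<^bsub>A\<^esub> b) \<cdot> (Inv B (cpt \<sigma> (a \<otimes>\<^bsub>A\<^esub> b)) \<cdot> FTen (Trg \<sigma>) a b) =
        cpt \<sigma> (a \<otimes>\<^bsub>A\<^esub> b) \<cdot> (FTen (Src \<sigma>) a b \<cdot> (Inv B (cpt \<sigma> a) \<odot> Inv B (cpt \<sigma> b)))"
      by (simp add: \<sigma>.S.B.chain[OF \<sigma>.cpt_Ten] \<sigma>.S.B.merge)
    then have "Inv B (cpt \<sigma> (a \<otimes>\<^bsub>A\<^esub> b)) \<cdot> FTen (Trg \<sigma>) a b =
        FTen (Src \<sigma>) a b \<cdot> (Inv B (cpt \<sigma> a) \<odot> Inv B (cpt \<sigma> b))"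
      by (rule \<sigma>.S.B.cancel_left) auto
    then show "cpt ?\<tau> (a \<otimes>\<^bsub>A\<^esub> b) \<cdot> FTen (Src ?\<tau>) a b = FTen (Trg ?\<tau>) a b \<cdot> (cpt ?\<tau> a \<odot> cpt ?\<tau> b)"
      by simp
  next
    show "cpt ?\<tau> (Unt A) \<cdot> FUnt (Src ?\<tau>) = FUnt (Trg ?\<tau>)"
      by (simp flip: \<sigma>.cpt_Unt)
  qed (auto intro: \<sigma>.src_smf \<sigma>.trg_smf)
qed

lemma mt_tenA:
  assumes "monoidal_transformation A B \<sigma>" "monoidal_transformation A B \<tau>"
  shows "monoidal_transformation A B (\<sigma> \<odot>\<^bsub>ihom A B\<^esub> \<tau>)"
proof -
  interpret \<sigma>: monoidal_transformation A B \<sigma> by fact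
  interpret \<tau>: monoidal_transformation A B \<tau> by fact
  show ?thesis
    by (rule monoidal_transformationI)
      (auto simp: \<sigma>.S.B.merge \<sigma>.S.B.merge_chain \<sigma>.S.B.interchange_nat \<sigma>.cpt_nat' \<tau>.cpt_nat' \<sigma>.cpt_Ten \<tau>.cpt_Ten
        \<sigma>.cpt_Unt \<tau>.cpt_Unt intro!: smf_tensor \<sigma>.src_smf \<sigma>.trg_smf \<tau>.src_smf \<tau>.trg_smf)
qed

lemma mt_asc:
  fixes B (structure)
  assumes "symmetric_monoidal_functor A B F" "symmetric_monoidal_functor A B G" "symmetric_monoidal_functor A B H"
  shows "monoidal_transformation A B (Asc (ihom A B) F G H)"
proof -
  interpret F: symmetric_monoidal_functor A B F by fact
  interpret G: symmetric_monoidal_functor A B G by fact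
  interpret H: symmetric_monoidal_functor A B H by fact
  note merge = F.B.merge F.B.merge_chain
  let ?a = "Asc (ihom A B) F G H"
  show ?thesis
  proof (rule monoidal_transformationI)
    fix a b assume [simp]: "a \<in> Ob A" "b \<in> Ob A"
    let ?f = "FOb F a" and ?g = "FOb G a" and ?h = "FOb H a" and ?f' = "FOb F b" and ?g' = "FOb G b" and ?h' = "FOb H b"
    let ?c = "Interchange B"
    have "cpt (?a) (a \<otimes>\<^bsub>A\<^esub> b) \<cdot> FTen (Src (?a)) a b =
        Asc B (FOb F (a \<otimes>\<^bsub>A\<^esub> b)) (FOb G (a \<otimes>\<^bsub>A\<^esub> b)) (FOb H (a \<otimes>\<^bsub>A\<^esub> b)) \<cdot>
        ((FTen F a b \<odot> FTen G a b) \<odot> FTen H a b) \<cdot>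
        (?c ?f ?g ?f' ?g' \<odot> Idn B (?h \<otimes> ?h')) \<cdot> ?c (?f \<otimes> ?g) ?h (?f' \<otimes> ?g') ?h'"
      by (simp add: merge)
    also have "\<dots> = (FTen F a b \<odot> (FTen G a b \<odot> FTen H a b)) \<cdot>
        (Asc B (?f \<otimes> ?f') (?g \<otimes> ?g') (?h \<otimes> ?h') \<cdot>
        (?c ?f ?g ?f' ?g' \<odot> Idn B (?h \<otimes> ?h')) \<cdot> ?c (?f \<otimes> ?g) ?h (?f' \<otimes> ?g') ?h')"
      by (simp add: F.B.chain[OF F.B.asc_nat])
    also have "\<dots> = (FTen F a b \<odot> (FTen G a b \<odot> FTen H a b)) \<cdot>
        (Idn B (?f \<otimes> ?f') \<odot> ?c ?g ?h ?g' ?h') \<cdot> ?c ?f (?g \<otimes> ?h) ?f' (?g' \<otimes> ?h') \<cdot>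
        (Asc B ?f ?g ?h \<odot> Asc B ?f' ?g' ?h')"
      by (simp only: F.B.interchange_asc F.F_ob G.F_ob H.F_ob \<open>a \<in> Ob A\<close> \<open>b \<in> Ob A\<close>)
    also have "\<dots> = FTen (Trg (?a)) a b \<cdot>
        (cpt (?a) a \<odot> cpt (?a) b)"
      by (simp add: merge)
    finally show "cpt (?a) (a \<otimes>\<^bsub>A\<^esub> b) \<cdot> FTen (Src (?a)) a b =
      FTen (Trg (?a)) a b \<cdot> (cpt (?a) a \<odot> cpt (?a) b)" .
  next
    let ?I = "Unt B" let ?i = "Inv B (Lun B (Unt B))"
    have "cpt (?a) (Unt A) \<cdot> FUnt (Src (?a)) =
        Asc B (FOb F (Unt A)) (FOb G (Unt A)) (FOb H (Unt A)) \<cdot> ((FUnt F \<odot> FUnt G) \<odot> FUnt H) \<cdot>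
        (?i \<odot> Idn B ?I) \<cdot> ?i"
      by (simp add: merge)
    also have "\<dots> = (FUnt F \<odot> (FUnt G \<odot> FUnt H)) \<cdot> (Asc B ?I ?I ?I \<cdot> (?i \<odot> Idn B ?I)) \<cdot> ?i"
      by (simp add: F.B.chain[OF F.B.asc_nat])
    also have "\<dots> = FUnt (Trg (?a))"
      unfolding F.B.asc_unit_inv by (simp add: merge)
    finally show "cpt (?a) (Unt A) \<cdot> FUnt (Src (?a)) =
      FUnt (Trg (?a))" .
  qed (auto simp: F.B.asc_nat intro!: smf_tensor assms)
qed

lemma mt_unitors:
  fixes B (structure)
  assumes "symmetric_monoidal_functor A B F"
  shows "monoidal_transformation A B (Lun (ihom A B) F)" "monoidal_transformation A B (Run (ihom A B) F)"
proof -
  interpret F: symmetric_monoidal_functor A B F by fact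
  note unit = smf_unit[OF F.A.symmetric_picard_axioms F.B.symmetric_picard_axioms]
  show "monoidal_transformation A B (Lun (ihom A B) F)"
  proof (rule monoidal_transformationI)
    fix a b assume [simp]: "a \<in> Ob A" "b \<in> Ob A"
    have "Lun B (FOb F (a \<otimes>\<^bsub>A\<^esub> b)) \<cdot> ((Lun B (Unt B) \<odot> FTen F a b) \<cdot> Interchange B (Unt B) (FOb F a) (Unt B) (FOb F b)) =
        Lun B (FOb F (a \<otimes>\<^bsub>A\<^esub> b)) \<cdot> (Idn B (Unt B) \<odot> FTen F a b) \<cdot>
        ((Lun B (Unt B) \<odot> Idn B (FOb F a \<otimes> FOb F b)) \<cdot> Interchange B (Unt B) (FOb F a) (Unt B) (FOb F b))"
      by (simp add: F.B.merge_chain)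
    also have "\<dots> = FTen F a b \<cdot> (Lun B (FOb F a) \<odot> Lun B (FOb F b))"
      by (simp add: F.B.chain[OF F.B.lun_nat] F.B.interchange_unit)
    finally show "cpt (Lun (ihom A B) F) (a \<otimes>\<^bsub>A\<^esub> b) \<cdot> FTen (Src (Lun (ihom A B) F)) a b =
        FTen (Trg (Lun (ihom A B) F)) a b \<cdot> (cpt (Lun (ihom A B) F) a \<odot> cpt (Lun (ihom A B) F) b)"
      by simp
  qed (auto simp: F.B.lun_nat F.B.chain[OF F.B.lun_nat] intro!: smf_tensor assms unit)
  show "monoidal_transformation A B (Run (ihom A B) F)"
  proof (rule monoidal_transformationI)
    fix a b assume [simp]: "a \<in> Ob A" "b \<in> Ob A"
    have "Run B (FOb F (a \<otimes>\<^bsub>A\<^esub> b)) \<cdot> ((FTen F a b \<odot> Lun B (Unt B)) \<cdot> Interchange B (FOb F a) (Unt B) (FOb F b) (Unt B)) =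
        Run B (FOb F (a \<otimes>\<^bsub>A\<^esub> b)) \<cdot> (FTen F a b \<odot> Idn B (Unt B)) \<cdot>
        ((Idn B (FOb F a \<otimes> FOb F b) \<odot> Lun B (Unt B)) \<cdot> Interchange B (FOb F a) (Unt B) (FOb F b) (Unt B))"
      by (simp add: F.B.merge_chain)
    also have "\<dots> = FTen F a b \<cdot> (Run B (FOb F a) \<odot> Run B (FOb F b))"
      by (simp add: F.B.chain[OF F.B.run_nat] F.B.interchange_unit)
    finally show "cpt (Run (ihom A B) F) (a \<otimes>\<^bsub>A\<^esub> b) \<cdot> FTen (Src (Run (ihom A B) F)) a b =
        FTen (Trg (Run (ihom A B) F)) a b \<cdot> (cpt (Run (ihom A B) F) a \<odot> cpt (Run (ihom A B) F) b)"
      by simp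
  qed (auto simp: F.B.run_nat F.B.chain[OF F.B.run_nat] F.B.run_unit intro!: smf_tensor assms unit)
qed

lemma mt_sym:
  assumes "symmetric_monoidal_functor A B F" "symmetric_monoidal_functor A B G"
  shows "monoidal_transformation A B (Sym (ihom A B) F G)"
proof -
  interpret F: symmetric_monoidal_functor A B F by fact
  interpret G: symmetric_monoidal_functor A B G by fact
  show ?thesis
    by (rule monoidal_transformationI)
      (auto simp: F.B.sym_nat F.B.chain[OF F.B.sym_nat] F.B.interchange_sym(2) intro!: smf_tensor assms)
qed

text \<open>Once the structural families are known to be monoidal transformations, every equational
  axiom holds in each component because it holds in \<open>B\<close>.\<close>

lemma symmetric_picard_ihom:
  assumes "symmetric_picard A" "symmetric_picard B"
  shows "symmetric_picard (ihom A B)"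
proof -
  interpret A: symmetric_picard A by fact
  interpret B: symmetric_picard B by fact
  note [simp] = symmetric_monoidal_functor.F_ob[of A B] monoidal_transformation.cpt_ar[of A B]
    monoidal_transformation.cpt_ext[of A B]
    smf_tensor smf_unit[OF assms] dual_smf[of A B] mt_idn mt_cmp mt_tenA mt_asc mt_unitors mt_sym
    monoidal_transformation.src_smf[of A B] monoidal_transformation.trg_smf[of A B]
  show ?thesis
  proof
    fix \<sigma> assume "\<sigma> \<in> Ar (ihom A B)"
    then have \<sigma> [simp]: "monoidal_transformation A B \<sigma>" by simp
    let ?\<tau> = "\<lparr>Src = Trg \<sigma>, Trg = Src \<sigma>, cpt = (\<lambda>a\<in>Ob A. Inv B (cpt \<sigma> a))\<rparr>"
    have "inverse_arrows (ihom A B) \<sigma> ?\<tau>"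
      unfolding inverse_arrows_def
      by (auto simp: mt_inv intro!: smt_eqI[where X = "Ob A"])
    then show "\<exists>\<tau>. inverse_arrows (ihom A B) \<sigma> \<tau>" by blast
  qed (auto intro!: smt_eqI[where X = "Ob A"]
      simp: B.merge B.asc_nat B.lun_nat B.run_nat B.sym_nat B.pentagon B.triangle B.hexagon)
qed

section \<open>Composition as a strict arrow\<close>

lemma ihom_Inv:
  assumes "monoidal_transformation A B \<sigma>"
  shows "Inv (ihom A B) \<sigma> = \<lparr>Src = Trg \<sigma>, Trg = Src \<sigma>, cpt = (\<lambda>a\<in>Ob A. Inv B (cpt \<sigma> a))\<rparr>"
proof -
  interpret \<sigma>: monoidal_transformation A B \<sigma> by fact
  interpret H: symmetric_picard "ihom A B"
    by (intro symmetric_picard_ihom \<sigma>.S.A.symmetric_picard_axioms \<sigma>.S.B.symmetric_picard_axioms)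
  show ?thesis
    by (rule H.Inv_eq) (auto simp: inverse_arrows_def mt_inv assms intro!: smt_eqI[where X = "Ob A"])
qed

lemma ihom_Inv_simps [simp]:
  assumes "monoidal_transformation A B \<sigma>"
  shows "Src (Inv (ihom A B) \<sigma>) = Trg \<sigma>" "Trg (Inv (ihom A B) \<sigma>) = Src \<sigma>"
    "a \<in> Ob A \<Longrightarrow> cpt (Inv (ihom A B) \<sigma>) a = Inv B (cpt \<sigma> a)"
  using assms by (auto simp: ihom_Inv)

lemma ihom_Interchange:
  assumes "symmetric_monoidal_functor A B F" "symmetric_monoidal_functor A B G"
    "symmetric_monoidal_functor A B H" "symmetric_monoidal_functor A B K" "a \<in> Ob A"
  shows "cpt (Interchange (ihom A B) F G H K) a = Interchange B (FOb F a) (FOb G a) (FOb H a) (FOb K a)"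
  using assms by (simp add: Interchange_def mt_asc smf_tensor)

lemma post_simps [simp]:
  "symmetric_monoidal_functor A B F \<Longrightarrow> FOb (post A B C G) F = comp_smf A C G F"
  "monoidal_transformation A B \<sigma> \<Longrightarrow> FAr (post A B C G) \<sigma> =
    \<lparr>Src = comp_smf A C G (Src \<sigma>), Trg = comp_smf A C G (Trg \<sigma>), cpt = (\<lambda>a\<in>Ob A. FAr G (cpt \<sigma> a))\<rparr>"
  "symmetric_monoidal_functor A B F \<Longrightarrow> symmetric_monoidal_functor A B F' \<Longrightarrow> FTen (post A B C G) F F' =
    \<lparr>Src = tensor_smf A C (comp_smf A C G F) (comp_smf A C G F'), Trg = comp_smf A C G (tensor_smf A B F F'),
     cpt = (\<lambda>a\<in>Ob A. FTen G (FOb F a) (FOb F' a))\<rparr>"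
  "FUnt (post A B C G) = \<lparr>Src = unit_smf A C, Trg = comp_smf A C G (unit_smf A B), cpt = (\<lambda>a\<in>Ob A. FUnt G)\<rparr>"
  by (auto simp: post_def)

lemma pre_simps [simp]:
  "symmetric_monoidal_functor B C G \<Longrightarrow> FOb (pre A B C F) G = comp_smf A C G F"
  "monoidal_transformation B C \<sigma> \<Longrightarrow> FAr (pre A B C F) \<sigma> =
    \<lparr>Src = comp_smf A C (Src \<sigma>) F, Trg = comp_smf A C (Trg \<sigma>) F, cpt = (\<lambda>a\<in>Ob A. cpt \<sigma> (FOb F a))\<rparr>"
  "symmetric_monoidal_functor B C G \<Longrightarrow> symmetric_monoidal_functor B C G' \<Longrightarrow>
    FTen (pre A B C F) G G' = Idn (ihom A C) (comp_smf A C (tensor_smf B C G G') F)"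
  "FUnt (pre A B C F) = Idn (ihom A C) (unit_smf A C)"
  by (auto simp: pre_def)

lemma post_functor_simps [simp]:
  "symmetric_monoidal_functor B C G \<Longrightarrow> FOb (post_functor A B C) G = post A B C G"
  "monoidal_transformation B C \<tau> \<Longrightarrow> FAr (post_functor A B C) \<tau> =
    \<lparr>Src = post A B C (Src \<tau>), Trg = post A B C (Trg \<tau>), cpt = (\<lambda>F\<in>Ob (ihom A B).
      \<lparr>Src = comp_smf A C (Src \<tau>) F, Trg = comp_smf A C (Trg \<tau>) F, cpt = (\<lambda>a\<in>Ob A. cpt \<tau> (FOb F a))\<rparr>)\<rparr>"
  "symmetric_monoidal_functor B C G \<Longrightarrow> symmetric_monoidal_functor B C G' \<Longrightarrow> FTen (post_functor A B C) G G' =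
    Idn (ihom (ihom A B) (ihom A C)) (post A B C (tensor_smf B C G G'))"
  "FUnt (post_functor A B C) = Idn (ihom (ihom A B) (ihom A C)) (unit_smf (ihom A B) (ihom A C))"
  by (auto simp: post_functor_def)

text \<open>From \<open>F_Lun\<close> at the unit and naturality of \<open>Lun\<close>. It makes the
  constraints of \<open>post\<close> compatible with units.\<close>

lemma (in symmetric_monoidal_functor) FUnt_FTen:
  "FTen F (Unt A) (Unt A) \<cdot>\<^bsub>B\<^esub> (FUnt F \<odot>\<^bsub>B\<^esub> FUnt F) = FAr F (Inv A (Lun A (Unt A))) \<cdot>\<^bsub>B\<^esub> FUnt F \<cdot>\<^bsub>B\<^esub> Lun B (Unt B)"
proof (rule B.cancel_left[of "FAr F (Lun A (Unt A))"])
  have "FAr F (Lun A (Unt A)) \<cdot>\<^bsub>B\<^esub> (FTen F (Unt A) (Unt A) \<cdot>\<^bsub>B\<^esub> (FUnt F \<odot>\<^bsub>B\<^esub> FUnt F)) =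
      (FAr F (Lun A (Unt A)) \<cdot>\<^bsub>B\<^esub> FTen F (Unt A) (Unt A) \<cdot>\<^bsub>B\<^esub> (FUnt F \<odot>\<^bsub>B\<^esub> Idn B (FOb F (Unt A)))) \<cdot>\<^bsub>B\<^esub>
      (Idn B (Unt B) \<odot>\<^bsub>B\<^esub> FUnt F)"
    by (simp add: B.merge)
  also have "\<dots> = FUnt F \<cdot>\<^bsub>B\<^esub> Lun B (Unt B)"
    unfolding F_Lun[OF A.unt_ob] by (simp add: B.lun_nat)
  finally show "FAr F (Lun A (Unt A)) \<cdot>\<^bsub>B\<^esub> (FTen F (Unt A) (Unt A) \<cdot>\<^bsub>B\<^esub> (FUnt F \<odot>\<^bsub>B\<^esub> FUnt F)) =
      FAr F (Lun A (Unt A)) \<cdot>\<^bsub>B\<^esub> (FAr F (Inv A (Lun A (Unt A))) \<cdot>\<^bsub>B\<^esub> FUnt F \<cdot>\<^bsub>B\<^esub> Lun B (Unt B))"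
    by simp
qed auto

text \<open>The constraint of \<open>tensor_smf\<close> contains an interchange, so compatibility of
  this family with tensor products comes down to \<open>F_Interchange\<close> for
  \<open>G\<close>.\<close>

lemma mt_post_ten:
  fixes C (structure)
  assumes "symmetric_monoidal_functor A B F" "symmetric_monoidal_functor A B F'" "symmetric_monoidal_functor B C G"
  shows "monoidal_transformation A C (FTen (post A B C G) F F')" (is "monoidal_transformation A C ?\<sigma>")
proof -
  interpret F: symmetric_monoidal_functor A B F by fact
  interpret F': symmetric_monoidal_functor A B F' by fact
  interpret G: symmetric_monoidal_functor B C G by fact
  show ?thesis
  proof (rule monoidal_transformationI)
    fix a b assume [simp]: "a \<in> Ob A" "b \<in> Ob A"
    let ?f = "FOb F a" and ?g = "FOb F' a" and ?f' = "FOb F b" and ?g' = "FOb F' b"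
    have "cpt ?\<sigma> (a \<otimes>\<^bsub>A\<^esub> b) \<cdot> FTen (Src ?\<sigma>) a b =
        (FTen G (FOb F (a \<otimes>\<^bsub>A\<^esub> b)) (FOb F' (a \<otimes>\<^bsub>A\<^esub> b)) \<cdot> (FAr G (FTen F a b) \<odot> FAr G (FTen F' a b))) \<cdot>
        (FTen G ?f ?f' \<odot> FTen G ?g ?g') \<cdot> Interchange C (FOb G ?f) (FOb G ?g) (FOb G ?f') (FOb G ?g')"
      by (simp add: assms G.B.merge_chain)
    also have "\<dots> = FAr G (FTen F a b \<odot>\<^bsub>B\<^esub> FTen F' a b) \<cdot> (FTen G (?f \<otimes>\<^bsub>B\<^esub> ?f') (?g \<otimes>\<^bsub>B\<^esub> ?g') \<cdot>
        (FTen G ?f ?f' \<odot> FTen G ?g ?g') \<cdot> Interchange C (FOb G ?f) (FOb G ?g) (FOb G ?f') (FOb G ?g'))"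
      by (simp add: G.FTen_nat')
    also have "\<dots> = FTen (Trg ?\<sigma>) a b \<cdot> (cpt ?\<sigma> a \<odot> cpt ?\<sigma> b)"
      by (simp add: assms flip: G.F_Interchange)
    finally show "cpt ?\<sigma> (a \<otimes>\<^bsub>A\<^esub> b) \<cdot> FTen (Src ?\<sigma>) a b = FTen (Trg ?\<sigma>) a b \<cdot> (cpt ?\<sigma> a \<odot> cpt ?\<sigma> b)" .
  next
    have "cpt ?\<sigma> (Unt A) \<cdot> FUnt (Src ?\<sigma>) =
        (FTen G (FOb F (Unt A)) (FOb F' (Unt A)) \<cdot> (FAr G (FUnt F) \<odot> FAr G (FUnt F'))) \<cdot>
        (FUnt G \<odot> FUnt G) \<cdot> Inv C (Lun C (Unt C))"
      by (simp add: assms G.B.merge_chain)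
    also have "\<dots> = FUnt (Trg ?\<sigma>)"
      by (simp add: assms G.FTen_nat' G.B.chain[OF G.FUnt_FTen])
    finally show "cpt ?\<sigma> (Unt A) \<cdot> FUnt (Src ?\<sigma>) = FUnt (Trg ?\<sigma>)" .
  next
    fix f assume "f \<in> Ar A"
    then show "cpt ?\<sigma> (Cod A f) \<cdot> FAr (Src ?\<sigma>) f = FAr (Trg ?\<sigma>) f \<cdot> cpt ?\<sigma> (Dom A f)"
      by (simp add: assms G.FTen_nat')
  qed (auto simp: assms intro!: smf_tensor smf_comp[where B = B] assms)
qed

lemma mt_post_unt:
  assumes "symmetric_picard A" "symmetric_monoidal_functor B C G"
  shows "monoidal_transformation A C (FUnt (post A B C G))"
proof -
  interpret A: symmetric_picard A by fact
  interpret G: symmetric_monoidal_functor B C G by fact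
  have "FAr G (Lun B (Unt B)) \<cdot>\<^bsub>C\<^esub> FTen G (Unt B) (Unt B) \<cdot>\<^bsub>C\<^esub> (FUnt G \<odot>\<^bsub>C\<^esub> FUnt G) = FUnt G \<cdot>\<^bsub>C\<^esub> Lun C (Unt C)"
    by (simp add: G.FUnt_FTen)
  then show ?thesis
    by (intro monoidal_transformationI)
      (auto intro!: smf_unit smf_comp[where B = B] assms G.A.symmetric_picard_axioms G.B.symmetric_picard_axioms)
qed

lemma smf_post:
  assumes "symmetric_picard A" "symmetric_monoidal_functor B C G"
  shows "symmetric_monoidal_functor (ihom A B) (ihom A C) (post A B C G)"
proof -
  interpret A: symmetric_picard A by fact
  interpret G: symmetric_monoidal_functor B C G by fact
  note B = G.A.symmetric_picard_axioms and C = G.B.symmetric_picard_axioms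
  note [simp] = symmetric_monoidal_functor.F_ob[of A B] monoidal_transformation.cpt_ar[of A B]
    smf_tensor smf_unit[OF assms(1) B] mt_idn mt_cmp mt_tenA mt_asc mt_unitors mt_sym
    monoidal_transformation.src_smf[of A B] monoidal_transformation.trg_smf[of A B]
    mt_post_unt[OF assms, simplified]
    smf_comp[OF _ assms(2), of A] whisker_functor_left[OF _ assms(2), of A]
  show ?thesis
  proof (rule symmetric_monoidal_functorI)
    show "symmetric_picard (ihom A B)" "symmetric_picard (ihom A C)"
      by (intro symmetric_picard_ihom assms B C)+
    show "FTen (post A B C G) F F' \<in> Ar (ihom A C) \<and>
        Dom (ihom A C) (FTen (post A B C G) F F') = FOb (post A B C G) F \<otimes>\<^bsub>ihom A C\<^esub> FOb (post A B C G) F' \<and>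
        Cod (ihom A C) (FTen (post A B C G) F F') = FOb (post A B C G) (F \<otimes>\<^bsub>ihom A B\<^esub> F')"
      if "F \<in> Ob (ihom A B)" "F' \<in> Ob (ihom A B)" for F F'
      using mt_post_ten[OF _ _ assms(2), of A F F'] that by simp
  qed (auto intro!: smt_eqI[where X = "Ob A"] simp: G.FTen_nat' G.F_Asc G.F_Lun G.F_Run G.F_Sym,
      auto simp: post_def)
qed

lemma mt_post_functor:
  assumes "symmetric_picard A" "monoidal_transformation B C \<tau>"
  shows "monoidal_transformation (ihom A B) (ihom A C) (FAr (post_functor A B C) \<tau>)"
proof -
  interpret A: symmetric_picard A by fact
  interpret \<tau>: monoidal_transformation B C \<tau> by fact
  note B = \<tau>.S.A.symmetric_picard_axioms and C = \<tau>.S.B.symmetric_picard_axioms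
  note [simp] = symmetric_monoidal_functor.F_ob[of A B] monoidal_transformation.cpt_ar[of A B]
    smf_tensor smf_unit[OF assms(1) B] mt_idn mt_cmp mt_tenA mt_asc mt_unitors mt_sym
    monoidal_transformation.src_smf[of A B] monoidal_transformation.trg_smf[of A B]
  show ?thesis
    by (rule monoidal_transformationI)
      (auto intro!: smt_eqI[where X = "Ob A"] smf_post assms \<tau>.src_smf \<tau>.trg_smf whisker_functor_right
        simp: assms \<tau>.cpt_nat' \<tau>.cpt_Ten \<tau>.cpt_Unt)
qed

text \<open>This equation and \<open>post_tensor\<close> are what gives the identity constraints of
  \<open>post_functor\<close> the right source and target.\<close>

lemma post_unit:
  assumes "symmetric_picard A" "symmetric_picard B" "symmetric_picard C"
  shows "post A B C (unit_smf B C) = unit_smf (ihom A B) (ihom A C)"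
proof -
  note [simp] = smf_tensor smf_unit[OF assms(1,2)] smf_unit[OF assms(2,3)] smf_unit[OF assms(1,3)]
    monoidal_transformation.src_smf[of A B] monoidal_transformation.trg_smf[of A B]
    comp_unit_smf[OF _ assms(3)] monoidal_transformation.cpt_ar[of A B] symmetric_monoidal_functor.F_ob[of A B]
  show ?thesis
    by (rule smf_eqI)
      (auto intro!: smf_post smf_unit symmetric_picard_ihom assms smt_eqI[where X = "Ob A"])
qed

lemma post_tensor:
  assumes "symmetric_picard A" "symmetric_monoidal_functor B C G" "symmetric_monoidal_functor B C G'"
  shows "post A B C (tensor_smf B C G G') = tensor_smf (ihom A B) (ihom A C) (post A B C G) (post A B C G')"
proof -
  interpret A: symmetric_picard A by fact
  interpret G: symmetric_monoidal_functor B C G by fact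
  note B = G.A.symmetric_picard_axioms and C = G.B.symmetric_picard_axioms
  note [simp] = smf_tensor smf_unit[OF assms(1) B] smf_unit[OF assms(1) C] smf_comp[where B = B]
    monoidal_transformation.src_smf[of A B] monoidal_transformation.trg_smf[of A B]
    comp_tensor_smf[OF _ assms(2,3)] monoidal_transformation.cpt_ar[of A B] symmetric_monoidal_functor.F_ob[of A B]
    ihom_Interchange mt_unitors
  show ?thesis
  proof (rule smf_eqI)
    show "symmetric_monoidal_functor (ihom A B) (ihom A C) (post A B C (tensor_smf B C G G'))"
      "symmetric_monoidal_functor (ihom A B) (ihom A C) (tensor_smf (ihom A B) (ihom A C) (post A B C G) (post A B C G'))"
      by (intro smf_post smf_tensor assms)+
  next
    fix F F' assume "F \<in> Ob (ihom A B)" "F' \<in> Ob (ihom A B)"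
    then have [simp]: "symmetric_monoidal_functor A B F" "symmetric_monoidal_functor A B F'" by auto
    show "FTen (post A B C (tensor_smf B C G G')) F F' =
        FTen (tensor_smf (ihom A B) (ihom A C) (post A B C G) (post A B C G')) F F'"
    proof (rule smt_eqI[where X = "Ob A"])
      show "Src (FTen (post A B C (tensor_smf B C G G')) F F') =
          Src (FTen (tensor_smf (ihom A B) (ihom A C) (post A B C G) (post A B C G')) F F')"
        by (simp add: assms Interchange_def)
    qed (auto simp: assms)
  qed (auto simp: assms comp_unit_smf intro!: smt_eqI[where X = "Ob A"])
qed

section \<open>Strictness of precomposition and postcomposition\<close>

lemma strict_arrowI:
  assumes "symmetric_monoidal_functor A B F" "FOb F (Unt A) = Unt B" "FUnt F = Idn B (Unt B)"
    "\<And>a b. \<lbrakk>a \<in> Ob A; b \<in> Ob A\<rbrakk> \<Longrightarrow> FOb F (a \<otimes>\<^bsub>A\<^esub> b) = FOb F a \<otimes>\<^bsub>B\<^esub> FOb F b"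
    "\<And>a b. \<lbrakk>a \<in> Ob A; b \<in> Ob A\<rbrakk> \<Longrightarrow> FTen F a b = Idn B (FOb F a \<otimes>\<^bsub>B\<^esub> FOb F b)"
    "\<And>a. a \<in> Ob A \<Longrightarrow> FOb F (Dual A a) = Dual B (FOb F a)"
    "\<And>a. a \<in> Ob A \<Longrightarrow> FAr F (Jay A a) = Jay B (FOb F a)"
  shows "strict_arrow A B F"
  by (intro strict_arrow.intro strict_arrow_axioms.intro assms)

text \<open>A dual of a functor is determined by its values on objects and its \<open>j\<close>.
  Whiskering the \<open>j\<close> of \<open>G\<close> with \<open>F\<close> exhibits the left side
  as a dual of the composite.\<close>

lemma comp_dual_smf:
  assumes "symmetric_monoidal_functor A B F" "symmetric_monoidal_functor B C G"
  shows "comp_smf A C (dual_smf B C G) F = dual_smf A C (comp_smf A C G F)"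
proof -
  interpret F: symmetric_monoidal_functor A B F by fact
  interpret G: symmetric_monoidal_functor B C G by fact
  have "monoidal_transformation A C (jay_smt A C (comp_smf A C (dual_smf B C G) F) (comp_smf A C G F))"
    using whisker_functor_right[OF dual_smf(3)[OF assms(2)] assms(1)]
    by (simp add: comp_unit_smf[OF assms(1) G.B.symmetric_picard_axioms] comp_tensor_smf[OF assms(1) dual_smf(1) assms(2)]
        assms jay_smt_def cong: restrict_cong)
  then show ?thesis
    by (intro dual_smf_eqI[symmetric] smf_comp[OF assms(1)] assms dual_smf) (auto simp: assms dual_smf)
qed

lemma smf_pre:
  assumes "symmetric_monoidal_functor A B F" "symmetric_picard C"
  shows "symmetric_monoidal_functor (ihom B C) (ihom A C) (pre A B C F)"
proof -
  interpret F: symmetric_monoidal_functor A B F by fact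
  interpret C: symmetric_picard C by fact
  note A = F.A.symmetric_picard_axioms and B = F.B.symmetric_picard_axioms
  note [simp] = symmetric_monoidal_functor.F_ob[of B C] monoidal_transformation.cpt_ar[of B C]
    smf_tensor smf_unit[OF B assms(2)] smf_unit[OF A assms(2)] mt_idn mt_cmp mt_tenA mt_asc mt_unitors mt_sym
    monoidal_transformation.src_smf[of B C] monoidal_transformation.trg_smf[of B C]
    smf_comp[OF assms(1)] whisker_functor_right[OF _ assms(1)] comp_tensor_smf[OF assms(1)] comp_unit_smf[OF assms]
  show ?thesis
  proof (rule symmetric_monoidal_functorI)
    show "symmetric_picard (ihom B C)" "symmetric_picard (ihom A C)"
      by (intro symmetric_picard_ihom assms A B)+
  qed (auto intro!: smt_eqI[where X = "Ob A"], auto simp: pre_def)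
qed

lemma strict_pre:
  assumes "symmetric_monoidal_functor A B F" "symmetric_picard C"
  shows "strict_arrow (ihom B C) (ihom A C) (pre A B C F)"
proof -
  interpret F: symmetric_monoidal_functor A B F by fact
  note A = F.A.symmetric_picard_axioms and B = F.B.symmetric_picard_axioms
  show ?thesis
    by (rule strict_arrowI[OF smf_pre[OF assms]])
      (auto simp: smf_unit[OF B assms(2)] comp_unit_smf[OF assms] comp_tensor_smf[OF assms(1)] smf_tensor
        comp_dual_smf[OF assms(1)] dual_smf intro!: smt_eqI[where X = "Ob A"])
qed

text \<open>Strictness of \<open>G\<close> makes composition with \<open>G\<close> commute with
  \<open>unit_smf\<close>, \<open>tensor_smf\<close> and \<open>dual_smf\<close>. For the tensor
  product, the interchange isomorphisms in the constraints are matched by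
  \<open>F_Interchange\<close>, in which the constraints of \<open>G\<close> have become
  identities.\<close>

lemma strict_post:
  assumes "symmetric_picard A" "strict_arrow B C G"
  shows "strict_arrow (ihom A B) (ihom A C) (post A B C G)"
proof -
  interpret G: strict_arrow B C G by fact
  have smf: "symmetric_monoidal_functor B C G" by unfold_locales
  note B = G.A.symmetric_picard_axioms and C = G.B.symmetric_picard_axioms
  note comp = smf_comp[OF _ smf]
  have unit: "comp_smf A C G (unit_smf A B) = unit_smf A C"
  proof (rule smf_eqI)
    have "FAr G (Lun B (Unt B)) = Lun C (Unt C)"
      using G.F_Lun[of "Unt B"] by (simp add: G.strict_FTen G.strict_Ten G.strict_Unt G.strict_FUnt)
    then show "FTen (comp_smf A C G (unit_smf A B)) a b = FTen (unit_smf A C) a b" if "a \<in> Ob A" "b \<in> Ob A" for a b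
      using that by (simp add: G.strict_FTen G.strict_Unt)
  qed (auto intro!: comp smf_unit assms B C simp: G.strict_Unt G.strict_FUnt)
  have tensor: "comp_smf A C G (tensor_smf A B F F') = tensor_smf A C (comp_smf A C G F) (comp_smf A C G F')"
    if "symmetric_monoidal_functor A B F" "symmetric_monoidal_functor A B F'" for F F'
  proof (rule smf_eqI)
    interpret F: symmetric_monoidal_functor A B F by fact
    interpret F': symmetric_monoidal_functor A B F' by fact
    have TenA: "FAr G (f \<odot>\<^bsub>B\<^esub> g) = FAr G f \<odot>\<^bsub>C\<^esub> FAr G g" if "f \<in> Ar B" "g \<in> Ar B" for f g
      using that G.FTen_nat'[of f g "Cod B f" "Cod B g"] by (simp add: G.strict_FTen G.strict_Ten)
    show "FAr (comp_smf A C G (tensor_smf A B F F')) f = FAr (tensor_smf A C (comp_smf A C G F) (comp_smf A C G F')) f"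
      if "f \<in> Ar A" for f using that by (simp add: TenA)
    show "FTen (comp_smf A C G (tensor_smf A B F F')) a b =
        FTen (tensor_smf A C (comp_smf A C G F) (comp_smf A C G F')) a b"
      if [simp]: "a \<in> Ob A" "b \<in> Ob A" for a b
      using G.F_Interchange[of "FOb F a" "FOb F' a" "FOb F b" "FOb F' b"]
      by (simp add: TenA G.strict_FTen G.strict_Ten)
    have "FAr G (Lun B (Unt B)) = Lun C (Unt C)"
      using G.F_Lun[of "Unt B"] by (simp add: G.strict_FTen G.strict_Ten G.strict_Unt G.strict_FUnt)
    then show "FUnt (comp_smf A C G (tensor_smf A B F F')) = FUnt (tensor_smf A C (comp_smf A C G F) (comp_smf A C G F'))"
      by (simp add: TenA G.strict_Unt G.strict_FUnt)
  qed (use that in \<open>auto intro!: comp smf_tensor simp: G.strict_Ten symmetric_monoidal_functor.F_ob\<close>)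
  have dual: "comp_smf A C G (dual_smf A B F) = dual_smf A C (comp_smf A C G F)"
    if F: "symmetric_monoidal_functor A B F" for F
  proof -
    have "monoidal_transformation A C (jay_smt A C (comp_smf A C G (dual_smf A B F)) (comp_smf A C G F))"
      using whisker_functor_left[OF dual_smf(3)[OF F] smf] F
      by (simp add: unit tensor dual_smf jay_smt_def G.strict_Jay symmetric_monoidal_functor.F_ob[OF F] cong: restrict_cong)
    then show ?thesis
      by (intro dual_smf_eqI[symmetric] comp F dual_smf)
        (auto simp: F dual_smf G.strict_Dual symmetric_monoidal_functor.F_ob[OF F])
  qed
  note ob = symmetric_monoidal_functor.F_ob[of A B]
  show ?thesis
    by (rule strict_arrowI[OF smf_post[OF assms(1) smf]])
      (auto simp: smf_unit[OF assms(1) B] smf_tensor unit tensor dual dual_smf ob G.strict_FUnt G.strict_Unt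
        G.strict_FTen G.strict_Ten G.strict_Jay intro!: smt_eqI[where X = "Ob A"])
qed

lemma smf_post_functor:
  assumes "symmetric_picard A" "symmetric_picard B" "symmetric_picard C"
  shows "symmetric_monoidal_functor (ihom B C) (ihom (ihom A B) (ihom A C)) (post_functor A B C)"
proof -
  note [simp] = symmetric_monoidal_functor.F_ob[of B C] monoidal_transformation.cpt_ar[of B C]
    symmetric_monoidal_functor.F_ob[of A B]
    smf_tensor smf_unit[OF assms(2,3)] smf_unit[OF assms(1,3)] mt_idn mt_cmp mt_tenA mt_asc mt_unitors mt_sym
    monoidal_transformation.src_smf[of B C] monoidal_transformation.trg_smf[of B C]
    post_tensor[OF assms(1)] post_unit[OF assms]
    smf_post[OF assms(1)] comp_tensor_smf comp_unit_smf[OF _ assms(3)]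
    smf_unit[OF symmetric_picard_ihom[OF assms(1,2)] symmetric_picard_ihom[OF assms(1,3)]] smf_comp[where B = B]
  interpret C: symmetric_picard C by fact
  show ?thesis
  proof (rule symmetric_monoidal_functorI)
    show "symmetric_picard (ihom B C)" "symmetric_picard (ihom (ihom A B) (ihom A C))"
      by (intro symmetric_picard_ihom assms)+
    show "FAr (post_functor A B C) \<tau> \<in> Ar (ihom (ihom A B) (ihom A C)) \<and>
        Dom (ihom (ihom A B) (ihom A C)) (FAr (post_functor A B C) \<tau>) = FOb (post_functor A B C) (Dom (ihom B C) \<tau>) \<and>
        Cod (ihom (ihom A B) (ihom A C)) (FAr (post_functor A B C) \<tau>) = FOb (post_functor A B C) (Cod (ihom B C) \<tau>)"
      if "\<tau> \<in> Ar (ihom B C)" for \<tau>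
      using mt_post_functor[OF assms(1), of B C \<tau>] that by simp
  qed (auto intro!: smt_eqI[where X = "Ob (ihom A B)"] smt_eqI[where X = "Ob A"], auto simp: post_functor_def)
qed

text \<open>For duals: the value of \<open>post_functor\<close> at the \<open>j\<close> of
  \<open>G\<close> has the shape of a \<open>j\<close> for \<open>post A B C G\<close>, and it is a
  monoidal transformation by \<open>mt_post_functor\<close>. Uniqueness of duals then
  applies.\<close>

lemma strict_post_functor:
  assumes "symmetric_picard A" "symmetric_picard B" "symmetric_picard C"
  shows "strict_arrow (ihom B C) (ihom (ihom A B) (ihom A C)) (post_functor A B C)"
proof -
  note [simp] = smf_tensor smf_unit[OF assms(2,3)] post_tensor[OF assms(1)] post_unit[OF assms]
    dual_smf[of B C] smf_post[OF assms(1)]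
  have dual: "post A B C (dual_smf B C G) = dual_smf (ihom A B) (ihom A C) (post A B C G)"
    if [simp]: "symmetric_monoidal_functor B C G" for G
  proof -
    have "FAr (post_functor A B C) (jay_smt B C (dual_smf B C G) G) =
        jay_smt (ihom A B) (ihom A C) (post A B C (dual_smf B C G)) (post A B C G)"
      by (rule smt_eqI[where X = "Ob (ihom A B)"])
        (auto simp: comp_unit_smf[OF _ assms(3)] comp_tensor_smf comp_dual_smf smf_comp[where B = B]
          symmetric_monoidal_functor.F_ob[of A B] intro!: smt_eqI[where X = "Ob A"])
    with mt_post_functor[OF assms(1) dual_smf(3)[OF that]]
    have "monoidal_transformation (ihom A B) (ihom A C)
        (jay_smt (ihom A B) (ihom A C) (post A B C (dual_smf B C G)) (post A B C G))"
      by simp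
    then show ?thesis
      by (intro dual_smf_eqI[symmetric]) (auto simp: comp_dual_smf)
  qed
  show ?thesis
    by (rule strict_arrowI[OF smf_post_functor[OF assms]])
      (auto intro!: smt_eqI[where X = "Ob (ihom A B)"] smt_eqI[where X = "Ob A"]
        simp: dual comp_unit_smf[OF _ assms(3)] comp_tensor_smf comp_dual_smf smf_comp[where B = B]
          symmetric_monoidal_functor.F_ob[of A B])
qed

lemma strict_comp:
  assumes "strict_arrow A B F" "strict_arrow B C G"
  shows "strict_arrow A C (comp_smf A C G F)"
proof -
  interpret F: strict_arrow A B F by fact
  interpret G: strict_arrow B C G by fact
  have "symmetric_monoidal_functor A C (comp_smf A C G F)"
    by (rule smf_comp[where B = B]) unfold_locales
  then show ?thesis
    by (rule strict_arrowI)
      (auto simp: F.strict_Unt F.strict_FUnt F.strict_Ten F.strict_FTen F.strict_Dual F.strict_Jay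
        G.strict_Unt G.strict_FUnt G.strict_Ten G.strict_FTen G.strict_Dual G.strict_Jay)
qed

section \<open>Transformations out of the free category\<close>

lemma \<I>_Inv [simp]: "iwf t \<Longrightarrow> Inv \<I> (icls t) = icls (TInv t)"
proof -
  interpret I: symmetric_picard \<I> by (rule symmetric_picard_\<I>)
  show "iwf t \<Longrightarrow> Inv \<I> (icls t) = icls (TInv t)" by (intro I.Inv_eq \<I>_inverse)
qed

lemma icls_ar [simp]: "iwf t \<Longrightarrow> icls t \<in> Ar \<I>"
  by (auto simp: \<I>_Ar)

text \<open>The value at \<open>IDual x\<close> is forced by naturality at \<open>j\<^sub>x\<close>.\<close>

primrec free_cpt :: "('o, 'a) spc \<Rightarrow> (iobj, iterm set, 'o, 'a) smf \<Rightarrow> (iobj, iterm set, 'o, 'a) smf \<Rightarrow>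
    'a \<Rightarrow> iobj \<Rightarrow> 'a" where
  "free_cpt B S T f \<star> = f"
| "free_cpt B S T f IUnt = FUnt T \<cdot>\<^bsub>B\<^esub> Inv B (FUnt S)"
| "free_cpt B S T f (ITen x y) =
    FTen T x y \<cdot>\<^bsub>B\<^esub> (free_cpt B S T f x \<odot>\<^bsub>B\<^esub> free_cpt B S T f y) \<cdot>\<^bsub>B\<^esub> Inv B (FTen S x y)"
| "free_cpt B S T f (IDual x) = (SOME g. g \<in> Hom B (FOb S (IDual x)) (FOb T (IDual x)) \<and>
    g \<odot>\<^bsub>B\<^esub> free_cpt B S T f x = Inv B (FTen T (IDual x) x) \<cdot>\<^bsub>B\<^esub> FAr T (icls (TJay x)) \<cdot>\<^bsub>B\<^esub> FUnt T \<cdot>\<^bsub>B\<^esub>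
      Inv B (FUnt S) \<cdot>\<^bsub>B\<^esub> Inv B (FAr S (icls (TJay x))) \<cdot>\<^bsub>B\<^esub> FTen S (IDual x) x)"

text \<open>The components are indexed by objects, so the congruence on terms imposes no condition
  on them: naturality is checked by induction on a representing term. For the associator, the unit
  isomorphisms and the symmetry, the constraints of \<open>S\<close> are cancelled on the right,
  which leaves the axioms of \<open>S\<close> and \<open>T\<close> for that arrow.\<close>

lemma free_transformation:
  fixes B (structure)
  assumes "symmetric_monoidal_functor \<I> B S" "symmetric_monoidal_functor \<I> B T"
    and f: "f \<in> Hom B (FOb S \<star>) (FOb T \<star>)"
  shows "\<exists>\<sigma>. monoidal_transformation \<I> B \<sigma> \<and> Src \<sigma> = S \<and> Trg \<sigma> = T \<and> cpt \<sigma> \<star> = f"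
proof -
  interpret S: symmetric_monoidal_functor \<I> B S by fact
  interpret T: symmetric_monoidal_functor \<I> B T by fact
  let ?c = "free_cpt B S T f"
  have jay [simp]: "FAr S (icls (TJay x)) \<in> Ar B" "Dom B (FAr S (icls (TJay x))) = FOb S IUnt"
    "Cod B (FAr S (icls (TJay x))) = FOb S (ITen (IDual x) x)"
    "FAr T (icls (TJay x)) \<in> Ar B" "Dom B (FAr T (icls (TJay x))) = FOb T IUnt"
    "Cod B (FAr T (icls (TJay x))) = FOb T (ITen (IDual x) x)" for x
    using S.F_ar[of "icls (TJay x)"] T.F_ar[of "icls (TJay x)"] by auto
  have [simp]: "FOb S x \<in> Ob B" "FOb T x \<in> Ob B" for x by auto
  have [simp]: "FTen S x y \<in> Ar B" "Dom B (FTen S x y) = FOb S x \<otimes> FOb S y" "Cod B (FTen S x y) = FOb S (ITen x y)"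
    "FTen T x y \<in> Ar B" "Dom B (FTen T x y) = FOb T x \<otimes> FOb T y" "Cod B (FTen T x y) = FOb T (ITen x y)" for x y
    using S.FTen_ar[of x y] T.FTen_ar[of x y] by auto
  have [simp]: "Cod B (FUnt S) = FOb S IUnt" "Cod B (FUnt T) = FOb T IUnt"
    using S.FUnt_ar T.FUnt_ar by auto
  \<comment> \<open>\<open>tenA_ex\<close> supplies the arrow chosen by \<open>SOME\<close>; it asks
    that the component at \<open>x\<close> be an arrow of the right type, hence the premise.\<close>
  have dual: "?c (IDual x) \<in> Hom B (FOb S (IDual x)) (FOb T (IDual x)) \<and>
      ?c (IDual x) \<odot> ?c x = Inv B (FTen T (IDual x) x) \<cdot> FAr T (icls (TJay x)) \<cdot> FUnt T \<cdot>
      Inv B (FUnt S) \<cdot> Inv B (FAr S (icls (TJay x))) \<cdot> FTen S (IDual x) x"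
    if "?c x \<in> Ar B \<and> Dom B (?c x) = FOb S x \<and> Cod B (?c x) = FOb T x" for x
    unfolding free_cpt.simps by (rule someI_ex, rule S.B.tenA_ex) (use that in auto)
  have c: "?c x \<in> Ar B \<and> Dom B (?c x) = FOb S x \<and> Cod B (?c x) = FOb T x" for x
  proof (induction x)
    case Gen
    then show ?case using f by (auto simp: Hom_def)
  next
    case (IDual x)
    from dual[OF IDual] show ?case by (auto simp: Hom_def)
  qed auto
  then have [simp]: "?c x \<in> Ar B" "Dom B (?c x) = FOb S x" "Cod B (?c x) = FOb T x" for x by auto
  have ten: "?c (ITen x y) \<cdot> FTen S x y = FTen T x y \<cdot> (?c x \<odot> ?c y)" for x y by simp
  have unt: "?c IUnt \<cdot> FUnt S = FUnt T" by simp
  have [simp]: "FAr S (icls t) \<in> Ar B" "Dom B (FAr S (icls t)) = FOb S (idom t)" "Cod B (FAr S (icls t)) = FOb S (icod t)"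
    "FAr T (icls t) \<in> Ar B" "Dom B (FAr T (icls t)) = FOb T (idom t)" "Cod B (FAr T (icls t)) = FOb T (icod t)"
    if "iwf t" for t
    using S.F_ar[of "icls t"] T.F_ar[of "icls t"] that by auto
  have nat: "iwf t \<Longrightarrow> ?c (icod t) \<cdot> FAr S (icls t) = FAr T (icls t) \<cdot> ?c (idom t)" for t
  proof (induction t)
    case (TId x)
    then show ?case using S.F_idn'[of x] T.F_idn'[of x] by simp
  next
    case (TCmp t s)
    then have "FAr S (icls (TCmp t s)) = FAr S (icls t) \<cdot> FAr S (icls s)"
      "FAr T (icls (TCmp t s)) = FAr T (icls t) \<cdot> FAr T (icls s)"
      using S.F_cmp'[of "icls s" "icls t"] T.F_cmp'[of "icls s" "icls t"] by auto
    with TCmp S.B.chain[OF TCmp.IH(1)] show ?case by simp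
  next
    case (TInv t)
    then have inv: "FAr S (icls (TInv t)) = Inv B (FAr S (icls t))" "FAr T (icls (TInv t)) = Inv B (FAr T (icls t))"
      using S.F_inv[of "icls t"] T.F_inv[of "icls t"] by auto
    have "FAr T (icls t) \<cdot> (?c (idom t) \<cdot> Inv B (FAr S (icls t))) =
        FAr T (icls t) \<cdot> (Inv B (FAr T (icls t)) \<cdot> ?c (icod t))"
      using TInv.prems S.B.chain[OF TInv.IH[symmetric], of "Inv B (FAr S (icls t))"] by simp
    then have "?c (idom t) \<cdot> Inv B (FAr S (icls t)) = Inv B (FAr T (icls t)) \<cdot> ?c (icod t)"
      by (rule S.B.cancel_left) (use TInv.prems in auto)
    then show ?case by (simp add: inv)
  next
    case (TTen t s)
    then have [simp]: "iwf t" "iwf s" by auto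
    show ?case
    proof (rule S.B.cancel_right[of _ "FTen S (idom t) (idom s)"])
      have S: "FAr S (icls (TTen t s)) \<cdot> FTen S (idom t) (idom s) =
          FTen S (icod t) (icod s) \<cdot> (FAr S (icls t) \<odot> FAr S (icls s))"
        using S.FTen_nat'[of "icls t" "icls s" "icod t" "icod s"] by simp
      have T: "FAr T (icls (TTen t s)) \<cdot> FTen T (idom t) (idom s) =
          FTen T (icod t) (icod s) \<cdot> (FAr T (icls t) \<odot> FAr T (icls s))"
        using T.FTen_nat'[of "icls t" "icls s" "icod t" "icod s"] by simp
      show "(?c (icod (TTen t s)) \<cdot> FAr S (icls (TTen t s))) \<cdot> FTen S (idom t) (idom s) =
          (FAr T (icls (TTen t s)) \<cdot> ?c (idom (TTen t s))) \<cdot> FTen S (idom t) (idom s)"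
        using TTen.IH by (simp add: S S.B.chain[OF T] S.B.merge)
    qed (use TTen.prems in auto)
  next
    case (TAsc x y z)
    \<comment> \<open>The constraint of \<open>S\<close> for three factors. It is invertible, so the
      square may be compared after composing with it.\<close>
    let ?k = "FTen S (ITen x y) z \<cdot> (FTen S x y \<odot> Idn B (FOb S z))"
    have c3: "?c (ITen x (ITen y z)) \<cdot> FTen S x (ITen y z) \<cdot> (Idn B (FOb S x) \<odot> FTen S y z) =
        FTen T x (ITen y z) \<cdot> (Idn B (FOb T x) \<odot> FTen T y z) \<cdot> (?c x \<odot> (?c y \<odot> ?c z))"
      by (simp add: S.B.merge S.B.merge_chain)
    have d3: "?c (ITen (ITen x y) z) \<cdot> FTen S (ITen x y) z \<cdot> (FTen S x y \<odot> Idn B (FOb S z)) =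
        FTen T (ITen x y) z \<cdot> (FTen T x y \<odot> Idn B (FOb T z)) \<cdot> ((?c x \<odot> ?c y) \<odot> ?c z)"
      by (simp add: S.B.merge S.B.merge_chain)
    have "(?c (ITen x (ITen y z)) \<cdot> FAr S (icls (TAsc x y z))) \<cdot> ?k = ?c (ITen x (ITen y z)) \<cdot>
        FTen S x (ITen y z) \<cdot> (Idn B (FOb S x) \<odot> FTen S y z) \<cdot> Asc B (FOb S x) (FOb S y) (FOb S z)"
      using S.F_Asc[of x y z] by (simp del: free_cpt.simps)
    also have "\<dots> = (?c (ITen x (ITen y z)) \<cdot> FTen S x (ITen y z) \<cdot> (Idn B (FOb S x) \<odot> FTen S y z)) \<cdot>
        Asc B (FOb S x) (FOb S y) (FOb S z)"
      by (simp del: free_cpt.simps)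
    also have "\<dots> = (FTen T x (ITen y z) \<cdot> (Idn B (FOb T x) \<odot> FTen T y z) \<cdot>
        Asc B (FOb T x) (FOb T y) (FOb T z)) \<cdot> ((?c x \<odot> ?c y) \<odot> ?c z)"
      unfolding c3 by (simp add: S.B.asc_nat del: free_cpt.simps)
    also have "\<dots> = FAr T (icls (TAsc x y z)) \<cdot> (FTen T (ITen x y) z \<cdot> (FTen T x y \<odot> Idn B (FOb T z)) \<cdot>
        ((?c x \<odot> ?c y) \<odot> ?c z))"
      using T.F_Asc[of x y z, symmetric] by (simp del: free_cpt.simps)
    also have "\<dots> = (FAr T (icls (TAsc x y z)) \<cdot> ?c (ITen (ITen x y) z)) \<cdot> ?k"
      unfolding d3[symmetric] by (simp del: free_cpt.simps)
    finally have "?c (ITen x (ITen y z)) \<cdot> FAr S (icls (TAsc x y z)) =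
        FAr T (icls (TAsc x y z)) \<cdot> ?c (ITen (ITen x y) z)"
      by (rule S.B.cancel_right) (auto simp del: free_cpt.simps)
    then show ?case by (simp del: free_cpt.simps)
  next
    case (TLun x)
    have S: "FAr S (icls (TLun x)) \<cdot> FTen S IUnt x \<cdot> (FUnt S \<odot> Idn B (FOb S x)) = Lun B (FOb S x)"
      using S.F_Lun[of x] by simp
    have T: "FAr T (icls (TLun x)) \<cdot> FTen T IUnt x \<cdot> (FUnt T \<odot> Idn B (FOb T x)) = Lun B (FOb T x)"
      using T.F_Lun[of x] by simp
    have "(?c x \<cdot> FAr S (icls (TLun x))) \<cdot> (FTen S IUnt x \<cdot> (FUnt S \<odot> Idn B (FOb S x))) =
        Lun B (FOb T x) \<cdot> (Idn B (Unt B) \<odot> ?c x)"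
      by (simp add: S S.B.lun_nat)
    also have "\<dots> = FAr T (icls (TLun x)) \<cdot> FTen T IUnt x \<cdot> (FUnt T \<odot> ?c x)"
      unfolding T[symmetric] by (simp add: S.B.merge)
    also have "\<dots> = (FAr T (icls (TLun x)) \<cdot> ?c (ITen IUnt x)) \<cdot> (FTen S IUnt x \<cdot> (FUnt S \<odot> Idn B (FOb S x)))"
      by (simp add: S.B.merge)
    finally have "?c x \<cdot> FAr S (icls (TLun x)) = FAr T (icls (TLun x)) \<cdot> ?c (ITen IUnt x)"
      by (rule S.B.cancel_right) (auto simp del: free_cpt.simps)
    then show ?case by (simp del: free_cpt.simps)
  next
    case (TRun x)
    have S: "FAr S (icls (TRun x)) \<cdot> FTen S x IUnt \<cdot> (Idn B (FOb S x) \<odot> FUnt S) = Run B (FOb S x)"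
      using S.F_Run[of x] by simp
    have T: "FAr T (icls (TRun x)) \<cdot> FTen T x IUnt \<cdot> (Idn B (FOb T x) \<odot> FUnt T) = Run B (FOb T x)"
      using T.F_Run[of x] by simp
    have "(?c x \<cdot> FAr S (icls (TRun x))) \<cdot> (FTen S x IUnt \<cdot> (Idn B (FOb S x) \<odot> FUnt S)) =
        Run B (FOb T x) \<cdot> (?c x \<odot> Idn B (Unt B))"
      by (simp add: S S.B.run_nat)
    also have "\<dots> = FAr T (icls (TRun x)) \<cdot> FTen T x IUnt \<cdot> (?c x \<odot> FUnt T)"
      unfolding T[symmetric] by (simp add: S.B.merge)
    also have "\<dots> = (FAr T (icls (TRun x)) \<cdot> ?c (ITen x IUnt)) \<cdot> (FTen S x IUnt \<cdot> (Idn B (FOb S x) \<odot> FUnt S))"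
      by (simp add: S.B.merge)
    finally have "?c x \<cdot> FAr S (icls (TRun x)) = FAr T (icls (TRun x)) \<cdot> ?c (ITen x IUnt)"
      by (rule S.B.cancel_right) (auto simp del: free_cpt.simps)
    then show ?case by (simp del: free_cpt.simps)
  next
    case (TSym x y)
    have S: "FAr S (icls (TSym x y)) \<cdot> FTen S x y = FTen S y x \<cdot> Sym B (FOb S x) (FOb S y)"
      using S.F_Sym[of x y] by simp
    have T: "FAr T (icls (TSym x y)) \<cdot> FTen T x y = FTen T y x \<cdot> Sym B (FOb T x) (FOb T y)"
      using T.F_Sym[of x y] by simp
    have "(?c (ITen y x) \<cdot> FAr S (icls (TSym x y))) \<cdot> FTen S x y =
        (FAr T (icls (TSym x y)) \<cdot> ?c (ITen x y)) \<cdot> FTen S x y"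
      by (simp add: S S.B.sym_nat S.B.chain[OF T])
    then have "?c (ITen y x) \<cdot> FAr S (icls (TSym x y)) = FAr T (icls (TSym x y)) \<cdot> ?c (ITen x y)"
      by (rule S.B.cancel_right) (auto simp del: free_cpt.simps)
    then show ?case by (simp del: free_cpt.simps)
  next
    case (TJay x)
    \<comment> \<open>The component at \<open>IDual x\<close> was chosen to make exactly this square
      commute.\<close>
    have "(?c (ITen (IDual x) x) \<cdot> FTen S (IDual x) x) \<cdot> (Inv B (FTen S (IDual x) x) \<cdot> FAr S (icls (TJay x))) =
        FTen T (IDual x) x \<cdot> (?c (IDual x) \<odot> ?c x) \<cdot> (Inv B (FTen S (IDual x) x) \<cdot> FAr S (icls (TJay x)))"
      unfolding ten by (simp del: free_cpt.simps)
    then have "?c (ITen (IDual x) x) \<cdot> FAr S (icls (TJay x)) =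
        FTen T (IDual x) x \<cdot> (?c (IDual x) \<odot> ?c x) \<cdot> (Inv B (FTen S (IDual x) x) \<cdot> FAr S (icls (TJay x)))"
      by (simp del: free_cpt.simps)
    also have "\<dots> = FAr T (icls (TJay x)) \<cdot> ?c IUnt"
      using dual[OF c, of x] by (simp del: free_cpt.simps(4))
    finally show ?case by (simp del: free_cpt.simps)
  qed
  have "monoidal_transformation \<I> B \<lparr>Src = S, Trg = T, cpt = ?c\<rparr>"
    by (rule monoidal_transformationI)
      (use nat ten unt in \<open>auto simp: \<I>_Ar assms simp del: free_cpt.simps\<close>)
  then show ?thesis
    by (intro exI[of _ "\<lparr>Src = S, Trg = T, cpt = ?c\<rparr>"]) simp
qed

text \<open>
  Uniqueness only needs compatibility with the tensor product, the unit and the arrows \<open>j\<^sub>x\<close>, so it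
  is stated for this part of the data of the source (\<open>so\<close>, \<open>sj\<close>, \<open>sT\<close>, \<open>su\<close>) and of the target.
\<close>

lemma (in symmetric_picard) free_unique:
  fixes so to :: "iobj \<Rightarrow> 'o" and c d :: "iobj \<Rightarrow> 'a"
  assumes ob: "\<And>x. so x \<in> Ob C" "\<And>x. to x \<in> Ob C"
    and s: "\<And>x. sj x \<in> Hom C (so IUnt) (so (ITen (IDual x) x))"
      "\<And>x y. sT x y \<in> Hom C (so x \<otimes> so y) (so (ITen x y))" "su \<in> Hom C (Unt C) (so IUnt)"
    and t: "\<And>x y. tT x y \<in> Hom C (to x \<otimes> to y) (to (ITen x y))"
    and c: "\<And>x. c x \<in> Hom C (so x) (to x)" "\<And>x. c (ITen (IDual x) x) \<cdot> sj x = tj x \<cdot> c IUnt"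
      "\<And>x y. c (ITen x y) \<cdot> sT x y = tT x y \<cdot> (c x \<odot> c y)" "c IUnt \<cdot> su = tu"
    and d: "\<And>x. d x \<in> Hom C (so x) (to x)" "\<And>x. d (ITen (IDual x) x) \<cdot> sj x = tj x \<cdot> d IUnt"
      "\<And>x y. d (ITen x y) \<cdot> sT x y = tT x y \<cdot> (d x \<odot> d y)" "d IUnt \<cdot> su = tu"
    and "c \<star> = d \<star>"
  shows "c x = d x"
proof -
  note [simp] = ob c(1)[THEN Hom_ar(1)] c(1)[THEN Hom_ar(2)] c(1)[THEN Hom_ar(3)]
    d(1)[THEN Hom_ar(1)] d(1)[THEN Hom_ar(2)] d(1)[THEN Hom_ar(3)]
    s(1)[THEN Hom_ar(1)] s(1)[THEN Hom_ar(2)] s(1)[THEN Hom_ar(3)]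
    s(2)[THEN Hom_ar(1)] s(2)[THEN Hom_ar(2)] s(2)[THEN Hom_ar(3)]
    s(3)[THEN Hom_ar(1)] s(3)[THEN Hom_ar(2)] s(3)[THEN Hom_ar(3)]
    t[THEN Hom_ar(1)] t[THEN Hom_ar(2)] t[THEN Hom_ar(3)]
  have unit: "c IUnt = d IUnt"
    by (rule cancel_right[of _ su]) (auto simp: c(4) d(4))
  show ?thesis
  proof (induction x)
    case Gen
    show ?case by fact
  next
    case IUnt
    show ?case by (rule unit)
  next
    case (ITen x y)
    then show ?case
      by (intro cancel_right[of "c (ITen x y)" "sT x y"]) (auto simp: c(3) d(3))
  next
    case (IDual x)
    \<comment> \<open>Compatibility with \<open>sj x\<close> fixes the component at
      \<open>ITen (IDual x) x\<close>, that is, the one at \<open>IDual x\<close> tensored with the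
      one at \<open>x\<close>. The latter is known by induction and is cancelled by faithfulness of
      tensoring.\<close>
    have "c (ITen (IDual x) x) = d (ITen (IDual x) x)"
      by (rule cancel_right[of _ "sj x"]) (auto simp: c(2) d(2) unit)
    then have "tT (IDual x) x \<cdot> (c (IDual x) \<odot> c x) = tT (IDual x) x \<cdot> (d (IDual x) \<odot> d x)"
      by (simp flip: c(3) d(3))
    then have "c (IDual x) \<odot> c x = d (IDual x) \<odot> d x"
      by (rule cancel_left) auto
    then show ?case
      by (intro tenA_faithful[of "c (IDual x)" "c x"]) (auto simp: IDual)
  qed
qed

section \<open>The canonical action and its uniqueness\<close>

lemma act_map:
  assumes "symmetric_picard A"
  shows "strict_arrow \<I> (ihom A A) (act_map A)" "FOb (act_map A) \<star> = id_smf A"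
proof -
  interpret A: symmetric_picard A by fact
  from theI'[OF \<I>_free[OF symmetric_picard_ihom[OF assms assms], of "id_smf A"]]
  show "strict_arrow \<I> (ihom A A) (act_map A)" "FOb (act_map A) \<star> = id_smf A"
    by (auto simp: act_map_def A.smf_id)
qed

lemma act_map_unique:
  assumes "symmetric_picard A" "strict_arrow \<I> (ihom A A) V" "FOb V \<star> = id_smf A"
  shows "V = act_map A"
proof -
  interpret A: symmetric_picard A by fact
  show ?thesis
    using \<I>_free[OF symmetric_picard_ihom[OF assms(1,1)], of "id_smf A"] act_map[OF assms(1)] assms(2,3)
    by (auto simp: A.smf_id)
qed

lemma pre_id:
  assumes "symmetric_picard A" "symmetric_picard C"
  shows "pre A A C (id_smf A) = id_smf (ihom A C)"
proof -
  interpret A: symmetric_picard A by fact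
  interpret AC: symmetric_picard "ihom A C" by (rule symmetric_picard_ihom[OF assms])
  show ?thesis
    by (rule smf_eqI[OF smf_pre[OF A.smf_id assms(2)] AC.smf_id])
      (auto simp: comp_id_smf smf_tensor smf_unit[OF assms] monoidal_transformation.src_smf[of A C]
        monoidal_transformation.trg_smf[of A C] monoidal_transformation.cpt_ext[of A C] intro!: smt_eqI[where X = "Ob A"])
qed

lemma post_id:
  assumes "symmetric_picard A" "symmetric_picard C"
  shows "post A C C (id_smf C) = id_smf (ihom A C)"
proof -
  interpret A: symmetric_picard A by fact
  interpret C: symmetric_picard C by fact
  interpret AC: symmetric_picard "ihom A C" by (rule symmetric_picard_ihom[OF assms])
  show ?thesis
    by (rule smf_eqI[OF smf_post[OF assms(1) C.smf_id] AC.smf_id])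
      (auto simp: comp_id_smf smf_tensor smf_unit[OF assms] monoidal_transformation.src_smf[of A C]
        monoidal_transformation.trg_smf[of A C] monoidal_transformation.cpt_ext[of A C]
        monoidal_transformation.cpt_ar[of A C] symmetric_monoidal_functor.F_ob[of A C] intro!: smt_eqI[where X = "Ob A"])
qed

text \<open>The strictness of \<open>pre\<close>, \<open>post\<close> and
  \<open>post_functor\<close> is applied here. Being an equality of functors, the result lets an
  identity serve as \<open>Beta\<close> of the strict module.\<close>

lemma act_act_eq_mult_act:
  assumes "symmetric_picard A"
  shows "act_act A (act_map A) = mult_act A (act_map A)"
proof -
  let ?AA = "ihom A A" and ?v = "act_map A"
  interpret A: symmetric_picard A by fact
  note AA = symmetric_picard_ihom[OF assms assms] and I = symmetric_picard_\<I>
  interpret v: strict_arrow \<I> ?AA ?v by (rule act_map[OF assms])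
  interpret w: strict_arrow \<I> "ihom \<I> \<I>" "act_map \<I>" by (rule act_map[OF I])
  note IAA = symmetric_picard_ihom[OF I AA]
  have v: "symmetric_monoidal_functor \<I> ?AA ?v" by unfold_locales
  have 1: "strict_arrow \<I> (ihom \<I> ?AA) (act_act A ?v)"
    unfolding act_act_def
    by (intro strict_comp[of \<I> ?AA] strict_comp[of ?AA "ihom ?AA ?AA"] act_map assms strict_post_functor strict_pre v AA)
  have 2: "strict_arrow \<I> (ihom \<I> ?AA) (mult_act A ?v)"
    unfolding mult_act_def
    by (intro strict_comp[of \<I> "ihom \<I> \<I>"] act_map strict_post assms I)
  have "FOb (mult_act A ?v) \<star> = ?v"
    using smf_comp[OF _ v, of \<I> "id_smf \<I>"] comp_id_smf[OF v] v.A.smf_id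
    by (simp add: mult_act_def act_map[OF I])
  moreover have "FOb (act_act A ?v) \<star> = ?v"
  proof -
    show ?thesis
      using smf_post[OF assms A.smf_id] comp_id_smf[OF v]
      by (simp add: act_act_def act_map[OF assms] A.smf_id post_id[OF assms assms])
  qed
  ultimately show ?thesis
    using \<I>_free[OF IAA, of ?v] 1 2 v by auto
qed

section \<open>Modules in components\<close>

text \<open>Strictness of \<open>act_map \<I>\<close> makes \<open>t \<bullet> s\<close> the
  substitution of \<open>s\<close> for \<open>\<star>\<close> in \<open>t\<close>. The other facts
  record further data of the same strict arrow.\<close>

lemma imult_simps [simp]:
  "\<star> \<bullet> s = s" "IUnt \<bullet> s = IUnt" "ITen x y \<bullet> s = ITen (x \<bullet> s) (y \<bullet> s)" "IDual x \<bullet> s = IDual (x \<bullet> s)"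
  and act_map_jay: "cpt (FAr (act_map \<I>) (icls (TJay x))) s = icls (TJay (x \<bullet> s))"
  and act_map_ten: "FTen (act_map \<I>) x y = Idn (ihom \<I> \<I>) (tensor_smf \<I> \<I> (FOb (act_map \<I>) x) (FOb (act_map \<I>) y))"
  and act_map_unt: "FUnt (act_map \<I>) = Idn (ihom \<I> \<I>) (unit_smf \<I> \<I>)"
  and act_map_smf: "symmetric_monoidal_functor \<I> \<I> (FOb (act_map \<I>) x)"
proof -
  interpret v: strict_arrow \<I> "ihom \<I> \<I>" "act_map \<I>" by (rule act_map[OF symmetric_picard_\<I>])
  show smf: "symmetric_monoidal_functor \<I> \<I> (FOb (act_map \<I>) x)" for x
    using v.F_ob[of x] by simp
  show "\<star> \<bullet> s = s" by (simp add: imult_def act_map[OF symmetric_picard_\<I>])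
  show "IUnt \<bullet> s = IUnt" using v.strict_Unt by (simp add: imult_def)
  show "ITen x y \<bullet> s = ITen (x \<bullet> s) (y \<bullet> s)" using v.strict_Ten[of x y] by (simp add: imult_def)
  show "IDual x \<bullet> s = IDual (x \<bullet> s)" using v.strict_Dual[of x] by (simp add: imult_def dual_smf smf)
  show "cpt (FAr (act_map \<I>) (icls (TJay x))) s = icls (TJay (x \<bullet> s))"
    using v.strict_Jay[of x] by (simp add: imult_def)
  show "FTen (act_map \<I>) x y = Idn (ihom \<I> \<I>) (tensor_smf \<I> \<I> (FOb (act_map \<I>) x) (FOb (act_map \<I>) y))"
    using v.strict_FTen[of x y] by simp
  show "FUnt (act_map \<I>) = Idn (ihom \<I> \<I>) (unit_smf \<I> \<I>)"
    using v.strict_FUnt by simp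
qed

text \<open>Together with \<open>act_unt\<close> and \<open>act_jay\<close>, linearity of
  \<open>t \<times> m\<close> in \<open>t\<close>: arrows from
  \<open>(x \<times> m) \<otimes> (y \<times> m)\<close> to
  \<open>(x \<otimes> y) \<times> m\<close>, from the unit to \<open>IUnt \<times> m\<close>, and
  the action of the arrow \<open>j\<close> at \<open>x\<close> on \<open>m\<close>.\<close>

definition act_ten :: "('o, 'a) imod \<Rightarrow> iobj \<Rightarrow> iobj \<Rightarrow> 'o \<Rightarrow> 'a" where
  "act_ten M x y m = cpt (FTen (Act M) x y) m"

definition act_unt :: "('o, 'a) imod \<Rightarrow> 'o \<Rightarrow> 'a" where
  "act_unt M m = cpt (FUnt (Act M)) m"

definition act_jay :: "('o, 'a) imod \<Rightarrow> iobj \<Rightarrow> 'o \<Rightarrow> 'a" where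
  "act_jay M x m = cpt (FAr (Act M) (icls (TJay x))) m"

text \<open>The transformations and axioms of a module are left out, because the component formulas
  are applied to \<open>strict_mod A\<close> before it is known to be a module.\<close>

locale action = U: symmetric_picard "Und M" + Act: symmetric_monoidal_functor \<I> "ihom (Und M) (Und M)" "Act M"
  for M :: "('o, 'a) imod"
begin

abbreviation "U \<equiv> Und M"
abbreviation "UU \<equiv> ihom (Und M) (Und M)"

lemma act_smf [simp]: "symmetric_monoidal_functor U U (FOb (Act M) t)"
  using Act.F_ob[of t] by simp

lemma Act_smf [simp]: "symmetric_monoidal_functor \<I> UU (Act M)"
  by (rule Act.smf_axioms)

lemma act_mt [simp]:
  "iwf t \<Longrightarrow> monoidal_transformation U U (FAr (Act M) (icls t))"
  "iwf t \<Longrightarrow> Src (FAr (Act M) (icls t)) = FOb (Act M) (idom t)"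
  "iwf t \<Longrightarrow> Trg (FAr (Act M) (icls t)) = FOb (Act M) (icod t)"
  using Act.F_ar[of "icls t"] by auto

lemma FTen_act_mt [simp]:
  "monoidal_transformation U U (FTen (Act M) x y)"
  "Src (FTen (Act M) x y) = tensor_smf U U (FOb (Act M) x) (FOb (Act M) y)"
  "Trg (FTen (Act M) x y) = FOb (Act M) (ITen x y)"
  using Act.FTen_ar[of x y] by auto

lemma FUnt_act_mt [simp]:
  "monoidal_transformation U U (FUnt (Act M))"
  "Src (FUnt (Act M)) = unit_smf U U" "Trg (FUnt (Act M)) = FOb (Act M) IUnt"
  using Act.FUnt_ar by auto

lemma act_ob [simp]: "m \<in> Ob U \<Longrightarrow> act_ob M t m \<in> Ob U"
  by (simp add: act_ob_def symmetric_monoidal_functor.F_ob[OF act_smf])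

lemma act_ar [simp]:
  "g \<in> Ar U \<Longrightarrow> act_ar M t g \<in> Ar U" "g \<in> Ar U \<Longrightarrow> Dom U (act_ar M t g) = act_ob M t (Dom U g)"
  "g \<in> Ar U \<Longrightarrow> Cod U (act_ar M t g) = act_ob M t (Cod U g)"
  by (simp_all add: act_ob_def act_ar_def symmetric_monoidal_functor.F_ar[OF act_smf])

lemma act_idn [simp]: "m \<in> Ob U \<Longrightarrow> act_ar M t (Idn U m) = Idn U (act_ob M t m)"
  by (simp add: act_ob_def act_ar_def symmetric_monoidal_functor.F_idn'[OF act_smf])

lemma act_ten [simp]:
  assumes "m \<in> Ob U"
  shows "act_ten M x y m \<in> Ar U" "Dom U (act_ten M x y m) = act_ob M x m \<otimes>\<^bsub>U\<^esub> act_ob M y m"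
    "Cod U (act_ten M x y m) = act_ob M (ITen x y) m"
  using monoidal_transformation.cpt_ar[OF FTen_act_mt(1) assms, of x y] assms
  by (auto simp: act_ten_def act_ob_def)

lemma act_jay [simp]:
  assumes "m \<in> Ob U"
  shows "act_jay M x m \<in> Ar U" "Dom U (act_jay M x m) = act_ob M IUnt m"
    "Cod U (act_jay M x m) = act_ob M (ITen (IDual x) x) m"
  using monoidal_transformation.cpt_ar[OF act_mt(1) assms, of "TJay x"] by (auto simp: act_jay_def act_ob_def)

lemma act_unt [simp]:
  assumes "m \<in> Ob U"
  shows "act_unt M m \<in> Ar U" "Dom U (act_unt M m) = Unt U" "Cod U (act_unt M m) = act_ob M IUnt m"
  using monoidal_transformation.cpt_ar[OF FUnt_act_mt(1) assms] assms by (auto simp: act_unt_def act_ob_def)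

lemma act_ten_nat:
  "\<lbrakk>g \<in> Ar U; Cod U g = m\<rbrakk> \<Longrightarrow> act_ten M x y m \<cdot>\<^bsub>U\<^esub> (act_ar M x g \<odot>\<^bsub>U\<^esub> act_ar M y g) =
    act_ar M (ITen x y) g \<cdot>\<^bsub>U\<^esub> act_ten M x y (Dom U g)"
  using monoidal_transformation.cpt_nat'[OF FTen_act_mt(1), of g m x y] by (simp add: act_ten_def act_ar_def)

lemma act_jay_nat:
  "\<lbrakk>g \<in> Ar U; Cod U g = m\<rbrakk> \<Longrightarrow> act_jay M x m \<cdot>\<^bsub>U\<^esub> act_ar M IUnt g =
    act_ar M (ITen (IDual x) x) g \<cdot>\<^bsub>U\<^esub> act_jay M x (Dom U g)"
  using monoidal_transformation.cpt_nat'[OF act_mt(1), of "TJay x" g m] by (simp add: act_jay_def act_ar_def)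

lemma act_unt_nat:
  "\<lbrakk>g \<in> Ar U; Dom U g = m\<rbrakk> \<Longrightarrow> act_ar M IUnt g \<cdot>\<^bsub>U\<^esub> act_unt M m = act_unt M (Cod U g)"
  using monoidal_transformation.cpt_nat'[OF FUnt_act_mt(1), of g "Cod U g"]
    monoidal_transformation.cpt_ar[OF FUnt_act_mt(1), of "Cod U g"] by (simp add: act_unt_def act_ar_def)

end

sublocale imodule \<subseteq> action M
proof -
  interpret U: symmetric_picard "Und M" by (rule Und)
  interpret Act: symmetric_monoidal_functor \<I> "ihom (Und M) (Und M)" "Act M"
    using Act by simp
  show "action M" by unfold_locales
qed

context action
begin

lemma UU_picard: "symmetric_picard UU"
  by (rule Act.B.symmetric_picard_axioms)

lemma Act_TId [simp]: "FAr (Act M) (icls (TId x)) = Idn UU (FOb (Act M) x)"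
  using Act.F_idn'[of x] by simp

text \<open>For fixed \<open>s\<close> and \<open>m\<close>, linearity of
  \<open>t \<times> (s \<times> m)\<close> in \<open>t\<close> is that of the action at the object
  \<open>s \<times> m\<close>. In \<open>mult_act_simps\<close> the object stays \<open>m\<close>
  and the indices are multiplied by \<open>s\<close>.\<close>

lemma act_act_simps:
  "FOb (FOb (act_act U (Act M)) t) s = comp_smf U U (FOb (Act M) t) (FOb (Act M) s)"
  "m \<in> Ob U \<Longrightarrow> cpt (cpt (FAr (act_act U (Act M)) (icls (TJay x))) s) m = act_jay M x (act_ob M s m)"
  "m \<in> Ob U \<Longrightarrow> cpt (cpt (FTen (act_act U (Act M)) x y) s) m = act_ten M x y (act_ob M s m)"
  "m \<in> Ob U \<Longrightarrow> cpt (cpt (FUnt (act_act U (Act M))) s) m = act_unt M (act_ob M s m)"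
proof -
  note [simp] = smf_post[OF U.symmetric_picard_axioms]
    smf_tensor mt_idn smf_unit[OF U.symmetric_picard_axioms U.symmetric_picard_axioms] smf_unit[OF UU_picard UU_picard]
    symmetric_monoidal_functor.F_ob[OF act_smf] smf_comp[where B = U]
    monoidal_transformation.cpt_ar[OF FTen_act_mt(1)] monoidal_transformation.cpt_ar[OF FUnt_act_mt(1)]
  show "FOb (FOb (act_act U (Act M)) t) s = comp_smf U U (FOb (Act M) t) (FOb (Act M) s)"
    by (simp add: act_act_def)
  assume m: "m \<in> Ob U"
  \<comment> \<open>\<open>FAr (post_functor U U U) \<tau>\<close> is kept folded, so that
    \<open>mt_post_functor\<close> can discharge the premise of the rule for
    \<open>pre\<close>.\<close>
  have pf': "FAr (pre \<I> UU UU (Act M)) (FAr (post_functor U U U) \<tau>) =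
      \<lparr>Src = comp_smf \<I> UU (post U U U (Src \<tau>)) (Act M), Trg = comp_smf \<I> UU (post U U U (Trg \<tau>)) (Act M),
       cpt = (\<lambda>s\<in>Ob \<I>. cpt (FAr (post_functor U U U) \<tau>) (FOb (Act M) s))\<rparr>"
    if "monoidal_transformation U U \<tau>" for \<tau>
    using mt_post_functor[OF U.symmetric_picard_axioms that] pre_simps(2)[of UU UU "FAr (post_functor U U U) \<tau>"] that
    by simp
  show "cpt (cpt (FAr (act_act U (Act M)) (icls (TJay x))) s) m = act_jay M x (act_ob M s m)"
    using m by (simp add: act_act_def pf' act_jay_def act_ob_def del: post_functor_simps(2)) simp
  show "cpt (cpt (FTen (act_act U (Act M)) x y) s) m = act_ten M x y (act_ob M s m)"
    using m by (simp add: act_act_def pf' act_ten_def act_ob_def del: post_functor_simps(2)) simp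
  show "cpt (cpt (FUnt (act_act U (Act M))) s) m = act_unt M (act_ob M s m)"
    using m by (simp add: act_act_def pf' act_unt_def act_ob_def del: post_functor_simps(2)) simp
qed

lemma mult_act_simps:
  "FOb (FOb (mult_act U (Act M)) t) s = FOb (Act M) (t \<bullet> s)"
  "m \<in> Ob U \<Longrightarrow> cpt (cpt (FAr (mult_act U (Act M)) (icls (TJay x))) s) m = act_jay M (x \<bullet> s) m"
  "m \<in> Ob U \<Longrightarrow> cpt (cpt (FTen (mult_act U (Act M)) x y) s) m = act_ten M (x \<bullet> s) (y \<bullet> s) m"
  "m \<in> Ob U \<Longrightarrow> cpt (cpt (FUnt (mult_act U (Act M))) s) m = act_unt M m"
proof -
  interpret v: strict_arrow \<I> "ihom \<I> \<I>" "act_map \<I>" by (rule act_map[OF symmetric_picard_\<I>])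
  have jay [simp]: "monoidal_transformation \<I> \<I> (FAr (act_map \<I>) (icls (TJay x)))" for x
    using v.F_ar[of "icls (TJay x)"] by simp
  note [simp] = act_map_smf act_map_ten act_map_unt act_map_jay smf_tensor mt_idn
    smf_unit[OF symmetric_picard_\<I> symmetric_picard_\<I>] imult_def[symmetric] symmetric_monoidal_functor.F_ob[OF act_smf]
    monoidal_transformation.cpt_ar[OF FTen_act_mt(1)] monoidal_transformation.cpt_ar[OF FUnt_act_mt(1)]
  show "FOb (FOb (mult_act U (Act M)) t) s = FOb (Act M) (t \<bullet> s)"
    by (simp add: mult_act_def)
  assume m: "m \<in> Ob U"
  show "cpt (cpt (FAr (mult_act U (Act M)) (icls (TJay x))) s) m = act_jay M (x \<bullet> s) m"
    using m by (simp add: mult_act_def act_jay_def)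
  have "symmetric_monoidal_functor U U (FOb (Act M) (ITen (x \<bullet> s) (y \<bullet> s)))" "symmetric_monoidal_functor U U (FOb (Act M) IUnt)"
    by (rule act_smf)+
  then show "cpt (cpt (FTen (mult_act U (Act M)) x y) s) m = act_ten M (x \<bullet> s) (y \<bullet> s) m"
    "cpt (cpt (FUnt (mult_act U (Act M))) s) m = act_unt M m"
    using m by (simp_all add: mult_act_def act_ten_def act_unt_def)
qed

end

context imodule
begin

text \<open>The trilinear transformation is peeled one variable at a time: its component at
  \<open>t\<close> is an arrow of \<open>ihom \<I> UU\<close>, whose component at \<open>s\<close>
  is an arrow of \<open>UU\<close>.\<close>

lemma Beta_mt:
  shows "monoidal_transformation \<I> (ihom \<I> UU) (Beta M)"
    "Src (Beta M) = act_act U (Act M)" "Trg (Beta M) = mult_act U (Act M)"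
    "monoidal_transformation \<I> UU (cpt (Beta M) t)"
    "Src (cpt (Beta M) t) = FOb (act_act U (Act M)) t" "Trg (cpt (Beta M) t) = FOb (mult_act U (Act M)) t"
    "monoidal_transformation U U (cpt (cpt (Beta M) t) s)"
    "Src (cpt (cpt (Beta M) t) s) = comp_smf U U (FOb (Act M) t) (FOb (Act M) s)"
    "Trg (cpt (cpt (Beta M) t) s) = FOb (Act M) (t \<bullet> s)"
proof -
  show 1: "monoidal_transformation \<I> (ihom \<I> UU) (Beta M)"
    "Src (Beta M) = act_act U (Act M)" "Trg (Beta M) = mult_act U (Act M)"
    using Beta by auto
  show 2: "monoidal_transformation \<I> UU (cpt (Beta M) t)"
    "Src (cpt (Beta M) t) = FOb (act_act U (Act M)) t" "Trg (cpt (Beta M) t) = FOb (mult_act U (Act M)) t" for t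
    using monoidal_transformation.cpt_ar[OF 1(1), of t] by (auto simp: 1)
  show "monoidal_transformation U U (cpt (cpt (Beta M) t) s)"
    "Src (cpt (cpt (Beta M) t) s) = comp_smf U U (FOb (Act M) t) (FOb (Act M) s)"
    "Trg (cpt (cpt (Beta M) t) s) = FOb (Act M) (t \<bullet> s)"
    using monoidal_transformation.cpt_ar[OF 2(1)[of t], of s] by (auto simp: 2 act_act_simps mult_act_simps)
qed

lemma beta_ar [simp]:
  assumes "m \<in> Ob U"
  shows "beta M t s m \<in> Ar U" "Dom U (beta M t s m) = act_ob M t (act_ob M s m)"
    "Cod U (beta M t s m) = act_ob M (t \<bullet> s) m"
  using monoidal_transformation.cpt_ar[OF Beta_mt(7)[of t s] assms] assms
  by (auto simp: beta_def act_ob_def Beta_mt)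

text \<open>With \<open>beta_ten\<close> and \<open>beta_unt\<close>, this is linearity of
  \<open>beta\<close> in its first variable, in the form that \<open>free_unique\<close> asks
  for.\<close>

lemma beta_jay:
  assumes "m \<in> Ob U"
  shows "beta M (ITen (IDual x) x) s m \<cdot>\<^bsub>U\<^esub> act_jay M x (act_ob M s m) = act_jay M (x \<bullet> s) m \<cdot>\<^bsub>U\<^esub> beta M IUnt s m"
  using arg_cong[OF monoidal_transformation.cpt_nat'[OF Beta_mt(1), of "icls (TJay x)"], where f = "\<lambda>\<sigma>. cpt (cpt \<sigma> s) m"] assms
  by (simp add: Beta_mt act_act_simps mult_act_simps flip: beta_def)

lemma beta_ten:
  assumes "m \<in> Ob U"
  shows "beta M (ITen x y) s m \<cdot>\<^bsub>U\<^esub> act_ten M x y (act_ob M s m) =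
    act_ten M (x \<bullet> s) (y \<bullet> s) m \<cdot>\<^bsub>U\<^esub> (beta M x s m \<odot>\<^bsub>U\<^esub> beta M y s m)"
  using arg_cong[OF monoidal_transformation.cpt_Ten[OF Beta_mt(1), of x y], where f = "\<lambda>\<sigma>. cpt (cpt \<sigma> s) m"] assms
  by (simp add: Beta_mt act_act_simps mult_act_simps flip: beta_def)

lemma beta_unt:
  assumes "m \<in> Ob U"
  shows "beta M IUnt s m \<cdot>\<^bsub>U\<^esub> act_unt M (act_ob M s m) = act_unt M m"
  using arg_cong[OF monoidal_transformation.cpt_Unt[OF Beta_mt(1)], where f = "\<lambda>\<sigma>. cpt (cpt \<sigma> s) m"] assms
  by (simp add: Beta_mt act_act_simps mult_act_simps flip: beta_def)

lemma Gamma_mt: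
  "monoidal_transformation U U (Gamma M)" "Src (Gamma M) = id_smf U" "Trg (Gamma M) = FOb (Act M) \<star>"
  using Gamma by auto

lemma gamma_ar [simp]:
  assumes "m \<in> Ob U"
  shows "gamma M m \<in> Ar U" "Dom U (gamma M m) = m" "Cod U (gamma M m) = act_ob M \<star> m"
  using monoidal_transformation.cpt_ar[OF Gamma_mt(1) assms] assms by (auto simp: gamma_def act_ob_def Gamma_mt)

lemma gamma_nat: "\<lbrakk>g \<in> Ar U; Cod U g = m\<rbrakk> \<Longrightarrow> gamma M m \<cdot>\<^bsub>U\<^esub> g = act_ar M \<star> g \<cdot>\<^bsub>U\<^esub> gamma M (Dom U g)"
  using monoidal_transformation.cpt_nat'[OF Gamma_mt(1), of g m] by (simp add: gamma_def act_ar_def Gamma_mt)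

end

text \<open>An arrow of \<open>SPC\<close> between the underlying categories with no transformation
  given: the setting for existence and uniqueness of a module structure on \<open>H\<close>.\<close>

locale imodule_pair = M: imodule M + N: imodule N for M N :: "('o, 'a) imod" +
  fixes H :: "('o, 'a) lin_map"
  assumes smf_H: "symmetric_monoidal_functor (Und M) (Und N) H"
begin

sublocale H: symmetric_monoidal_functor "Und M" "Und N" H
  by (rule smf_H)

abbreviation "MN \<equiv> ihom (Und M) (Und N)"

lemma MN_picard: "symmetric_picard MN"
  by (intro symmetric_picard_ihom M.Und N.Und)

lemma smf_after: "symmetric_monoidal_functor \<I> MN (act_after M N H)"
  unfolding act_after_def by (rule smf_comp[OF N.Act_smf smf_pre[OF smf_H N.Und]])

lemma smf_before: "symmetric_monoidal_functor \<I> MN (act_before M N H)"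
  unfolding act_before_def by (rule smf_comp[OF M.Act_smf smf_post[OF M.Und smf_H]])

lemma act_after_simps:
  "FOb (act_after M N H) t = comp_smf (Und M) (Und N) (FOb (Act N) t) H"
  "m \<in> Ob (Und M) \<Longrightarrow> cpt (FAr (act_after M N H) (icls (TJay x))) m = act_jay N x (FOb H m)"
  "m \<in> Ob (Und M) \<Longrightarrow> cpt (FTen (act_after M N H) x y) m = act_ten N x y (FOb H m)"
  "m \<in> Ob (Und M) \<Longrightarrow> cpt (FUnt (act_after M N H)) m = act_unt N (FOb H m)"
proof -
  note [simp] = smf_tensor smf_unit[OF N.Und N.Und] symmetric_monoidal_functor.F_ob[OF N.act_smf]
    monoidal_transformation.cpt_ar[OF N.FTen_act_mt(1)] monoidal_transformation.cpt_ar[OF N.FUnt_act_mt(1)]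
  show "FOb (act_after M N H) t = comp_smf (Und M) (Und N) (FOb (Act N) t) H"
    by (simp add: act_after_def)
  assume m: "m \<in> Ob (Und M)"
  show "cpt (FAr (act_after M N H) (icls (TJay x))) m = act_jay N x (FOb H m)"
    "cpt (FTen (act_after M N H) x y) m = act_ten N x y (FOb H m)"
    "cpt (FUnt (act_after M N H)) m = act_unt N (FOb H m)"
    using m by (simp_all add: act_after_def act_jay_def act_ten_def act_unt_def)
qed

lemma act_before_simps:
  "FOb (act_before M N H) t = comp_smf (Und M) (Und N) H (FOb (Act M) t)"
  "m \<in> Ob (Und M) \<Longrightarrow> cpt (FAr (act_before M N H) (icls (TJay x))) m = FAr H (act_jay M x m)"
  "m \<in> Ob (Und M) \<Longrightarrow> cpt (FTen (act_before M N H) x y) m =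
    FAr H (act_ten M x y m) \<cdot>\<^bsub>Und N\<^esub> FTen H (act_ob M x m) (act_ob M y m)"
  "m \<in> Ob (Und M) \<Longrightarrow> cpt (FUnt (act_before M N H)) m = FAr H (act_unt M m) \<cdot>\<^bsub>Und N\<^esub> FUnt H"
proof -
  show "FOb (act_before M N H) t = comp_smf (Und M) (Und N) H (FOb (Act M) t)"
    by (simp add: act_before_def)
  assume m: "m \<in> Ob (Und M)"
  show "cpt (FAr (act_before M N H) (icls (TJay x))) m = FAr H (act_jay M x m)"
    "cpt (FTen (act_before M N H) x y) m =
      FAr H (act_ten M x y m) \<cdot>\<^bsub>Und N\<^esub> FTen H (act_ob M x m) (act_ob M y m)"
    "cpt (FUnt (act_before M N H)) m = FAr H (act_unt M m) \<cdot>\<^bsub>Und N\<^esub> FUnt H"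
    using m by (simp_all add: act_before_def act_jay_def act_ten_def act_unt_def act_ob_def)
qed

definition bilin :: "('o, 'a) bilin_trans \<Rightarrow> bool" where
  "bilin \<delta> \<longleftrightarrow> \<delta> \<in> Hom (ihom \<I> MN) (act_after M N H) (act_before M N H)"

lemma bilin_mt:
  assumes "bilin \<delta>"
  shows "monoidal_transformation \<I> MN \<delta>" "Src \<delta> = act_after M N H" "Trg \<delta> = act_before M N H"
    "monoidal_transformation (Und M) (Und N) (cpt \<delta> t)"
    "Src (cpt \<delta> t) = comp_smf (Und M) (Und N) (FOb (Act N) t) H"
    "Trg (cpt \<delta> t) = comp_smf (Und M) (Und N) H (FOb (Act M) t)"
proof -
  show 1: "monoidal_transformation \<I> MN \<delta>" "Src \<delta> = act_after M N H" "Trg \<delta> = act_before M N H"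
    using assms by (auto simp: bilin_def)
  show "monoidal_transformation (Und M) (Und N) (cpt \<delta> t)"
    "Src (cpt \<delta> t) = comp_smf (Und M) (Und N) (FOb (Act N) t) H"
    "Trg (cpt \<delta> t) = comp_smf (Und M) (Und N) H (FOb (Act M) t)"
    using monoidal_transformation.cpt_ar[OF 1(1), of t] by (auto simp: 1 act_after_simps act_before_simps)
qed

lemma bilin_ar:
  assumes "bilin \<delta>" "m \<in> Ob (Und M)"
  shows "cpt (cpt \<delta> t) m \<in> Ar (Und N)" "Dom (Und N) (cpt (cpt \<delta> t) m) = act_ob N t (FOb H m)"
    "Cod (Und N) (cpt (cpt \<delta> t) m) = FOb H (act_ob M t m)"
  using monoidal_transformation.cpt_ar[OF bilin_mt(4)[OF assms(1), of t] assms(2)] assms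
  by (auto simp: act_ob_def bilin_mt)

lemma bilin_jay:
  assumes "bilin \<delta>" "m \<in> Ob (Und M)"
  shows "cpt (cpt \<delta> (ITen (IDual x) x)) m \<cdot>\<^bsub>Und N\<^esub> act_jay N x (FOb H m) =
    FAr H (act_jay M x m) \<cdot>\<^bsub>Und N\<^esub> cpt (cpt \<delta> IUnt) m"
  using arg_cong[OF monoidal_transformation.cpt_nat'[OF bilin_mt(1)[OF assms(1)], of "icls (TJay x)"], where f = "\<lambda>\<sigma>. cpt \<sigma> m"] assms
  by (simp add: bilin_mt act_after_simps act_before_simps)

lemma bilin_ten:
  assumes "bilin \<delta>" "m \<in> Ob (Und M)"
  shows "cpt (cpt \<delta> (ITen x y)) m \<cdot>\<^bsub>Und N\<^esub> act_ten N x y (FOb H m) =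
    FAr H (act_ten M x y m) \<cdot>\<^bsub>Und N\<^esub> FTen H (act_ob M x m) (act_ob M y m) \<cdot>\<^bsub>Und N\<^esub>
      (cpt (cpt \<delta> x) m \<odot>\<^bsub>Und N\<^esub> cpt (cpt \<delta> y) m)"
  using arg_cong[OF monoidal_transformation.cpt_Ten[OF bilin_mt(1)[OF assms(1)], of x y], where f = "\<lambda>\<sigma>. cpt \<sigma> m"] assms
  by (simp add: bilin_mt act_after_simps act_before_simps bilin_ar)

lemma bilin_unt:
  assumes "bilin \<delta>" "m \<in> Ob (Und M)"
  shows "cpt (cpt \<delta> IUnt) m \<cdot>\<^bsub>Und N\<^esub> act_unt N (FOb H m) = FAr H (act_unt M m) \<cdot>\<^bsub>Und N\<^esub> FUnt H"
  using arg_cong[OF monoidal_transformation.cpt_Unt[OF bilin_mt(1)[OF assms(1)]], where f = "\<lambda>\<sigma>. cpt \<sigma> m"] assms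
  by (simp add: bilin_mt act_after_simps act_before_simps)

end

section \<open>Morphisms of modules\<close>

context imodule_pair
begin

text \<open>For each fixed \<open>m\<close> the components form a family in \<open>t\<close> to
  which \<open>free_unique\<close> applies.\<close>

lemma bilin_unique:
  assumes \<delta>: "bilin \<delta>" and \<epsilon>: "bilin \<epsilon>"
    and eq: "\<And>m. m \<in> Ob (Und M) \<Longrightarrow> cpt (cpt \<delta> \<star>) m = cpt (cpt \<epsilon> \<star>) m"
  shows "\<delta> = \<epsilon>"
proof (rule smt_eqI[where X = UNIV])
  show "cpt \<delta> t = cpt \<epsilon> t" for t
  proof (rule smt_eqI[where X = "Ob (Und M)"])
    fix m assume m [simp]: "m \<in> Ob (Und M)"
    show "cpt (cpt \<delta> t) m = cpt (cpt \<epsilon> t) m"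
      by (rule N.U.free_unique[where c = "\<lambda>t. cpt (cpt \<delta> t) m" and d = "\<lambda>t. cpt (cpt \<epsilon> t) m"
            and so = "\<lambda>t. act_ob N t (FOb H m)" and to = "\<lambda>t. FOb H (act_ob M t m)"
            and sj = "\<lambda>x. act_jay N x (FOb H m)" and tj = "\<lambda>x. FAr H (act_jay M x m)"
            and sT = "\<lambda>x y. act_ten N x y (FOb H m)"
            and tT = "\<lambda>x y. FAr H (act_ten M x y m) \<cdot>\<^bsub>Und N\<^esub> FTen H (act_ob M x m) (act_ob M y m)"
            and su = "act_unt N (FOb H m)" and tu = "FAr H (act_unt M m) \<cdot>\<^bsub>Und N\<^esub> FUnt H"])
        (use \<delta> \<epsilon> in \<open>auto simp: Hom_def bilin_ar bilin_jay bilin_ten bilin_unt eq\<close>)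
  qed (auto simp: bilin_mt[OF \<delta>] bilin_mt[OF \<epsilon>] monoidal_transformation.cpt_ext[OF bilin_mt(4)[OF \<delta>]]
      monoidal_transformation.cpt_ext[OF bilin_mt(4)[OF \<epsilon>]])
qed (auto simp: bilin_mt[OF \<delta>] bilin_mt[OF \<epsilon>] extensional_def)

text \<open>The condition on \<open>\<gamma>\<close> alone. By \<open>morphism_iff_unital\<close>
  the condition on \<open>\<beta>\<close> follows from it.\<close>

definition unital :: "('o, 'a) bilin_trans \<Rightarrow> bool" where
  "unital \<delta> \<longleftrightarrow> bilin \<delta> \<and>
    (\<forall>m\<in>Ob (Und M). FAr H (gamma M m) = cpt (cpt \<delta> \<star>) m \<cdot>\<^bsub>Und N\<^esub> gamma N (FOb H m))"

lemma unital_ex: "\<exists>\<delta>. unital \<delta>"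
proof -
  interpret MN: symmetric_picard MN by (rule MN_picard)
  \<comment> \<open>\<open>H \<gamma>\<close> and \<open>\<gamma> H\<close> are taken as values of
    \<open>post\<close> and \<open>pre\<close>, because \<open>free_transformation\<close> with
    codomain \<open>MN\<close> needs an arrow of \<open>MN\<close> at \<open>\<star>\<close> and not
    merely a family of components.\<close>
  let ?HM = "FAr (post (Und M) (Und M) (Und N) H) (Gamma M)"
  let ?NH = "FAr (pre (Und M) (Und N) (Und N) H) (Gamma N)"
  note [simp] = M.Gamma_mt N.Gamma_mt comp_id_smf[OF smf_H]
  have 1: "monoidal_transformation (Und M) (Und N) ?HM" "Src ?HM = H"
      "Trg ?HM = FOb (act_before M N H) \<star>"
    and 2: "monoidal_transformation (Und M) (Und N) ?NH" "Src ?NH = H"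
      "Trg ?NH = FOb (act_after M N H) \<star>"
    using whisker_functor_left[OF M.Gamma_mt(1) smf_H] whisker_functor_right[OF N.Gamma_mt(1) smf_H]
    by (simp_all add: act_before_simps act_after_simps)
  have "?HM \<cdot>\<^bsub>MN\<^esub> Inv MN ?NH \<in> Hom MN (FOb (act_after M N H) \<star>) (FOb (act_before M N H) \<star>)"
    by (rule MN.cmp[where b = H]) (use 1 2 MN.inv_ar(1)[of ?NH] in \<open>auto simp del: pre_simps post_simps\<close>)
  from free_transformation[OF smf_after smf_before this] obtain \<delta>
    where \<delta>: "monoidal_transformation \<I> MN \<delta>" "Src \<delta> = act_after M N H" "Trg \<delta> = act_before M N H"
      "cpt \<delta> \<star> = ?HM \<cdot>\<^bsub>MN\<^esub> Inv MN ?NH" by blast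
  then have "bilin \<delta>" by (simp add: bilin_def)
  moreover have "FAr H (gamma M m) = cpt (cpt \<delta> \<star>) m \<cdot>\<^bsub>Und N\<^esub> gamma N (FOb H m)" if [simp]: "m \<in> Ob (Und M)" for m
  proof -
    have "cpt (cpt \<delta> \<star>) m = cpt ?HM m \<cdot>\<^bsub>Und N\<^esub> Inv (Und N) (cpt ?NH m)"
      using 2(1) by (simp add: \<delta>(4) del: pre_simps post_simps)
    then show ?thesis by (simp flip: gamma_def)
  qed
  ultimately show ?thesis by (auto simp: unital_def)
qed

lemma unital_beta:
  assumes "unital \<delta>" and m [simp]: "m \<in> Ob (Und M)"
  shows "cpt (cpt \<delta> (t \<bullet> s)) m \<cdot>\<^bsub>Und N\<^esub> beta N t s (FOb H m) =
    FAr H (beta M t s m) \<cdot>\<^bsub>Und N\<^esub> cpt (cpt \<delta> t) (act_ob M s m) \<cdot>\<^bsub>Und N\<^esub> act_ar N t (cpt (cpt \<delta> s) m)"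
proof -
  have bilin: "bilin \<delta>" and unit: "FAr H (gamma M m) = cpt (cpt \<delta> \<star>) m \<cdot>\<^bsub>Und N\<^esub> gamma N (FOb H m)"
    if "m \<in> Ob (Und M)" for m
    using assms that by (auto simp: unital_def)
  note \<delta> = bilin[OF m]
  note [simp] = bilin_ar[OF \<delta>]
  let ?n = "act_ob N s (FOb H m)" and ?m = "act_ob M s m"
  let ?tT = "\<lambda>x y. FAr H (act_ten M (x \<bullet> s) (y \<bullet> s) m) \<cdot>\<^bsub>Und N\<^esub> FTen H (act_ob M (x \<bullet> s) m) (act_ob M (y \<bullet> s) m)"
  \<comment> \<open>For fixed \<open>s\<close> and \<open>m\<close> the two sides become families in
    \<open>t\<close>, which \<open>free_unique\<close> compares without presenting them as
    transformations between functors.\<close>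
  let ?c = "\<lambda>t. cpt (cpt \<delta> (t \<bullet> s)) m \<cdot>\<^bsub>Und N\<^esub> beta N t s (FOb H m)"
  let ?d = "\<lambda>t. FAr H (beta M t s m) \<cdot>\<^bsub>Und N\<^esub> cpt (cpt \<delta> t) ?m \<cdot>\<^bsub>Und N\<^esub> act_ar N t (cpt (cpt \<delta> s) m)"
  have "?c t = ?d t"
  proof (rule N.U.free_unique[where c = ?c and d = ?d and so = "\<lambda>t. act_ob N t ?n" and to = "\<lambda>t. FOb H (act_ob M (t \<bullet> s) m)"
          and sj = "\<lambda>x. act_jay N x ?n" and tj = "\<lambda>x. FAr H (act_jay M (x \<bullet> s) m)"
          and sT = "\<lambda>x y. act_ten N x y ?n" and tT = ?tT
          and su = "act_unt N ?n" and tu = "FAr H (act_unt M m) \<cdot>\<^bsub>Und N\<^esub> FUnt H"])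
    fix x y
    show "?c (ITen (IDual x) x) \<cdot>\<^bsub>Und N\<^esub> act_jay N x ?n = FAr H (act_jay M (x \<bullet> s) m) \<cdot>\<^bsub>Und N\<^esub> ?c IUnt"
      using N.U.chain[OF bilin_jay[OF \<delta> m], of "x \<bullet> s" "beta N IUnt s (FOb H m)"] by (simp add: N.beta_jay)
    show "?d (ITen (IDual x) x) \<cdot>\<^bsub>Und N\<^esub> act_jay N x ?n = FAr H (act_jay M (x \<bullet> s) m) \<cdot>\<^bsub>Und N\<^esub> ?d IUnt"
    proof -
      have "?d (ITen (IDual x) x) \<cdot>\<^bsub>Und N\<^esub> act_jay N x ?n = FAr H (beta M (ITen (IDual x) x) s m) \<cdot>\<^bsub>Und N\<^esub>
          (cpt (cpt \<delta> (ITen (IDual x) x)) ?m \<cdot>\<^bsub>Und N\<^esub> act_jay N x (FOb H ?m)) \<cdot>\<^bsub>Und N\<^esub> act_ar N IUnt (cpt (cpt \<delta> s) m)"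
        by (simp add: N.act_jay_nat)
      also have "\<dots> = FAr H (beta M (ITen (IDual x) x) s m \<cdot>\<^bsub>Und M\<^esub> act_jay M x ?m) \<cdot>\<^bsub>Und N\<^esub>
          cpt (cpt \<delta> IUnt) ?m \<cdot>\<^bsub>Und N\<^esub> act_ar N IUnt (cpt (cpt \<delta> s) m)"
        by (simp add: bilin_jay[OF \<delta>])
      also have "\<dots> = FAr H (act_jay M (x \<bullet> s) m) \<cdot>\<^bsub>Und N\<^esub> ?d IUnt"
        by (simp only: M.beta_jay m) simp
      finally show ?thesis .
    qed
    show "?c (ITen x y) \<cdot>\<^bsub>Und N\<^esub> act_ten N x y ?n = ?tT x y \<cdot>\<^bsub>Und N\<^esub> (?c x \<odot>\<^bsub>Und N\<^esub> ?c y)"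
      using N.U.chain[OF bilin_ten[OF \<delta> m], of "x \<bullet> s" "y \<bullet> s" "beta N x s (FOb H m) \<odot>\<^bsub>Und N\<^esub> beta N y s (FOb H m)"]
      by (simp add: N.beta_ten N.U.merge)
    show "?d (ITen x y) \<cdot>\<^bsub>Und N\<^esub> act_ten N x y ?n = ?tT x y \<cdot>\<^bsub>Und N\<^esub> (?d x \<odot>\<^bsub>Und N\<^esub> ?d y)"
    proof -
      have "?d (ITen x y) \<cdot>\<^bsub>Und N\<^esub> act_ten N x y ?n = FAr H (beta M (ITen x y) s m) \<cdot>\<^bsub>Und N\<^esub>
          (cpt (cpt \<delta> (ITen x y)) ?m \<cdot>\<^bsub>Und N\<^esub> act_ten N x y (FOb H ?m)) \<cdot>\<^bsub>Und N\<^esub>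
          (act_ar N x (cpt (cpt \<delta> s) m) \<odot>\<^bsub>Und N\<^esub> act_ar N y (cpt (cpt \<delta> s) m))"
        by (simp add: N.act_ten_nat)
      also have "\<dots> = FAr H (beta M (ITen x y) s m \<cdot>\<^bsub>Und M\<^esub> act_ten M x y ?m) \<cdot>\<^bsub>Und N\<^esub>
          FTen H (act_ob M x ?m) (act_ob M y ?m) \<cdot>\<^bsub>Und N\<^esub> (cpt (cpt \<delta> x) ?m \<odot>\<^bsub>Und N\<^esub> cpt (cpt \<delta> y) ?m) \<cdot>\<^bsub>Und N\<^esub>
          (act_ar N x (cpt (cpt \<delta> s) m) \<odot>\<^bsub>Und N\<^esub> act_ar N y (cpt (cpt \<delta> s) m))"
        by (simp add: bilin_ten[OF \<delta>])
      also have "\<dots> = FAr H (act_ten M (x \<bullet> s) (y \<bullet> s) m) \<cdot>\<^bsub>Und N\<^esub> (FAr H (beta M x s m \<odot>\<^bsub>Und M\<^esub> beta M y s m) \<cdot>\<^bsub>Und N\<^esub>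
          FTen H (act_ob M x ?m) (act_ob M y ?m)) \<cdot>\<^bsub>Und N\<^esub> (cpt (cpt \<delta> x) ?m \<odot>\<^bsub>Und N\<^esub> cpt (cpt \<delta> y) ?m) \<cdot>\<^bsub>Und N\<^esub>
          (act_ar N x (cpt (cpt \<delta> s) m) \<odot>\<^bsub>Und N\<^esub> act_ar N y (cpt (cpt \<delta> s) m))"
        by (simp only: M.beta_ten m) simp
      also have "FAr H (beta M x s m \<odot>\<^bsub>Und M\<^esub> beta M y s m) \<cdot>\<^bsub>Und N\<^esub> FTen H (act_ob M x ?m) (act_ob M y ?m) =
          FTen H (act_ob M (x \<bullet> s) m) (act_ob M (y \<bullet> s) m) \<cdot>\<^bsub>Und N\<^esub> (FAr H (beta M x s m) \<odot>\<^bsub>Und N\<^esub> FAr H (beta M y s m))"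
        by (simp add: H.FTen_nat')
      finally show ?thesis by (simp add: N.U.merge)
    qed
    show "?c IUnt \<cdot>\<^bsub>Und N\<^esub> act_unt N ?n = FAr H (act_unt M m) \<cdot>\<^bsub>Und N\<^esub> FUnt H"
      by (simp add: N.beta_unt bilin_unt[OF \<delta>])
    show "?d IUnt \<cdot>\<^bsub>Und N\<^esub> act_unt N ?n = FAr H (act_unt M m) \<cdot>\<^bsub>Und N\<^esub> FUnt H"
    proof -
      have "?d IUnt \<cdot>\<^bsub>Und N\<^esub> act_unt N ?n = FAr H (beta M IUnt s m \<cdot>\<^bsub>Und M\<^esub> act_unt M ?m) \<cdot>\<^bsub>Und N\<^esub> FUnt H"
        by (simp add: N.act_unt_nat bilin_unt[OF \<delta>])
      then show ?thesis by (simp only: M.beta_unt m)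
    qed
    \<comment> \<open>Composed with \<open>\<gamma>\<close>, both sides become
      \<open>\<delta>\<close> at \<open>s\<close>: the left by \<open>gamma_beta\<close> in
      \<open>N\<close>, the right by naturality of \<open>\<gamma>\<close>, the unit condition at
      \<open>s \<times> m\<close> and \<open>gamma_beta\<close> in \<open>M\<close>.\<close>
    show "?c \<star> = ?d \<star>"
    proof (rule N.U.cancel_right[where h = "gamma N ?n"])
      have "?c \<star> \<cdot>\<^bsub>Und N\<^esub> gamma N ?n = cpt (cpt \<delta> s) m"
        by (simp add: N.gamma_beta)
      also have "\<dots> = FAr H (beta M \<star> s m \<cdot>\<^bsub>Und M\<^esub> gamma M ?m) \<cdot>\<^bsub>Und N\<^esub> cpt (cpt \<delta> s) m"
        by (simp only: M.gamma_beta m) simp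
      also have "\<dots> = ?d \<star> \<cdot>\<^bsub>Und N\<^esub> gamma N ?n"
        by (simp add: unit N.gamma_nat)
      finally show "?c \<star> \<cdot>\<^bsub>Und N\<^esub> gamma N ?n = ?d \<star> \<cdot>\<^bsub>Und N\<^esub> gamma N ?n" .
    qed auto
  qed (auto simp: Hom_def)
  then show ?thesis .
qed

lemma morphism_iff_unital: "imodule_morphism M N H \<delta> \<longleftrightarrow> unital \<delta>"
proof
  assume "imodule_morphism M N H \<delta>"
  then interpret imodule_morphism M N H \<delta> .
  show "unital \<delta>" using delta delta_gamma by (auto simp: unital_def bilin_def)
next
  assume "unital \<delta>"
  then show "imodule_morphism M N H \<delta>"
    using unital_beta smf_H by unfold_locales (auto simp: unital_def bilin_def)
qed

lemma unital_unique:
  assumes "unital \<delta>" "unital \<epsilon>"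
  shows "\<delta> = \<epsilon>"
proof (rule bilin_unique)
  show "bilin \<delta>" "bilin \<epsilon>" using assms by (auto simp: unital_def)
  note [simp] = bilin_ar[OF this(1)] bilin_ar[OF this(2)]
  show "cpt (cpt \<delta> \<star>) m = cpt (cpt \<epsilon> \<star>) m" if "m \<in> Ob (Und M)" for m
    by (rule N.U.cancel_right[where h = "gamma N (FOb H m)"]) (use assms that in \<open>auto simp: unital_def\<close>)
qed

lemma morphism_ex1: "\<exists>!\<delta>. imodule_morphism M N H \<delta>"
  using unital_ex unital_unique by (auto simp: morphism_iff_unital)

end

text \<open>A morphism named by its endpoints and underlying arrow, which determine it by
  \<open>morphism_ex1\<close>. Equality of module morphisms thus becomes equality of arrows of
  \<open>SPC\<close>.\<close>

definition mor :: "('o, 'a) imod \<Rightarrow> ('o, 'a) imod \<Rightarrow> ('o, 'a) lin_map \<Rightarrow> ('o, 'a) imod_mor" where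
  "mor M N H = (M, N, H, THE \<delta>. imodule_morphism M N H \<delta>)"

lemma imodule_pair_iff:
  "imodule_pair M N H \<longleftrightarrow> imodule M \<and> imodule N \<and> symmetric_monoidal_functor (Und M) (Und N) H"
  by (auto simp: imodule_pair_def imodule_pair_axioms_def)

lemma morphism_mor: "imodule_morphism M N H \<delta> \<Longrightarrow> imodule_pair M N H \<and> (M, N, H, \<delta>) = mor M N H"
proof -
  assume m: "imodule_morphism M N H \<delta>"
  then interpret imodule_morphism M N H \<delta> .
  have p: "imodule_pair M N H"
    using H M.imodule_axioms N.imodule_axioms by (simp add: imodule_pair_iff)
  with m imodule_pair.morphism_ex1[OF p] show ?thesis
    by (auto simp: mor_def intro: the1_equality[symmetric])
qed

lemma mor_morphism:
  assumes "imodule_pair M N H"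
  shows "imodule_morphism M N H (THE \<delta>. imodule_morphism M N H \<delta>)"
  by (rule theI'[OF imodule_pair.morphism_ex1[OF assms]])

lemma IMod_simps [simp]:
  "M \<in> Ob IMod \<longleftrightarrow> imodule M" "Idn IMod = imod_id" "Cmp IMod = imod_comp"
  "Dom IMod (mor M N H) = M" "Cod IMod (mor M N H) = N"
  by (auto simp: IMod_def mor_def)

lemma IMod_Ar: "f \<in> Ar IMod \<longleftrightarrow> (\<exists>M N H. imodule_pair M N H \<and> f = mor M N H)"
proof
  assume "f \<in> Ar IMod"
  then obtain M N H \<delta> where "f = (M, N, H, \<delta>)" "imodule_morphism M N H \<delta>" by (auto simp: IMod_def)
  with morphism_mor[of M N H \<delta>] show "\<exists>M N H. imodule_pair M N H \<and> f = mor M N H" by auto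
next
  assume "\<exists>M N H. imodule_pair M N H \<and> f = mor M N H"
  with mor_morphism show "f \<in> Ar IMod" by (auto simp: IMod_def mor_def)
qed

lemma IMod_Hom: "f \<in> Hom IMod M N \<longleftrightarrow> (\<exists>H. imodule_pair M N H \<and> f = mor M N H)"
  by (auto simp: Hom_def IMod_Ar)

text \<open>Precomposition and postcomposition with an identity functor are identities, so the
  source and target of the bilinear transformation are both \<open>Act M\<close>.\<close>

lemma imod_id_mor:
  assumes "imodule M"
  shows "imodule_pair M M (id_smf (Und M)) \<and> imod_id M = mor M M (id_smf (Und M))"
proof -
  interpret imodule M by fact
  have p: "imodule_pair M M (id_smf (Und M))" using assms U.smf_id by (simp add: imodule_pair_iff)
  then interpret p: imodule_pair M M "id_smf (Und M)" .
  have "act_after M M (id_smf U) = Act M" "act_before M M (id_smf U) = Act M"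
    using comp_id_smf[OF Act_smf] pre_id[OF Und Und] post_id[OF Und Und] by (auto simp: act_after_def act_before_def)
  then have "p.unital (Idn (ihom \<I> UU) (Act M))"
    using mt_idn[OF Act_smf] by (auto simp: p.unital_def p.bilin_def simp flip: act_ob_def)
  then show ?thesis
    using morphism_mor[of M M "id_smf U" "Idn (ihom \<I> UU) (Act M)"] p.morphism_iff_unital p
    by (auto simp: imod_id_def)
qed

text \<open>Rather than checking that the formula in \<open>imod_comp\<close> defines a morphism,
  the proof takes the structure \<open>\<zeta>\<close> that the composite functor is known to have
  and shows by \<open>free_unique\<close> that its components are given by the formula.\<close>

lemma imod_comp_mor:
  assumes "imodule_pair M N H" "imodule_pair N P K"
  shows "imodule_pair M P (comp_smf (Und M) (Und P) K H) \<and>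
    imod_comp (mor N P K) (mor M N H) = mor M P (comp_smf (Und M) (Und P) K H)"
proof -
  interpret H: imodule_pair M N H by fact
  interpret K: imodule_pair N P K by fact
  let ?KH = "comp_smf (Und M) (Und P) K H"
  have p: "imodule_pair M P ?KH"
    using H.M.imodule_axioms K.N.imodule_axioms smf_comp[OF H.smf_H K.smf_H] by (simp add: imodule_pair_iff)
  then interpret KH: imodule_pair M P ?KH .
  obtain \<delta> where \<delta>: "H.unital \<delta>" "mor M N H = (M, N, H, \<delta>)"
    using mor_morphism[OF assms(1)] by (auto simp: H.morphism_iff_unital mor_def)
  obtain \<epsilon> where \<epsilon>: "K.unital \<epsilon>" "mor N P K = (N, P, K, \<epsilon>)"
    using mor_morphism[OF assms(2)] by (auto simp: K.morphism_iff_unital mor_def)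
  obtain \<zeta> where \<zeta>: "KH.unital \<zeta>" "mor M P ?KH = (M, P, ?KH, \<zeta>)"
    using mor_morphism[OF p] by (auto simp: KH.morphism_iff_unital mor_def)
  have bilin: "H.bilin \<delta>" "K.bilin \<epsilon>" "KH.bilin \<zeta>"
    using \<delta> \<epsilon> \<zeta> by (auto simp: H.unital_def K.unital_def KH.unital_def)
  note [simp] = H.bilin_ar[OF bilin(1)] K.bilin_ar[OF bilin(2)] KH.bilin_ar[OF bilin(3)]
  have comp: "cpt (cpt \<zeta> t) m = FAr K (cpt (cpt \<delta> t) m) \<cdot>\<^bsub>Und P\<^esub> cpt (cpt \<epsilon> t) (FOb H m)"
    if m [simp]: "m \<in> Ob (Und M)" for t m
  proof (rule K.N.U.free_unique[where c = "\<lambda>t. cpt (cpt \<zeta> t) m"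
        and d = "\<lambda>t. FAr K (cpt (cpt \<delta> t) m) \<cdot>\<^bsub>Und P\<^esub> cpt (cpt \<epsilon> t) (FOb H m)"
        and so = "\<lambda>t. act_ob P t (FOb ?KH m)" and to = "\<lambda>t. FOb ?KH (act_ob M t m)"
        and sj = "\<lambda>x. act_jay P x (FOb ?KH m)" and tj = "\<lambda>x. FAr ?KH (act_jay M x m)"
        and sT = "\<lambda>x y. act_ten P x y (FOb ?KH m)"
        and tT = "\<lambda>x y. FAr ?KH (act_ten M x y m) \<cdot>\<^bsub>Und P\<^esub> FTen ?KH (act_ob M x m) (act_ob M y m)"
        and su = "act_unt P (FOb ?KH m)" and tu = "FAr ?KH (act_unt M m) \<cdot>\<^bsub>Und P\<^esub> FUnt ?KH"])
    fix x y
    let ?d = "\<lambda>t. FAr K (cpt (cpt \<delta> t) m) \<cdot>\<^bsub>Und P\<^esub> cpt (cpt \<epsilon> t) (FOb H m)"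
    show "cpt (cpt \<zeta> (ITen (IDual x) x)) m \<cdot>\<^bsub>Und P\<^esub> act_jay P x (FOb ?KH m) =
        FAr ?KH (act_jay M x m) \<cdot>\<^bsub>Und P\<^esub> cpt (cpt \<zeta> IUnt) m"
      by (rule KH.bilin_jay[OF bilin(3) m])
    show "cpt (cpt \<zeta> (ITen x y)) m \<cdot>\<^bsub>Und P\<^esub> act_ten P x y (FOb ?KH m) =
        (FAr ?KH (act_ten M x y m) \<cdot>\<^bsub>Und P\<^esub> FTen ?KH (act_ob M x m) (act_ob M y m)) \<cdot>\<^bsub>Und P\<^esub>
        (cpt (cpt \<zeta> x) m \<odot>\<^bsub>Und P\<^esub> cpt (cpt \<zeta> y) m)"
      using KH.bilin_ten[OF bilin(3) m, of x y] by simp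
    show "cpt (cpt \<zeta> IUnt) m \<cdot>\<^bsub>Und P\<^esub> act_unt P (FOb ?KH m) = FAr ?KH (act_unt M m) \<cdot>\<^bsub>Und P\<^esub> FUnt ?KH"
      by (rule KH.bilin_unt[OF bilin(3) m])
    have "?d (ITen (IDual x) x) \<cdot>\<^bsub>Und P\<^esub> act_jay P x (FOb ?KH m) =
        FAr K (cpt (cpt \<delta> (ITen (IDual x) x)) m \<cdot>\<^bsub>Und N\<^esub> act_jay N x (FOb H m)) \<cdot>\<^bsub>Und P\<^esub> cpt (cpt \<epsilon> IUnt) (FOb H m)"
      by (simp add: K.bilin_jay[OF bilin(2)])
    then show "?d (ITen (IDual x) x) \<cdot>\<^bsub>Und P\<^esub> act_jay P x (FOb ?KH m) = FAr ?KH (act_jay M x m) \<cdot>\<^bsub>Und P\<^esub> ?d IUnt"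
      by (simp add: H.bilin_jay[OF bilin(1)])
    have "?d (ITen x y) \<cdot>\<^bsub>Und P\<^esub> act_ten P x y (FOb ?KH m) =
        FAr K (cpt (cpt \<delta> (ITen x y)) m \<cdot>\<^bsub>Und N\<^esub> act_ten N x y (FOb H m)) \<cdot>\<^bsub>Und P\<^esub>
        FTen K (act_ob N x (FOb H m)) (act_ob N y (FOb H m)) \<cdot>\<^bsub>Und P\<^esub>
        (cpt (cpt \<epsilon> x) (FOb H m) \<odot>\<^bsub>Und P\<^esub> cpt (cpt \<epsilon> y) (FOb H m))"
      by (simp add: K.bilin_ten[OF bilin(2)])
    also have "\<dots> = FAr K (FAr H (act_ten M x y m)) \<cdot>\<^bsub>Und P\<^esub> FAr K (FTen H (act_ob M x m) (act_ob M y m)) \<cdot>\<^bsub>Und P\<^esub>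
        (FAr K (cpt (cpt \<delta> x) m \<odot>\<^bsub>Und N\<^esub> cpt (cpt \<delta> y) m) \<cdot>\<^bsub>Und P\<^esub> FTen K (act_ob N x (FOb H m)) (act_ob N y (FOb H m))) \<cdot>\<^bsub>Und P\<^esub>
        (cpt (cpt \<epsilon> x) (FOb H m) \<odot>\<^bsub>Und P\<^esub> cpt (cpt \<epsilon> y) (FOb H m))"
      by (simp add: H.bilin_ten[OF bilin(1)])
    also have "FAr K (cpt (cpt \<delta> x) m \<odot>\<^bsub>Und N\<^esub> cpt (cpt \<delta> y) m) \<cdot>\<^bsub>Und P\<^esub> FTen K (act_ob N x (FOb H m)) (act_ob N y (FOb H m)) =
        FTen K (FOb H (act_ob M x m)) (FOb H (act_ob M y m)) \<cdot>\<^bsub>Und P\<^esub> (FAr K (cpt (cpt \<delta> x) m) \<odot>\<^bsub>Und P\<^esub> FAr K (cpt (cpt \<delta> y) m))"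
      by (simp add: K.H.FTen_nat')
    finally show "?d (ITen x y) \<cdot>\<^bsub>Und P\<^esub> act_ten P x y (FOb ?KH m) =
        (FAr ?KH (act_ten M x y m) \<cdot>\<^bsub>Und P\<^esub> FTen ?KH (act_ob M x m) (act_ob M y m)) \<cdot>\<^bsub>Und P\<^esub> (?d x \<odot>\<^bsub>Und P\<^esub> ?d y)"
      by (simp add: K.N.U.merge)
    have "?d IUnt \<cdot>\<^bsub>Und P\<^esub> act_unt P (FOb ?KH m) =
        FAr K (cpt (cpt \<delta> IUnt) m \<cdot>\<^bsub>Und N\<^esub> act_unt N (FOb H m)) \<cdot>\<^bsub>Und P\<^esub> FUnt K"
      by (simp add: K.bilin_unt[OF bilin(2)])
    then show "?d IUnt \<cdot>\<^bsub>Und P\<^esub> act_unt P (FOb ?KH m) = FAr ?KH (act_unt M m) \<cdot>\<^bsub>Und P\<^esub> FUnt ?KH"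
      by (simp add: H.bilin_unt[OF bilin(1)])
    \<comment> \<open>Composed with \<open>\<gamma>\<close> of \<open>P\<close>, both sides equal
      \<open>K H \<gamma>\<close>, by the unit conditions of \<open>\<zeta>\<close>,
      \<open>\<delta>\<close> and \<open>\<epsilon>\<close>.\<close>
    show "cpt (cpt \<zeta> \<star>) m = ?d \<star>"
    proof (rule K.N.U.cancel_right[where h = "gamma P (FOb ?KH m)"])
      have "cpt (cpt \<zeta> \<star>) m \<cdot>\<^bsub>Und P\<^esub> gamma P (FOb ?KH m) = FAr K (FAr H (gamma M m))"
        using \<zeta>(1) by (simp add: KH.unital_def)
      also have "\<dots> = FAr K (cpt (cpt \<delta> \<star>) m \<cdot>\<^bsub>Und N\<^esub> gamma N (FOb H m))"
        using \<delta>(1) by (simp add: H.unital_def)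
      also have "\<dots> = ?d \<star> \<cdot>\<^bsub>Und P\<^esub> gamma P (FOb ?KH m)"
        using \<epsilon>(1) by (simp add: K.unital_def)
      finally show "cpt (cpt \<zeta> \<star>) m \<cdot>\<^bsub>Und P\<^esub> gamma P (FOb ?KH m) = ?d \<star> \<cdot>\<^bsub>Und P\<^esub> gamma P (FOb ?KH m)" .
    qed auto
  qed (auto simp: Hom_def)
  \<comment> \<open>Every term of type \<open>iobj\<close> is an object of \<open>\<I>\<close>, so
    the outer family is compared on \<open>UNIV\<close>, which matches the unrestricted abstraction
    over \<open>t\<close> in \<open>imod_comp\<close>.\<close>
  have "\<zeta> = \<lparr>Src = act_after M P ?KH, Trg = act_before M P ?KH,
      cpt = (\<lambda>t. \<lparr>Src = FOb (act_after M P ?KH) t, Trg = FOb (act_before M P ?KH) t,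
        cpt = (\<lambda>m\<in>Ob (Und M). FAr K (cpt (cpt \<delta> t) m) \<cdot>\<^bsub>Und P\<^esub> cpt (cpt \<epsilon> t) (FOb H m))\<rparr>)\<rparr>"
    by (intro smt_eqI[where X = UNIV] smt_eqI[where X = "Ob (Und M)"])
      (auto simp: KH.bilin_mt[OF bilin(3)] KH.act_after_simps KH.act_before_simps extensional_def comp,
       use monoidal_transformation.cpt_ext[OF KH.bilin_mt(4)[OF bilin(3)]] in \<open>auto simp: extensional_def\<close>)
  then show ?thesis
    using p by (simp add: \<delta>(2) \<epsilon>(2) \<zeta>(2) Let_def)
qed

section \<open>The categories of symmetric Picard categories and of modules\<close>

lemma SPC_simps [simp]:
  "A \<in> Ob SPC \<longleftrightarrow> symmetric_picard A" "(A, B, F) \<in> Ar SPC \<longleftrightarrow> symmetric_monoidal_functor A B F"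
  "Dom SPC (A, B, F) = A" "Cod SPC (A, B, F) = B" "Idn SPC A = (A, A, id_smf A)"
  "Cmp SPC (B', C, G) (A, B, F) = (A, C, comp_smf A C G F)"
  by (auto simp: SPC_def)

lemma SPC_Hom: "f \<in> Hom SPC A B \<longleftrightarrow> (\<exists>F. symmetric_monoidal_functor A B F \<and> f = (A, B, F))"
  by (cases f) (auto simp: Hom_def)

lemma SPC_Ar_E:
  assumes "f \<in> Ar SPC"
  obtains A B F where "symmetric_monoidal_functor A B F" "f = (A, B, F)" "symmetric_picard A" "symmetric_picard B"
  using assms by (cases f) (auto simp: symmetric_monoidal_functor_def)

lemma category_SPC:
  "category (SPC :: (('o, 'a) spc, ('o, 'a) spc \<times> ('o, 'a) spc \<times> ('o, 'a, 'o, 'a) smf) cat)"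
proof
  fix A B C D :: "('o, 'a) spc" and f g h :: "('o, 'a) spc \<times> ('o, 'a) spc \<times> ('o, 'a, 'o, 'a) smf"
  show "Dom SPC f \<in> Ob SPC \<and> Cod SPC f \<in> Ob SPC" if "f \<in> Ar SPC"
    using that by (auto elim: SPC_Ar_E)
  show "Idn SPC A \<in> Hom SPC A A" if "A \<in> Ob SPC"
    using that by (simp add: SPC_Hom symmetric_picard.smf_id)
  show "f \<cdot>\<^bsub>SPC\<^esub> Idn SPC A = f" "Idn SPC B \<cdot>\<^bsub>SPC\<^esub> f = f" if "f \<in> Hom SPC A B"
    using that by (auto simp: SPC_Hom comp_id_smf)
  assume f: "f \<in> Hom SPC A B" and g: "g \<in> Hom SPC B C"
  then show "g \<cdot>\<^bsub>SPC\<^esub> f \<in> Hom SPC A C"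
    by (auto simp: SPC_Hom intro: smf_comp)
  assume "h \<in> Hom SPC C D"
  with f g show "(h \<cdot>\<^bsub>SPC\<^esub> g) \<cdot>\<^bsub>SPC\<^esub> f = h \<cdot>\<^bsub>SPC\<^esub> (g \<cdot>\<^bsub>SPC\<^esub> f)"
    by (auto simp: SPC_Hom comp_smf_assoc)
qed

lemma category_IMod: "category (IMod :: (('o, 'a) imod, ('o, 'a) imod_mor) cat)"
proof
  fix M N P Q :: "('o, 'a) imod" and f g h :: "('o, 'a) imod_mor"
  show "Dom IMod f \<in> Ob IMod \<and> Cod IMod f \<in> Ob IMod" if "f \<in> Ar IMod"
    using that by (auto simp: IMod_Ar imodule_pair_iff)
  show "Idn IMod M \<in> Hom IMod M M" if "M \<in> Ob IMod"
    using that imod_id_mor by (auto simp: IMod_Hom)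
  show "f \<cdot>\<^bsub>IMod\<^esub> Idn IMod M = f" "Idn IMod N \<cdot>\<^bsub>IMod\<^esub> f = f" if f: "f \<in> Hom IMod M N"
  proof -
    from f obtain H where H: "imodule_pair M N H" "f = mor M N H" by (auto simp: IMod_Hom)
    then have "imodule M" "imodule N" "symmetric_monoidal_functor (Und M) (Und N) H" by (auto simp: imodule_pair_iff)
    with H imod_comp_mor[of M M "id_smf (Und M)" N H] imod_comp_mor[of M N H N "id_smf (Und N)"]
    show "f \<cdot>\<^bsub>IMod\<^esub> Idn IMod M = f" "Idn IMod N \<cdot>\<^bsub>IMod\<^esub> f = f"
      by (auto simp: imod_id_mor comp_id_smf)
  qed
  assume f: "f \<in> Hom IMod M N" and g: "g \<in> Hom IMod N P"
  then obtain H K where HK: "imodule_pair M N H" "f = mor M N H" "imodule_pair N P K" "g = mor N P K"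
    by (auto simp: IMod_Hom)
  then show "g \<cdot>\<^bsub>IMod\<^esub> f \<in> Hom IMod M P"
    using imod_comp_mor[of M N H P K] by (auto simp: IMod_Hom)
  assume "h \<in> Hom IMod P Q"
  then obtain L where L: "imodule_pair P Q L" "h = mor P Q L" by (auto simp: IMod_Hom)
  have "comp_smf (Und M) (Und Q) (comp_smf (Und N) (Und Q) L K) H = comp_smf (Und M) (Und Q) L (comp_smf (Und M) (Und P) K H)"
    using HK L by (intro comp_smf_assoc[symmetric]) (auto simp: imodule_pair_iff)
  with HK L imod_comp_mor[OF HK(1,3)] imod_comp_mor[OF HK(3) L(1)]
  show "(h \<cdot>\<^bsub>IMod\<^esub> g) \<cdot>\<^bsub>IMod\<^esub> f = h \<cdot>\<^bsub>IMod\<^esub> (g \<cdot>\<^bsub>IMod\<^esub> f)"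
    using imod_comp_mor[of M N H Q] imod_comp_mor[of M P _ Q L] by auto
qed

section \<open>Strict modules and the equivalence\<close>

definition strict_mod :: "('o, 'a) spc \<Rightarrow> ('o, 'a) imod" where
  "strict_mod A = \<lparr>Und = A, Act = act_map A,
     Beta = Idn (ihom \<I> (ihom \<I> (ihom A A))) (act_act A (act_map A)),
     Gamma = Idn (ihom A A) (id_smf A)\<rparr>"

lemma Und_strict_mod [simp]: "Und (strict_mod A) = A"
  by (simp add: strict_mod_def)

text \<open>By \<open>act_act_eq_mult_act\<close> the action is multiplicative on the nose. Hence
  \<open>beta\<close> and \<open>gamma\<close> have identity components and every axiom compares
  identities.\<close>

lemma strict_imodule_strict_mod:
  assumes "symmetric_picard A"
  shows "strict_imodule (strict_mod A)"
proof -
  interpret A: symmetric_picard A by fact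
  let ?M = "strict_mod A"
  interpret v: strict_arrow \<I> "ihom A A" "act_map A" by (rule act_map[OF assms])
  interpret action ?M
    by (intro action.intro) (simp_all add: strict_mod_def A.symmetric_picard_axioms v.smf_axioms)
  have Act: "Act ?M = act_map A" by (simp add: strict_mod_def)
  have "FOb (act_map A) (t \<bullet> s) = comp_smf A A (FOb (act_map A) t) (FOb (act_map A) s)" for t s
    using act_act_simps(1)[of t s] mult_act_simps(1)[of t s] act_act_eq_mult_act[OF assms] by (simp add: Act)
  then have [simp]: "act_ob ?M (t \<bullet> s) m = act_ob ?M t (act_ob ?M s m)" if "m \<in> Ob A" for t s m
    using that by (simp add: Act act_ob_def)
  have [simp]: "beta ?M t s m = Idn A (act_ob ?M t (act_ob ?M s m))" if "m \<in> Ob A" for t s m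
    using act_act_simps(1)[of t s] that by (simp add: Act beta_def strict_mod_def act_ob_def)
  have [simp]: "act_ob ?M \<star> m = m" "gamma ?M m = Idn A m" if "m \<in> Ob A" for m
    using that by (simp_all add: act_ob_def gamma_def strict_mod_def act_map[OF assms])
  have act: "symmetric_monoidal_functor \<I> (ihom \<I> (ihom A A)) (act_act A (act_map A))"
    unfolding act_act_eq_mult_act[OF assms] mult_act_def
    by (rule smf_comp[OF _ smf_post[OF symmetric_picard_\<I> v.smf_axioms]])
      (use act_map[OF symmetric_picard_\<I>] in \<open>simp add: strict_arrow_def\<close>)
  show ?thesis
  proof (intro strict_imodule.intro imodule.intro strict_imodule_axioms.intro)
    show "symmetric_picard (Und ?M)" by (simp add: assms)
    show "Act ?M \<in> Ob (ihom \<I> (ihom (Und ?M) (Und ?M)))" by (simp add: Act v.smf_axioms)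
    show "Beta ?M \<in> Hom (ihom \<I> (ihom \<I> (ihom (Und ?M) (Und ?M))))
        (act_act (Und ?M) (Act ?M)) (mult_act (Und ?M) (Act ?M))"
      using act by (simp add: strict_mod_def mt_idn act_act_eq_mult_act[OF assms])
    show "Gamma ?M \<in> Hom (ihom (Und ?M) (Und ?M)) (id_smf (Und ?M)) (FOb (Act ?M) \<star>)"
      by (simp add: strict_mod_def act_map[OF assms] mt_idn A.smf_id)
    show "strict_arrow \<I> (ihom (Und ?M) (Und ?M)) (Act ?M)"
      by (simp add: Act act_map[OF assms])
    show "Beta ?M = Idn (ihom \<I> (ihom \<I> (ihom (Und ?M) (Und ?M)))) (act_act (Und ?M) (Act ?M))"
      "Gamma ?M = Idn (ihom (Und ?M) (Und ?M)) (id_smf (Und ?M))"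
      by (simp_all add: strict_mod_def)
  qed (use act_ob act_ar act_idn in auto)
qed

text \<open>An identity \<open>Gamma\<close> forces \<open>\<star>\<close> to act as the identity
  functor; freeness then determines \<open>Act\<close>, and with it \<open>Beta\<close>.\<close>

lemma strict_imodule_unique:
  assumes "strict_imodule M"
  shows "M = strict_mod (Und M)"
proof -
  interpret strict_imodule M by fact
  have "FOb (Act M) \<star> = id_smf (Und M)"
    using Gamma_mt(3) by (simp add: strict_Gamma)
  then have "Act M = act_map (Und M)"
    by (rule act_map_unique[OF Und strict_Act])
  then show ?thesis
    using strict_Beta strict_Gamma by (intro imod.equality) (auto simp: strict_mod_def)
qed

lemma strict_mod_imodule: "symmetric_picard A \<Longrightarrow> imodule (strict_mod A)"
  using strict_imodule_strict_mod by (auto simp: strict_imodule_def)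

lemma IMod_strict_simps [simp]:
  "M \<in> Ob IMod_strict \<longleftrightarrow> strict_imodule M" "Dom IMod_strict = Dom IMod" "Cod IMod_strict = Cod IMod"
  "Idn IMod_strict = imod_id" "Cmp IMod_strict = imod_comp"
  "f \<in> Ar IMod_strict \<longleftrightarrow> f \<in> Ar IMod \<and> strict_imodule (Dom IMod f) \<and> strict_imodule (Cod IMod f)"
  by (auto simp: IMod_strict_def full_subcategory_def strict_imodule_def)

lemma IMod_strict_Hom:
  "f \<in> Hom IMod_strict M N \<longleftrightarrow> f \<in> Hom IMod M N \<and> strict_imodule M \<and> strict_imodule N"
  by (auto simp: Hom_def)

lemma category_IMod_strict: "category (IMod_strict :: (('o, 'a) imod, ('o, 'a) imod_mor) cat)"
proof -
  interpret C: category "IMod :: (('o, 'a) imod, ('o, 'a) imod_mor) cat" by (rule category_IMod)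
  show ?thesis
  proof
    fix M :: "('o, 'a) imod" assume "M \<in> Ob IMod_strict"
    then show "Idn IMod_strict M \<in> Hom IMod_strict M M"
      using C.idn[of M] by (simp add: IMod_strict_Hom strict_imodule_def)
  qed (use C.cmp C.cmp_idn C.idn_cmp C.cmp_assoc in \<open>auto simp: IMod_strict_Hom\<close>)
qed

section \<open>The functors between symmetric Picard categories and modules\<close>

definition strict_functor :: "(('o, 'a) spc, ('o, 'a) spc \<times> ('o, 'a) spc \<times> ('o, 'a) lin_map,
    ('o, 'a) imod, ('o, 'a) imod_mor) fctr" where
  "strict_functor = \<lparr>FOb = (\<lambda>A\<in>Ob SPC. strict_mod A),
     FAr = (\<lambda>f\<in>Ar SPC. mor (strict_mod (fst f)) (strict_mod (fst (snd f))) (snd (snd f)))\<rparr>"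

lemma strict_functor_simps [simp]:
  "symmetric_picard A \<Longrightarrow> FOb strict_functor A = strict_mod A"
  "symmetric_monoidal_functor A B F \<Longrightarrow> FAr strict_functor (A, B, F) = mor (strict_mod A) (strict_mod B) F"
  by (auto simp: strict_functor_def)

lemma strict_pair:
  "symmetric_monoidal_functor A B F \<Longrightarrow> imodule_pair (strict_mod A) (strict_mod B) F"
  by (auto simp: imodule_pair_iff symmetric_monoidal_functor_def intro: strict_mod_imodule)

lemma is_functor_idF: "category C \<Longrightarrow> is_functor C C (idF C)"
proof -
  assume "category C"
  then interpret category C .
  show ?thesis by unfold_locales (auto simp: idF_def Hom_def)
qed

lemma is_functor_compF:
  assumes "is_functor C D F" "is_functor D E G"
  shows "is_functor C E (compF C G F)"
proof -
  interpret F: is_functor C D F by fact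
  interpret G: is_functor D E G by fact
  show ?thesis
  proof
    show "FAr (compF C G F) f \<in> Hom E (FOb (compF C G F) a) (FOb (compF C G F) b)" if "f \<in> Hom C a b" for f a b
      using that F.C.Hom_ob[OF that] F.C.Hom_ar[OF that] G.FAr[OF F.FAr[OF that]] by (simp add: compF_def)
    show "FAr (compF C G F) (g \<cdot>\<^bsub>C\<^esub> f) = FAr (compF C G F) g \<cdot>\<^bsub>E\<^esub> FAr (compF C G F) f"
      if f: "f \<in> Hom C a b" and g: "g \<in> Hom C b c" for f g a b c
      using F.F_cmp[OF f g] G.F_cmp[OF F.FAr[OF f] F.FAr[OF g]] F.C.Hom_ar[OF f] F.C.Hom_ar[OF g]
        F.C.Hom_ar[OF F.C.cmp[OF f g]] by (simp add: compF_def)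
  qed (auto simp: compF_def F.FOb G.FOb F.F_idn G.F_idn)
qed

lemma compF_assoc:
  assumes "is_functor C D F"
  shows "compF C (compF D H G) F = compF C H (compF C G F)"
proof -
  interpret F: is_functor C D F by fact
  have "FAr F f \<in> Ar D" if "f \<in> Ar C" for f
    using F.FAr[of f "Dom C f" "Cod C f"] that by (auto simp: Hom_def)
  then show ?thesis by (simp add: compF_def F.FOb cong: restrict_cong)
qed

lemma is_functor_strict:
  "is_functor SPC IMod_strict (strict_functor :: (_, _, ('o, 'a) imod, _) fctr)"
proof (intro is_functor.intro is_functor_axioms.intro category_SPC category_IMod_strict)
  show "FOb strict_functor \<in> extensional (Ob SPC)" "FAr strict_functor \<in> extensional (Ar SPC)"
    by (auto simp: strict_functor_def)
  fix A B C :: "('o, 'a) spc" and f g :: "('o, 'a) spc \<times> ('o, 'a) spc \<times> ('o, 'a) lin_map"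
  show "FOb strict_functor A \<in> Ob IMod_strict" if "A \<in> Ob SPC"
    using that by (simp add: strict_imodule_strict_mod)
  show "FAr strict_functor (Idn SPC A) = Idn IMod_strict (FOb strict_functor A)" if "A \<in> Ob SPC"
    using that imod_id_mor[OF strict_mod_imodule, of A] by (simp add: symmetric_picard.smf_id)
  assume f: "f \<in> Hom SPC A B"
  then obtain F where F: "symmetric_monoidal_functor A B F" "f = (A, B, F)" by (auto simp: SPC_Hom)
  then have "symmetric_picard A" "symmetric_picard B" by (auto simp: symmetric_monoidal_functor_def)
  with F show "FAr strict_functor f \<in> Hom IMod_strict (FOb strict_functor A) (FOb strict_functor B)"
    using strict_pair[OF F(1)] by (auto simp: IMod_strict_Hom IMod_Hom strict_imodule_strict_mod)
  assume "g \<in> Hom SPC B C"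
  then obtain G where G: "symmetric_monoidal_functor B C G" "g = (B, C, G)" by (auto simp: SPC_Hom)
  show "FAr strict_functor (g \<cdot>\<^bsub>SPC\<^esub> f) = FAr strict_functor g \<cdot>\<^bsub>IMod_strict\<^esub> FAr strict_functor f"
    using imod_comp_mor[OF strict_pair[OF F(1)] strict_pair[OF G(1)]] F G smf_comp[OF F(1) G(1)] by simp
qed

lemma forgetful_simps [simp]:
  "imodule M \<Longrightarrow> FOb forgetful M = Und M"
  "imodule_pair M N H \<Longrightarrow> FAr forgetful (mor M N H) = (Und M, Und N, H)"
proof -
  show "imodule M \<Longrightarrow> FOb forgetful M = Und M" by (simp add: forgetful_def)
  assume "imodule_pair M N H"
  then have "mor M N H \<in> Ar IMod" by (auto simp: IMod_Ar)
  then show "FAr forgetful (mor M N H) = (Und M, Und N, H)" by (simp add: forgetful_def mor_def)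
qed

lemma is_functor_forgetful: "is_functor IMod SPC (forgetful :: (('o, 'a) imod, _, _, _) fctr)"
proof (intro is_functor.intro is_functor_axioms.intro category_SPC category_IMod)
  show "FOb forgetful \<in> extensional (Ob IMod)" "FAr forgetful \<in> extensional (Ar IMod)"
    by (auto simp: forgetful_def)
  fix M N P :: "('o, 'a) imod" and f g :: "('o, 'a) imod_mor"
  show "FOb forgetful M \<in> Ob SPC" if "M \<in> Ob IMod"
    using that by (simp add: imodule.Und)
  show "FAr forgetful (Idn IMod M) = Idn SPC (FOb forgetful M)" if "M \<in> Ob IMod"
    using that imod_id_mor[of M] by simp
  assume "f \<in> Hom IMod M N"
  then obtain H where H: "imodule_pair M N H" "f = mor M N H" by (auto simp: IMod_Hom)
  then show "FAr forgetful f \<in> Hom SPC (FOb forgetful M) (FOb forgetful N)"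
    by (simp add: SPC_Hom imodule_pair_iff)
  assume "g \<in> Hom IMod N P"
  then obtain K where K: "imodule_pair N P K" "g = mor N P K" by (auto simp: IMod_Hom)
  show "FAr forgetful (g \<cdot>\<^bsub>IMod\<^esub> f) = FAr forgetful g \<cdot>\<^bsub>SPC\<^esub> FAr forgetful f"
    using H K imod_comp_mor[OF H(1) K(1)] by simp
qed

lemma is_functor_inc: "is_functor IMod_strict IMod (inc :: (('o, 'a) imod, _, _, _) fctr)"
proof (intro is_functor.intro is_functor_axioms.intro category_IMod_strict category_IMod)
  fix M :: "('o, 'a) imod"
  show "FAr inc (Idn IMod_strict M) = Idn IMod (FOb inc M)" if "M \<in> Ob IMod_strict"
    using that imod_id_mor[of M]
    by (auto simp: inc_def idF_def strict_imodule_def IMod_Ar)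
next
  fix M N P :: "('o, 'a) imod" and f g :: "('o, 'a) imod_mor"
  assume f: "f \<in> Hom IMod_strict M N" and g: "g \<in> Hom IMod_strict N P"
  then have "g \<cdot>\<^bsub>IMod_strict\<^esub> f \<in> Hom IMod_strict M P"
    by (rule category.cmp[OF category_IMod_strict])
  with f g show "FAr inc (g \<cdot>\<^bsub>IMod_strict\<^esub> f) = FAr inc g \<cdot>\<^bsub>IMod\<^esub> FAr inc f"
    by (auto simp: inc_def idF_def Hom_def)
qed (auto simp: inc_def idF_def Hom_def strict_imodule_def)

lemma forgetful_strict:
  "compF SPC (compF IMod_strict forgetful inc) strict_functor = (idF SPC :: (('o, 'a) spc, _, _, _) fctr)"
proof -
  have "FAr forgetful (FAr strict_functor f) = f \<and> FAr strict_functor f \<in> Ar IMod_strict" if "f \<in> Ar SPC"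
    for f :: "('o, 'a) spc \<times> ('o, 'a) spc \<times> ('o, 'a) lin_map"
    using that by (auto elim!: SPC_Ar_E simp: strict_pair strict_imodule_strict_mod)
      (auto simp: IMod_Ar intro: strict_pair)
  then show ?thesis
    by (simp add: compF_def idF_def inc_def strict_imodule_strict_mod strict_mod_imodule
        del: IMod_strict_simps(6) cong: restrict_cong)
qed

text \<open>On objects this is \<open>strict_imodule_unique\<close>; on arrows it holds because a
  morphism is determined by its underlying arrow.\<close>

lemma strict_forgetful:
  "compF IMod_strict strict_functor (compF IMod_strict forgetful inc) = (idF IMod_strict :: (('o, 'a) imod, _, _, _) fctr)"
proof -
  have ob: "imodule M \<and> strict_mod (Und M) = M \<and> symmetric_picard (Und M)" if "strict_imodule M" for M :: "('o, 'a) imod"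
    using that strict_imodule_unique[OF that] by (auto simp: strict_imodule_def imodule.Und)
  have ar: "FAr strict_functor (FAr forgetful f) = f" if f: "f \<in> Ar IMod_strict" for f :: "('o, 'a) imod_mor"
  proof -
    from f obtain M N H where H: "imodule_pair M N H" "f = mor M N H" by (auto simp: IMod_Ar)
    with f have "strict_imodule M" "strict_imodule N" by auto
    with H show ?thesis by (simp add: imodule_pair_iff ob)
  qed
  show ?thesis
    by (simp add: compF_def idF_def inc_def ob ar del: IMod_strict_simps(6) strict_functor_simps forgetful_simps
        cong: restrict_cong) (simp add: ob cong: restrict_cong)
qed

lemma isomorphism_strict_functor: "isomorphism_of_categories SPC IMod_strict strict_functor"
  unfolding isomorphism_of_categories_def
  using is_functor_strict is_functor_compF[OF is_functor_inc is_functor_forgetful] forgetful_strict strict_forgetful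
  by blast

lemma equivalence_forgetful:
  "equivalence_with_inverse IMod SPC (forgetful :: (('o, 'a) imod, _, _, _) fctr) (compF SPC inc strict_functor)"
proof -
  let ?\<Psi> = "compF SPC inc strict_functor :: (('o, 'a) spc, _, _, _) fctr"
  have \<Psi>: "is_functor SPC IMod ?\<Psi>" by (rule is_functor_compF[OF is_functor_strict is_functor_inc])
  have \<Psi>_ob: "FOb ?\<Psi> A = strict_mod A" if "symmetric_picard A" for A
    using that by (simp add: compF_def inc_def idF_def strict_imodule_strict_mod)
  have \<Psi>_ar: "FAr ?\<Psi> (A, B, F) = mor (strict_mod A) (strict_mod B) F" if F: "symmetric_monoidal_functor A B F" for A B F
  proof -
    have "symmetric_picard A" "symmetric_picard B" using F by (auto simp: symmetric_monoidal_functor_def)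
    then have "mor (strict_mod A) (strict_mod B) F \<in> Ar IMod_strict"
      using strict_pair[OF F] by (auto simp: strict_imodule_strict_mod IMod_Ar)
    with F show ?thesis by (simp add: compF_def inc_def idF_def del: IMod_strict_simps(6))
  qed
  \<comment> \<open>The identity functor of \<open>Und M\<close> carries unique module structures
    from \<open>M\<close> to the strict module and back. Invertibility and naturality are equations
    between underlying arrows and follow from \<open>comp_id_smf\<close>.\<close>
  have "natural_iso IMod IMod (idF IMod) (compF IMod ?\<Psi> forgetful)
      (\<lambda>M. mor M (strict_mod (Und M)) (id_smf (Und M)))"
    unfolding natural_iso_def
  proof (intro conjI ballI)
    show "is_functor IMod IMod (idF IMod)" by (rule is_functor_idF[OF category_IMod])
    show "is_functor IMod IMod (compF IMod ?\<Psi> forgetful)" by (rule is_functor_compF[OF is_functor_forgetful \<Psi>])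
    fix M :: "('o, 'a) imod" assume "M \<in> Ob IMod"
    then have M: "imodule M" "symmetric_picard (Und M)" "imodule (strict_mod (Und M))"
      by (auto simp: imodule.Und strict_mod_imodule)
    then have pair: "imodule_pair M (strict_mod (Und M)) (id_smf (Und M))" "imodule_pair (strict_mod (Und M)) M (id_smf (Und M))"
      by (auto simp: imodule_pair_iff symmetric_picard.smf_id)
    with M show "mor M (strict_mod (Und M)) (id_smf (Und M)) \<in> Hom IMod (FOb (idF IMod) M) (FOb (compF IMod ?\<Psi> forgetful) M)"
      by (auto simp: IMod_Hom idF_def compF_def[of _ ?\<Psi>] \<Psi>_ob)
    have "inverse_arrows IMod (mor M (strict_mod (Und M)) (id_smf (Und M))) (mor (strict_mod (Und M)) M (id_smf (Und M)))"
      using imod_comp_mor[OF pair] imod_comp_mor[OF pair(2,1)] imod_id_mor[OF M(1)] imod_id_mor[OF M(3)] pair M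
      by (auto simp: inverse_arrows_def IMod_Hom IMod_Ar comp_id_smf symmetric_picard.smf_id)
    then show "\<exists>g. inverse_arrows IMod (mor M (strict_mod (Und M)) (id_smf (Und M))) g" ..
  next
    fix f :: "('o, 'a) imod_mor" assume f: "f \<in> Ar IMod"
    then obtain M N H where H: "imodule_pair M N H" "f = mor M N H" by (auto simp: IMod_Ar)
    then have *: "imodule M" "imodule N" "symmetric_monoidal_functor (Und M) (Und N) H" "symmetric_picard (Und M)"
      "symmetric_picard (Und N)" by (auto simp: imodule_pair_iff imodule.Und)
    let ?S = "\<lambda>M. strict_mod (Und M)"
    have pair: "imodule_pair M (?S M) (id_smf (Und M))" "imodule_pair N (?S N) (id_smf (Und N))"
      "imodule_pair (?S M) (?S N) H"
      using * by (auto simp: imodule_pair_iff symmetric_picard.smf_id strict_mod_imodule)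
    show "mor (Cod IMod f) (?S (Cod IMod f)) (id_smf (Und (Cod IMod f))) \<cdot>\<^bsub>IMod\<^esub> FAr (idF IMod) f =
        FAr (compF IMod ?\<Psi> forgetful) f \<cdot>\<^bsub>IMod\<^esub> mor (Dom IMod f) (?S (Dom IMod f)) (id_smf (Und (Dom IMod f)))"
      using f H * imod_comp_mor[OF H(1) pair(2)] imod_comp_mor[OF pair(1,3)]
      by (simp add: idF_def compF_def[of _ ?\<Psi>] \<Psi>_ar comp_id_smf)
  qed
  moreover have "natural_iso SPC SPC (compF SPC forgetful ?\<Psi>) (idF SPC) (Idn SPC)"
  proof -
    interpret C: category SPC by (rule category_SPC)
    \<comment> \<open>Forgetting the structure of the strict module on \<open>A\<close> returns
      \<open>A\<close> itself, so identities serve as the counit.\<close>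
    have id: "compF SPC forgetful ?\<Psi> = idF SPC"
      using forgetful_strict by (simp add: compF_assoc[OF is_functor_strict])
    have "inverse_arrows SPC (Idn SPC A) (Idn SPC A)" if "A \<in> Ob SPC" for A
      using that C.idn[OF that] C.cmp_idn[OF C.idn[OF that]] by (simp add: inverse_arrows_def Hom_def del: SPC_simps(2-))
    then show ?thesis
      unfolding natural_iso_def id
      by (auto simp: is_functor_idF[OF category_SPC])
        (auto simp: idF_def SPC_Hom comp_id_smf symmetric_picard.smf_id)
  qed
  ultimately show ?thesis
    unfolding equivalence_with_inverse_def using is_functor_forgetful \<Psi> by blast
qed

theorem proposition6p36:
  "\<exists>\<Phi> :: (('o, 'a) spc, ('o, 'a) spc \<times> ('o, 'a) spc \<times> ('o, 'a, 'o, 'a) smf,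
            ('o, 'a) imod, ('o, 'a) imod_mor) fctr.
     isomorphism_of_categories SPC IMod_strict \<Phi> \<and>
     equivalence_with_inverse IMod SPC forgetful (compF SPC inc \<Phi>)"
  using isomorphism_strict_functor equivalence_forgetful by blast

end
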